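(* Let $\alpha,\beta:S^1\to S^1$ be orientation preserving homeomorphisms for neither of which $1$ is a fixed point, and let $\mathcal B_\alpha$, $\mathcal B_\beta$ be the associated $C^*$-algebras. If $\mathcal B_\alpha$ and $\mathcal B_\beta$ are isomorphic, then $\tau(\alpha)=\tau(\beta)$.
   Context: $S^1=\{z\in\mathbb C:|z|=1\}$. A lift of an orientation preserving homeomorphism $\alpha$ of $S^1$ is a continuous $\gamma:\mathbb R\to\mathbb R$ with $\alpha(e^{2\pi it})=e^{2\pi i\gamma(t)}$; it is an increasing homeomorphism with $\gamma(t+1)=\gamma(t)+1$. The rotation number $\tau(\alpha)\in[0,1)$ is the fractional part of $\lim_{n\to\infty}\gamma^n(t)/n$ (independent of $t$ and of the lift). Algebra $\mathcal B_\alpha$ (for $\alpha$ with $\alpha(1)\ne1$): $\gamma$ is the unique lift with $0<\gamma(0)<1$; $\mathbb U$ is the unitary operator on $L^2(\mathbb R)$ given by $(\mathbb Uf)(t)=\sqrt{|\gamma'(t)|}f(\gamma(t))$, a formula which (by monotonicity of $\gamma$) makes sense for almost all $t$; $P$ is the orthogonal projection of $L^2(\mathbb R)$ onto $H=L^2([0,\infty))$; $U=P\mathbb UP\in L(H)$; $\mathcal A\subset L(H)$ is the algebra of operators of multiplication by continuous functions of period $1$; $\mathcal B_\alpha=C^*\big(\bigcup_{n=0}^\infty U^{*n}\mathcal AU^n\big)$, a commutative $C^*$-algebra. Its maximal ideal space is identified with $\widetilde M_\alpha=\bigcup_{N\in\mathbb N}M_N\cup M_\infty\subset\overline{\mathbb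 N}\times S^1$, where $\overline{\mathbb N}=\mathbb N\cup\{\infty\}$ is the one-point compactification of $\mathbb N=\{0,1,\dots\}$, $M_\infty=\{\infty\}\times S^1$ and $M_N=\{N\}\times\{e^{2\pi it}:t\in[\gamma^N(0),\gamma^{N+1}(0)]\}$. The same applies to $\beta$.
   Formalization: The formula for 𝕌 is assumed to define a unitary operator for both α and β (the lift and its inverse are locally absolutely continuous); for singular lifts it gives 𝕌=0, the algebra is C(S¹) for every rotation number, and the claim fails. *)

theory Defs
  imports "HOL-Analysis.Analysis"
begin

section \<open>Circle homeomorphisms, lifts and rotation numbers\<close>

definition is_lift :: "(complex \<Rightarrow> complex) \<Rightarrow> (real \<Rightarrow> real) \<Rightarrow> bool" where
  "is_lift \<alpha> \<gamma> \<longleftrightarrow> continuous_on UNIV \<gamma> \<and> (\<forall>t. \<alpha> (cis (2 * pi * t)) = cis (2 * pi * \<gamma> t))"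

text \<open>A map of the circle is a function on \<open>complex\<close> of which only the restriction to the unit
  circle is ever used.  Two lifts differ by an integer constant, so that some lift is increasing
  iff all lifts are.\<close>

definition orientation_preserving_homeo :: "(complex \<Rightarrow> complex) \<Rightarrow> bool" where
  "orientation_preserving_homeo \<alpha> \<longleftrightarrow>
     (\<exists>\<alpha>'. homeomorphism (sphere 0 1) (sphere 0 1) \<alpha> \<alpha>') \<and>
     (\<exists>\<gamma>. is_lift \<alpha> \<gamma> \<and> strict_mono \<gamma>)"

definition rotation_number :: "(complex \<Rightarrow> complex) \<Rightarrow> real" where
  "rotation_number \<alpha> =
     (let \<gamma> = (SOME \<gamma>. is_lift \<alpha> \<gamma>) in frac (lim (\<lambda>n. (\<gamma> ^^ n) 0 / real n)))"

definition normalized_lift :: "(complex \<Rightarrow> complex) \<Rightarrow> real \<Rightarrow> real" where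
  "normalized_lift \<alpha> = (THE \<gamma>. is_lift \<alpha> \<gamma> \<and> 0 < \<gamma> 0 \<and> \<gamma> 0 < 1)"


section \<open>The complex Hilbert space of square integrable functions on the real line\<close>

definition sq_int :: "(real \<Rightarrow> complex) \<Rightarrow> bool" where
  "sq_int f \<longleftrightarrow> f \<in> borel_measurable lborel \<and> integrable lborel (\<lambda>t. (cmod (f t))\<^sup>2)"

lemma sq_int_measurable: "sq_int f \<Longrightarrow> f \<in> borel_measurable borel"
  by (simp add: sq_int_def)

lemma sq_int_zero: "sq_int (\<lambda>_. 0)"
  by (simp add: sq_int_def)

lemma sq_int_mult:
  assumes "sq_int f" "g \<in> borel_measurable borel" "bounded (range g)"
  shows "sq_int (\<lambda>t. g t * f t)"
proof -
  obtain C where C: "\<And>t. cmod (g t) \<le> C"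
    using assms(3) by (auto simp: bounded_iff)
  have m: "f \<in> borel_measurable borel" using assms(1) by (rule sq_int_measurable)
  have "integrable lborel (\<lambda>t. C\<^sup>2 * (cmod (f t))\<^sup>2)"
    using assms(1) by (simp add: sq_int_def)
  then have "integrable lborel (\<lambda>t. (cmod (g t * f t))\<^sup>2)"
  proof (rule Bochner_Integration.integrable_bound)
    show "(\<lambda>t. (cmod (g t * f t))\<^sup>2) \<in> borel_measurable lborel"
      using m assms(2) by simp
    have "(cmod (g t))\<^sup>2 * (cmod (f t))\<^sup>2 \<le> C\<^sup>2 * (cmod (f t))\<^sup>2" for t
      by (intro mult_right_mono power_mono C) auto
    then show "AE t in lborel. norm ((cmod (g t * f t))\<^sup>2) \<le> norm (C\<^sup>2 * (cmod (f t))\<^sup>2)"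
      by (simp add: norm_mult power_mult_distrib)
  qed
  then show ?thesis using m assms(2) by (simp add: sq_int_def)
qed

lemma sq_int_cmult: "sq_int f \<Longrightarrow> sq_int (\<lambda>t. c * f t)"
  by (rule sq_int_mult) (auto simp: bounded_iff)

lemma sq_int_uminus: "sq_int f \<Longrightarrow> sq_int (\<lambda>t. - f t)"
  using sq_int_cmult[of f "-1"] by simp

lemma sq_int_scaleR: "sq_int f \<Longrightarrow> sq_int (\<lambda>t. r *\<^sub>R f t)"
  using sq_int_cmult[of f "of_real r"] by (simp add: scaleR_conv_of_real)

lemma sq_int_product:
  assumes "sq_int f" "sq_int g"
  shows "integrable lborel (\<lambda>t. f t * cnj (g t))"
proof -
  have m: "f \<in> borel_measurable borel" "g \<in> borel_measurable borel"
    using assms by (auto intro: sq_int_measurable)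
  have mc: "(\<lambda>t. cnj (g t)) \<in> borel_measurable borel"
    using m(2) by (rule borel_measurable_continuous_on[rotated]) (intro continuous_intros)
  have "integrable lborel (\<lambda>t. (cmod (f t))\<^sup>2 + (cmod (g t))\<^sup>2)"
    using assms by (simp add: sq_int_def)
  then show ?thesis
  proof (rule Bochner_Integration.integrable_bound)
    show "(\<lambda>t. f t * cnj (g t)) \<in> borel_measurable lborel"
      using m mc by simp
    have "x * y \<le> x\<^sup>2 + y\<^sup>2" if "0 \<le> x" "0 \<le> y" for x y :: real
      using sum_squares_bound[of x y] that mult_nonneg_nonneg[of x y] by linarith
    then show "AE t in lborel. norm (f t * cnj (g t)) \<le> norm ((cmod (f t))\<^sup>2 + (cmod (g t))\<^sup>2)"
      by (simp add: norm_mult)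
  qed
qed

lemma sq_int_add:
  assumes "sq_int f" "sq_int g"
  shows "sq_int (\<lambda>t. f t + g t)"
proof -
  have m: "f \<in> borel_measurable borel" "g \<in> borel_measurable borel"
    using assms by (auto intro: sq_int_measurable)
  have "integrable lborel (\<lambda>t. 2 * (cmod (f t))\<^sup>2 + 2 * (cmod (g t))\<^sup>2)"
    using assms by (simp add: sq_int_def)
  then have "integrable lborel (\<lambda>t. (cmod (f t + g t))\<^sup>2)"
  proof (rule Bochner_Integration.integrable_bound)
    show "(\<lambda>t. (cmod (f t + g t))\<^sup>2) \<in> borel_measurable lborel"
      using m by simp
    have "(cmod (x + y))\<^sup>2 \<le> 2 * (cmod x)\<^sup>2 + 2 * (cmod y)\<^sup>2" for x y :: complex
    proof -
      have "(cmod (x + y))\<^sup>2 \<le> (cmod x + cmod y)\<^sup>2"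
        by (intro power_mono norm_triangle_ineq) auto
      also have "\<dots> \<le> 2 * (cmod x)\<^sup>2 + 2 * (cmod y)\<^sup>2"
        using sum_squares_bound[of "cmod x" "cmod y"] by (simp add: power2_sum)
      finally show ?thesis .
    qed
    then show "AE t in lborel. norm ((cmod (f t + g t))\<^sup>2)
        \<le> norm (2 * (cmod (f t))\<^sup>2 + 2 * (cmod (g t))\<^sup>2)"
      by simp
  qed
  then show ?thesis using m by (simp add: sq_int_def)
qed

lemma sq_int_diff: "sq_int f \<Longrightarrow> sq_int g \<Longrightarrow> sq_int (\<lambda>t. f t - g t)"
  using sq_int_add[of f "\<lambda>t. - g t"] sq_int_uminus[of g] by simp

definition l2_eq :: "(real \<Rightarrow> complex) \<Rightarrow> (real \<Rightarrow> complex) \<Rightarrow> bool" where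
  "l2_eq f g \<longleftrightarrow> sq_int f \<and> sq_int g \<and> (AE t in lborel. f t = g t)"

quotient_type L2 = "real \<Rightarrow> complex" / partial: l2_eq
proof (rule part_equivpI)
  show "\<exists>f. l2_eq f f"
    by (rule exI[of _ "\<lambda>_. 0"]) (simp add: l2_eq_def sq_int_zero)
  show "symp l2_eq"
    by (auto simp: symp_def l2_eq_def)
  show "transp l2_eq"
    unfolding transp_def l2_eq_def by (auto elim: AE_mp)
qed

lift_definition to_L2 :: "(real \<Rightarrow> complex) \<Rightarrow> L2" is
  "\<lambda>f. if sq_int f then f else (\<lambda>_. 0)"
  by (simp add: l2_eq_def sq_int_zero)

text \<open>The inner product is linear in the first argument.\<close>

lift_definition cinner :: "L2 \<Rightarrow> L2 \<Rightarrow> complex" is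
  "\<lambda>f g. LINT t|lborel. f t * cnj (g t)"
proof -
  fix f f' g g' :: "real \<Rightarrow> complex"
  assume h: "l2_eq f f'" "l2_eq g g'"
  then have m: "integrable lborel (\<lambda>t. f t * cnj (g t))" "integrable lborel (\<lambda>t. f' t * cnj (g' t))"
    by (auto intro: sq_int_product simp: l2_eq_def)
  have ae: "AE t in lborel. f t = f' t" "AE t in lborel. g t = g' t"
    using h by (auto simp: l2_eq_def)
  show "(LINT t|lborel. f t * cnj (g t)) = (LINT t|lborel. f' t * cnj (g' t))"
    by (rule integral_cong_AE) (use m ae in auto)
qed

text \<open>For a multiplier that is not a bounded Borel function the value is a dummy.\<close>

lift_definition L2_times :: "(real \<Rightarrow> complex) \<Rightarrow> L2 \<Rightarrow> L2" is
  "\<lambda>g f. if g \<in> borel_measurable borel \<and> bounded (range g) then (\<lambda>t. g t * f t) else (\<lambda>_. 0)"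
  by (auto simp: l2_eq_def sq_int_zero intro: sq_int_mult)

instantiation L2 :: real_vector
begin

lift_definition zero_L2 :: L2 is "\<lambda>_. 0"
  by (simp add: l2_eq_def sq_int_zero)

lift_definition plus_L2 :: "L2 \<Rightarrow> L2 \<Rightarrow> L2" is "\<lambda>f g t. f t + g t"
  by (auto simp: l2_eq_def intro: sq_int_add)

lift_definition uminus_L2 :: "L2 \<Rightarrow> L2" is "\<lambda>f t. - f t"
  by (auto simp: l2_eq_def intro: sq_int_uminus)

lift_definition minus_L2 :: "L2 \<Rightarrow> L2 \<Rightarrow> L2" is "\<lambda>f g t. f t - g t"
  by (auto simp: l2_eq_def intro: sq_int_diff)

lift_definition scaleR_L2 :: "real \<Rightarrow> L2 \<Rightarrow> L2" is "\<lambda>r f t. r *\<^sub>R f t"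
  by (auto simp: l2_eq_def intro: sq_int_scaleR)

instance
proof
  fix F G K :: L2 and r s :: real
  show "F + G + K = F + (G + K)"
    by transfer (simp add: l2_eq_def sq_int_add add.assoc)
  show "F + G = G + F"
    by transfer (simp add: l2_eq_def sq_int_add add.commute)
  show "0 + F = F"
    by transfer (simp add: l2_eq_def)
  show "- F + F = 0"
    by transfer (simp add: l2_eq_def sq_int_zero)
  show "F - G = F + - G"
    by transfer (simp add: l2_eq_def sq_int_diff)
  show "r *\<^sub>R (F + G) = r *\<^sub>R F + r *\<^sub>R G"
    by transfer (simp add: l2_eq_def sq_int_add sq_int_scaleR scaleR_add_right)
  show "(r + s) *\<^sub>R F = r *\<^sub>R F + s *\<^sub>R F"
    by transfer (simp add: l2_eq_def sq_int_add sq_int_scaleR scaleR_add_left)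
  show "r *\<^sub>R s *\<^sub>R F = (r * s) *\<^sub>R F"
    by transfer (simp add: l2_eq_def sq_int_scaleR)
  show "1 *\<^sub>R F = F"
    by transfer (simp add: l2_eq_def)
qed

end

lemma cinner_add_left: "cinner (F + G) K = cinner F K + cinner G K"
  by transfer (auto simp: l2_eq_def distrib_right sq_int_product Bochner_Integration.integral_add)

lemma cinner_commute: "cinner F G = cnj (cinner G F)"
  by transfer (subst Bochner_Integration.integral_cnj[symmetric], simp add: mult.commute)

lemma cinner_scaleR_left: "cinner (r *\<^sub>R F) G = of_real r * cinner F G"
  by transfer (simp add: scaleR_conv_of_real mult.assoc)

lemma cinner_self: "Im (cinner F F) = 0" "0 \<le> Re (cinner F F)"
  "cinner F F = 0 \<longleftrightarrow> F = 0"
proof -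
  show "Im (cinner F F) = 0"
    using arg_cong[OF cinner_commute[of F F], of Im] by simp
  show "0 \<le> Re (cinner F F)"
  proof transfer
    fix f assume "l2_eq f f"
    have "(LINT t|lborel. f t * cnj (f t)) = of_real (LINT t|lborel. (cmod (f t))\<^sup>2)"
      unfolding integral_complex_of_real[symmetric] by (simp add: complex_norm_square del: of_real_power)
    then show "0 \<le> Re (LINT t|lborel. f t * cnj (f t))" by simp
  qed
  show "cinner F F = 0 \<longleftrightarrow> F = 0"
  proof transfer
    fix f assume f: "l2_eq f f"
    have "(LINT t|lborel. f t * cnj (f t)) = of_real (LINT t|lborel. (cmod (f t))\<^sup>2)"
      unfolding integral_complex_of_real[symmetric] by (simp add: complex_norm_square del: of_real_power)
    moreover have "(LINT t|lborel. (cmod (f t))\<^sup>2) = 0 \<longleftrightarrow> (AE t in lborel. (cmod (f t))\<^sup>2 = 0)"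
      using f by (intro integral_nonneg_eq_0_iff_AE) (auto simp: l2_eq_def sq_int_def)
    ultimately show "(LINT t|lborel. f t * cnj (f t)) = 0 \<longleftrightarrow> l2_eq f (\<lambda>_. 0)"
      using f by (simp add: l2_eq_def sq_int_zero)
  qed
qed

instantiation L2 :: real_inner
begin

definition inner_L2 :: "L2 \<Rightarrow> L2 \<Rightarrow> real" where
  "inner_L2 F G = Re (cinner F G)"

definition norm_L2 :: "L2 \<Rightarrow> real" where
  "norm_L2 F = sqrt (inner F F)"

definition dist_L2 :: "L2 \<Rightarrow> L2 \<Rightarrow> real" where
  "dist_L2 F G = norm (F - G)"

definition sgn_L2 :: "L2 \<Rightarrow> L2" where
  "sgn_L2 F = inverse (norm F) *\<^sub>R F"

definition uniformity_L2 :: "(L2 \<times> L2) filter" where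
  "uniformity_L2 = (INF e\<in>{0<..}. principal {(x, y). dist x y < e})"

definition open_L2 :: "L2 set \<Rightarrow> bool" where
  "open_L2 S \<longleftrightarrow> (\<forall>x\<in>S. \<forall>\<^sub>F (x', y) in uniformity. x' = x \<longrightarrow> y \<in> S)"

instance
proof
  fix F G K :: L2 and r :: real
  show "inner F G = inner G F"
    using cinner_commute[of F G] by (simp add: inner_L2_def)
  show "inner (F + G) K = inner F K + inner G K"
    by (simp add: inner_L2_def cinner_add_left)
  show "inner (r *\<^sub>R F) G = r * inner F G"
    by (simp add: inner_L2_def cinner_scaleR_left)
  show "0 \<le> inner F F"
    unfolding inner_L2_def by (rule cinner_self(2))
  show "inner F F = 0 \<longleftrightarrow> F = 0"
    using cinner_self(1,3)[of F] by (simp add: inner_L2_def complex_eq_iff)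
qed (simp_all add: dist_L2_def norm_L2_def sgn_L2_def uniformity_L2_def open_L2_def)

end


section \<open>Operators\<close>

text \<open>The type \<open>L2 \<Rightarrow>\<^sub>L L2\<close> consists of the bounded real-linear operators with the operator norm;
  complex linearity is imposed where the algebra of operators is introduced.\<close>

lemma L2_obtain:
  obtains f where "sq_int f" "F = to_L2 f"
proof -
  have "\<exists>f. sq_int f \<and> F = to_L2 f"
    by transfer (auto simp: l2_eq_def)
  then show ?thesis using that by blast
qed

lemma cinner_L2_times_le:
  assumes g: "g \<in> borel_measurable borel" and C: "\<And>t. cmod (g t) \<le> C"
  shows "Re (cinner (L2_times g F) (L2_times g F)) \<le> C\<^sup>2 * Re (cinner F F)"
proof -
  have b: "bounded (range g)" using C by (auto simp: bounded_iff)
  obtain f where f: "sq_int f" "F = to_L2 f" by (rule L2_obtain)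
  have sq: "Re (cinner (to_L2 h) (to_L2 h)) = (LINT t|lborel. (cmod (h t))\<^sup>2)" if "sq_int h" for h
    using that
  proof transfer
    fix h :: "real \<Rightarrow> complex" assume h: "sq_int h"
    have "(LINT t|lborel. h t * cnj (h t)) = of_real (LINT t|lborel. (cmod (h t))\<^sup>2)"
      unfolding integral_complex_of_real[symmetric] by (simp add: complex_norm_square del: of_real_power)
    with h show "Re (LINT t|lborel. (if sq_int h then h else (\<lambda>_. 0)) t *
        cnj ((if sq_int h then h else (\<lambda>_. 0)) t)) = (LINT t|lborel. (cmod (h t))\<^sup>2)"
      by simp
  qed
  have gf: "sq_int (\<lambda>t. g t * f t)" using f(1) g b by (rule sq_int_mult)
  have "L2_times g (to_L2 f) = to_L2 (\<lambda>t. g t * f t)"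
    using f(1) gf g b by transfer (simp add: l2_eq_def)
  moreover have "(LINT t|lborel. (cmod (g t * f t))\<^sup>2) \<le> (LINT t|lborel. C\<^sup>2 * (cmod (f t))\<^sup>2)"
  proof (rule integral_mono)
    show "(cmod (g t * f t))\<^sup>2 \<le> C\<^sup>2 * (cmod (f t))\<^sup>2" for t
      by (simp add: norm_mult power_mult_distrib C mult_right_mono power_mono)
  qed (use f gf in \<open>auto simp: sq_int_def\<close>)
  ultimately show ?thesis using f gf by (simp add: sq)
qed

lemma bounded_linear_L2_times: "bounded_linear (L2_times g)"
proof (cases "g \<in> borel_measurable borel \<and> bounded (range g)")
  case True
  then obtain C where C: "\<And>t. cmod (g t) \<le> C"
    by (auto simp: bounded_iff)
  have C0: "0 \<le> C" using C[of 0] norm_ge_zero order_trans by blast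
  show ?thesis
  proof
    show "L2_times g (F + G) = L2_times g F + L2_times g G" for F G
      using True by transfer (auto simp: l2_eq_def distrib_left intro!: sq_int_mult sq_int_add)
    show "L2_times g (r *\<^sub>R F) = r *\<^sub>R L2_times g F" for r F
      using True
      by transfer (auto simp: l2_eq_def
          intro!: sq_int_mult sq_int_scaleR)
    have "norm (L2_times g F) \<le> norm F * C" for F
    proof (rule power2_le_imp_le)
      show "(norm (L2_times g F))\<^sup>2 \<le> (norm F * C)\<^sup>2"
        using cinner_L2_times_le[of g C F] True C
        by (simp add: power2_norm_eq_inner inner_L2_def power_mult_distrib mult.commute)
    qed (simp add: C0)
    then show "\<exists>K. \<forall>F. norm (L2_times g F) \<le> norm F * K" by blast
  qed
next
  case False
  then have "L2_times g = (\<lambda>_. 0)"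
    by (intro ext) (transfer, auto simp: l2_eq_def sq_int_zero)
  then show ?thesis by (simp add: bounded_linear_zero)
qed

lift_definition mult_op :: "(real \<Rightarrow> complex) \<Rightarrow> L2 \<Rightarrow>\<^sub>L L2" is L2_times
  by (rule bounded_linear_L2_times)

abbreviation scalar_op :: "complex \<Rightarrow> L2 \<Rightarrow>\<^sub>L L2" where
  "scalar_op c \<equiv> mult_op (\<lambda>_. c)"

definition clinear_op :: "(L2 \<Rightarrow>\<^sub>L L2) \<Rightarrow> bool" where
  "clinear_op T \<longleftrightarrow> (\<forall>c F. T (scalar_op c F) = scalar_op c (T F))"

definition adj :: "(L2 \<Rightarrow>\<^sub>L L2) \<Rightarrow> L2 \<Rightarrow>\<^sub>L L2" where
  "adj T = (THE S :: L2 \<Rightarrow>\<^sub>L L2. \<forall>F G. cinner (T F) G = cinner F (S G))"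

definition unitary_op :: "(L2 \<Rightarrow>\<^sub>L L2) \<Rightarrow> bool" where
  "unitary_op W \<longleftrightarrow> (\<forall>F G. cinner (W F) (W G) = cinner F G) \<and> surj (blinfun_apply W)"

definition orth_proj :: "L2 set \<Rightarrow> L2 \<Rightarrow>\<^sub>L L2" where
  "orth_proj S = (THE Q :: L2 \<Rightarrow>\<^sub>L L2. \<forall>F. Q F \<in> S \<and> (\<forall>G\<in>S. cinner (F - Q F) G = 0))"

text \<open>\<open>half_line_L2\<close> is \<open>L\<^sup>2([0,\<infinity>))\<close>, with functions extended by zero to the real line.\<close>

definition half_line_L2 :: "L2 set" where
  "half_line_L2 = to_L2 ` {f. sq_int f \<and> (\<forall>t<0. f t = 0)}"

definition projH :: "L2 \<Rightarrow>\<^sub>L L2" where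
  "projH = orth_proj half_line_L2"

text \<open>A bounded operator on \<open>half_line_L2\<close> is identified with its extension by zero to the
  orthogonal complement; this respects norms, adjoints and composition, and turns the identity
  operator (in particular every zeroth power) into \<open>projH\<close>.\<close>

definition ops_on_H :: "(L2 \<Rightarrow>\<^sub>L L2) set" where
  "ops_on_H = {T. clinear_op T \<and> projH o\<^sub>L T o\<^sub>L projH = T}"

primrec op_power :: "(L2 \<Rightarrow>\<^sub>L L2) \<Rightarrow> nat \<Rightarrow> L2 \<Rightarrow>\<^sub>L L2" where
  "op_power T 0 = projH"
| "op_power T (Suc n) = T o\<^sub>L op_power T n"

definition cstar_subalgebra :: "(L2 \<Rightarrow>\<^sub>L L2) set \<Rightarrow> bool" where
  "cstar_subalgebra X \<longleftrightarrow> X \<subseteq> ops_on_H \<and> closed X \<and> 0 \<in> X \<and>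
     (\<forall>S\<in>X. \<forall>T\<in>X. S + T \<in> X \<and> S o\<^sub>L T \<in> X) \<and>
     (\<forall>c. \<forall>T\<in>X. scalar_op c o\<^sub>L T \<in> X) \<and>
     (\<forall>T\<in>X. adj T \<in> X)"

definition cstar_generated :: "(L2 \<Rightarrow>\<^sub>L L2) set \<Rightarrow> (L2 \<Rightarrow>\<^sub>L L2) set" where
  "cstar_generated S = \<Inter> {X. cstar_subalgebra X \<and> S \<subseteq> X}"

text \<open>Isomorphism of $C^*$-algebras means \<open>*\<close>-isomorphism, which is automatically isometric.\<close>

definition cstar_isomorphic :: "(L2 \<Rightarrow>\<^sub>L L2) set \<Rightarrow> (L2 \<Rightarrow>\<^sub>L L2) set \<Rightarrow> bool" where
  "cstar_isomorphic X Y \<longleftrightarrow> (\<exists>\<Phi>. bij_betw \<Phi> X Y \<and>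
     (\<forall>S\<in>X. \<forall>T\<in>X. \<Phi> (S + T) = \<Phi> S + \<Phi> T \<and> \<Phi> (S o\<^sub>L T) = \<Phi> S o\<^sub>L \<Phi> T) \<and>
     (\<forall>c. \<forall>T\<in>X. \<Phi> (scalar_op c o\<^sub>L T) = scalar_op c o\<^sub>L \<Phi> T) \<and>
     (\<forall>T\<in>X. \<Phi> (adj T) = adj (\<Phi> T)))"


section \<open>The algebra of a circle homeomorphism\<close>

text \<open>A monotone function is differentiable almost everywhere, so the values of \<open>deriv\<close> at points
  of non-differentiability are immaterial.\<close>

definition weighted_comp :: "(real \<Rightarrow> real) \<Rightarrow> (real \<Rightarrow> complex) \<Rightarrow> real \<Rightarrow> complex" where
  "weighted_comp \<gamma> f t = of_real (sqrt \<bar>deriv \<gamma> t\<bar>) * f (\<gamma> t)"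

definition induces :: "(real \<Rightarrow> real) \<Rightarrow> (L2 \<Rightarrow>\<^sub>L L2) \<Rightarrow> bool" where
  "induces \<gamma> W \<longleftrightarrow>
     (\<forall>f. sq_int f \<longrightarrow> sq_int (weighted_comp \<gamma> f) \<and> W (to_L2 f) = to_L2 (weighted_comp \<gamma> f))"

text \<open>For a general homeomorphism \<open>\<alpha>\<close> the operator \<open>bbU \<alpha>\<close> need not be unitary: it vanishes when the
  lift has derivative zero almost everywhere.  Its unitarity amounts to local absolute continuity
  of the lift and of its inverse.\<close>

definition bbU :: "(complex \<Rightarrow> complex) \<Rightarrow> L2 \<Rightarrow>\<^sub>L L2" where
  "bbU \<alpha> = (THE W. induces (normalized_lift \<alpha>) W)"

definition compr_U :: "(complex \<Rightarrow> complex) \<Rightarrow> L2 \<Rightarrow>\<^sub>L L2" where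
  "compr_U \<alpha> = projH o\<^sub>L bbU \<alpha> o\<^sub>L projH"

definition periodic_mult_algebra :: "(L2 \<Rightarrow>\<^sub>L L2) set" where
  "periodic_mult_algebra =
     {projH o\<^sub>L mult_op a o\<^sub>L projH | a. continuous_on UNIV a \<and> (\<forall>t. a (t + 1) = a t)}"

definition circle_algebra :: "(complex \<Rightarrow> complex) \<Rightarrow> (L2 \<Rightarrow>\<^sub>L L2) set" where
  "circle_algebra \<alpha> = cstar_generated
     (\<Union>n. (\<lambda>A. op_power (adj (compr_U \<alpha>)) n o\<^sub>L A o\<^sub>L op_power (compr_U \<alpha>) n)
            ` periodic_mult_algebra)"


subsection \<open>Values of the definite descriptions\<close>

lemma cinner_to_L2:
  assumes "sq_int f" "sq_int g"
  shows "cinner (to_L2 f) (to_L2 g) = (LINT t|lborel. f t * cnj (g t))"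
  using assms by transfer simp

lemma mult_op_to_L2:
  assumes "g \<in> borel_measurable borel" "bounded (range g)" "sq_int f"
  shows "mult_op g (to_L2 f) = to_L2 (\<lambda>t. g t * f t)"
  using assms(3) sq_int_mult[OF assms(3,1,2)] assms(1,2) unfolding mult_op.rep_eq
  by transfer (simp add: l2_eq_def)

lemma cinner_diff_left: "cinner (F - G) K = cinner F K - cinner G K"
  using cinner_add_left[of "F - G" G K] by simp

lemma cinner_diff_right: "cinner K (F - G) = cinner K F - cinner K G"
  unfolding cinner_commute[of K] by (simp add: cinner_diff_left)

lemma adj_eqI:
  fixes T S :: "L2 \<Rightarrow>\<^sub>L L2"
  assumes "\<And>F G. cinner (T F) G = cinner F (S G)"
  shows "adj T = S"
  unfolding adj_def
proof (rule the_equality)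
  fix S' :: "L2 \<Rightarrow>\<^sub>L L2" assume S': "\<forall>F G. cinner (T F) G = cinner F (S' G)"
  show "S' = S"
  proof (rule blinfun_eqI)
    fix G
    have "cinner (S' G - S G) (S' G - S G) = 0"
      unfolding cinner_diff_right using S' by (simp flip: assms)
    then show "S' G = S G" using cinner_self(3) by simp
  qed
qed (use assms in blast)

lemma induces_unique:
  assumes "induces (normalized_lift \<alpha>) W"
  shows "bbU \<alpha> = W"
  unfolding bbU_def
proof (rule the_equality[where P = "induces (normalized_lift \<alpha>)", OF assms])
  fix W' assume "induces (normalized_lift \<alpha>) W'"
  show "W' = W"
  proof (intro blinfun_eqI)
    fix F
    obtain f where "sq_int f" "F = to_L2 f" by (rule L2_obtain)
    then show "W' F = W F"
      using assms \<open>induces (normalized_lift \<alpha>) W'\<close> by (simp add: induces_def)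
  qed
qed

lemma projH_eq_mult_op: "projH = mult_op (indicator {0..})"
  unfolding projH_def orth_proj_def
proof (rule the_equality)
  let ?i = "indicator {0..} :: real \<Rightarrow> complex"
  have i: "?i \<in> borel_measurable borel" "bounded (range ?i)"
    by (auto simp: bounded_iff indicator_def intro!: exI[of _ 1])
  show *: "\<forall>F. mult_op ?i F \<in> half_line_L2 \<and> (\<forall>G\<in>half_line_L2. cinner (F - mult_op ?i F) G = 0)"
  proof (intro allI conjI ballI)
    fix F
    obtain f where f: "sq_int f" "F = to_L2 f" by (rule L2_obtain)
    have if_: "sq_int (\<lambda>t. ?i t * f t)" using f(1) i by (rule sq_int_mult)
    show "mult_op ?i F \<in> half_line_L2"
      unfolding f(2) mult_op_to_L2[OF i f(1)] half_line_L2_def using if_ by (intro imageI) auto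
    fix G assume "G \<in> half_line_L2"
    then obtain g where g: "G = to_L2 g" "sq_int g" "\<forall>t<0. g t = 0" by (auto simp: half_line_L2_def)
    have "(\<lambda>t. ?i t * f t * cnj (g t)) = (\<lambda>t. f t * cnj (g t))"
      using g(3) by (auto simp: indicator_def fun_eq_iff not_le)
    then show "cinner (F - mult_op ?i F) G = 0"
      using f g if_ by (simp add: mult_op_to_L2[OF i] cinner_diff_left cinner_to_L2)
  qed
  fix P' :: "L2 \<Rightarrow>\<^sub>L L2"
  assume P': "\<forall>F. P' F \<in> half_line_L2 \<and> (\<forall>G\<in>half_line_L2. cinner (F - P' F) G = 0)"
  show "P' = mult_op ?i"
  proof (rule blinfun_eqI)
    fix F
    have "cinner (P' F - mult_op ?i F) G = 0" if "G \<in> half_line_L2" for G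
    proof -
      have "cinner (F - P' F) G = 0" "cinner (F - mult_op ?i F) G = 0"
        using that P' * by blast+
      then show ?thesis by (simp add: cinner_diff_left)
    qed
    then have "cinner (P' F - mult_op ?i F) (P' F - mult_op ?i F) = 0"
      using P' * by (subst cinner_diff_right) simp
    then show "P' F = mult_op ?i F" using cinner_self(3) by simp
  qed
qed

end

theory Submission
  imports Defs
begin

text \<open>With \<open>x N = \<gamma>\<^sup>N 0\<close>, conjugation by \<open>U\<^sup>n\<close> turns a periodic multiplier into one cut off to
  \<open>[x n, \<infinity>)\<close>. Hence the algebra consists of the continuous functions on a compact space: one circle
  at height \<open>0\<close> and the arcs \<open>[x N, x (N + 1)]\<close> mod \<open>1\<close> at heights \<open>1 / (N + 1)\<close>. An isomorphism of the
  algebras is induced by a homeomorphism of these spaces. It permutes the levels, fixes the limit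
  circle, on which it has a lift \<open>G\<close>, and takes the end points of arcs to end points of arcs. Far down
  the sequence of arcs it is close to \<open>G\<close>, so that \<open>G\<close> carries the pair \<open>(x N, \<gamma> (x N))\<close> almost, up
  to integers, to a pair \<open>(y, \<delta> y)\<close> or \<open>(\<delta> y, y)\<close>, according to the orientation of \<open>G\<close>. Along the
  orbit of a limit point \<open>z\<close> of the \<open>x N\<close> mod \<open>1\<close> therefore \<open>\<delta> \<circ> G = G \<circ> \<gamma>\<close> or \<open>\<delta> \<circ> G \<circ> \<gamma> = G\<close>
  exactly, and in both cases the translation numbers agree.\<close>

section \<open>Lifts and translation numbers\<close>

text \<open>A homeomorphism of the spectra forgets the order of the arcs: arc \<open>N\<close> may
  go to an arc \<open>M\<close> unrelated to \<open>N\<close>, so there is no reason for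
  \<open>G\<close> to conjugate the two circle maps. What survives is that the two ends of an arc
  are one step of the dynamics apart. This is why a relation is found only near the points
  \<open>x N\<close>, and only asymptotically, and why it becomes exact only at limit points. The
  normalization 0 < \<gamma> 0 < 1 makes every arc shorter than a full turn. An arc is then a single
  interval, whose ends are shifted by the same integer. Hence the limit relation holds in the reals
  and not just modulo 1, and the translation numbers themselves coincide. If \<open>G\<close>
  reverses orientation, it relates \<gamma> to the inverse of \<delta>; reversal and inversion each
  change the sign of the translation number, so that equality results again. If the
  \<open>x N\<close> stay bounded, the arcs shrink to one point of the limit circle. The whole
  circle still belongs to the spectrum, because of the half line beyond all \<open>x N\<close>; this
  case is not treated separately.\<close>

lemma cis_2pi_eq_iff: "cis (2 * pi * s) = cis (2 * pi * t) \<longleftrightarrow> s - t \<in> \<int>"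
proof
  assume "cis (2 * pi * s) = cis (2 * pi * t)"
  then have "sin (2 * pi * s) = sin (2 * pi * t) \<and> cos (2 * pi * s) = cos (2 * pi * t)"
    by (auto simp: complex_eq_iff)
  then obtain n :: int where "2 * pi * s = 2 * pi * t + 2 * pi * n"
    unfolding sin_cos_eq_iff by blast
  then have "2 * pi * s = 2 * pi * (t + n)" by (simp add: distrib_left)
  then have "s - t = n" by simp
  then show "s - t \<in> \<int>" by simp
next
  assume "s - t \<in> \<int>"
  then have "cis (2 * pi * t) * cis (2 * pi * (s - t)) = cis (2 * pi * t)" by simp
  then show "cis (2 * pi * s) = cis (2 * pi * t)" by (simp add: cis_mult algebra_simps)
qed

lemma unit_circle_cis_2pi:
  assumes "z \<in> sphere 0 1"
  obtains t where "t \<in> {0..<1}" "z = cis (2 * pi * t)"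
proof -
  have "z = cis (2 * pi * frac (Arg z / (2 * pi)))"
  proof -
    have "z = cis (2 * pi * (Arg z / (2 * pi)))"
      using assms cis_Arg[of z] by (cases "z = 0") (auto simp: sgn_eq)
    also have "\<dots> = cis (2 * pi * frac (Arg z / (2 * pi)))"
      unfolding cis_2pi_eq_iff by (simp add: frac_def)
    finally show ?thesis .
  qed
  then show ?thesis by (intro that[of "frac (Arg z / (2 * pi))"]) (auto simp: frac_lt_1)
qed

lemma norm_cis_2pi_minus_one: "cmod (cis (2 * pi * d) - 1) = 2 * \<bar>sin (pi * d)\<bar>"
proof -
  have "cmod (cis (2 * pi * d) - 1) = cmod (cis (pi * d) - cis (- (pi * d)))"
  proof -
    have "cis (2 * pi * d) - 1 = cis (pi * d) * (cis (pi * d) - cis (- (pi * d)))"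
      by (simp add: right_diff_distrib cis_mult mult.assoc)
    then show ?thesis by (simp add: norm_mult)
  qed
  also have "cis (pi * d) - cis (- (pi * d)) = Complex 0 (2 * sin (pi * d))"
    by (simp add: complex_eq_iff)
  also have "cmod \<dots> = 2 * \<bar>sin (pi * d)\<bar>" by (simp add: cmod_def real_sqrt_mult)
  finally show ?thesis .
qed

lemma Ints_valued_constant:
  fixes f :: "real \<Rightarrow> real"
  assumes "connected S" "continuous_on S f" "\<And>t. t \<in> S \<Longrightarrow> f t \<in> \<int>"
  obtains k :: int where "\<And>t. t \<in> S \<Longrightarrow> f t = k"
proof -
  have "f constant_on S"
  proof (rule continuous_discrete_range_constant[OF assms(1,2)])
    fix x assume x: "x \<in> S"
    have "1 \<le> norm (f y - f x)" if "y \<in> S" "f y \<noteq> f x" for y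
      using Ints_nonzero_abs_ge1[of "f y - f x"] assms(3)[OF x] assms(3)[OF that(1)] that(2) by simp
    then show "\<exists>e>0. \<forall>y. y \<in> S \<and> f y \<noteq> f x \<longrightarrow> e \<le> norm (f y - f x)"
      by (intro exI[of _ 1]) auto
  qed
  then obtain c where c: "\<And>t. t \<in> S \<Longrightarrow> f t = c" by (auto simp: constant_on_def)
  show ?thesis
  proof (cases "S = {}")
    case False
    then obtain t where "t \<in> S" by blast
    then have "c \<in> \<int>" using assms(3) c by metis
    then obtain k :: int where "c = k" by (auto elim: Ints_cases)
    then show ?thesis using c that by blast
  qed (use that in blast)
qed

lemma lifts_differ_by_int:
  assumes "is_lift \<alpha> \<gamma>" "is_lift \<alpha> \<gamma>'"
  obtains k :: int where "\<And>t. \<gamma>' t = \<gamma> t + k"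
proof -
  have "continuous_on UNIV (\<lambda>t. \<gamma>' t - \<gamma> t)"
    using assms by (auto simp: is_lift_def intro: continuous_intros)
  moreover have "\<gamma>' t - \<gamma> t \<in> \<int>" for t
    using assms unfolding is_lift_def by (metis cis_2pi_eq_iff)
  ultimately obtain k :: int where k: "\<And>t. \<gamma>' t - \<gamma> t = k"
    using Ints_valued_constant[of UNIV "\<lambda>t. \<gamma>' t - \<gamma> t"] by auto
  have "\<gamma>' t = \<gamma> t + k" for t using k[of t] by linarith
  then show ?thesis by (rule that)
qed

lemma shift_int:
  fixes G :: "real \<Rightarrow> real" and k :: int and t d :: real
  assumes "\<And>t. G (t + 1) = G t + d"
  shows "G (t + k) = G t + k * d"
proof (induction k arbitrary: t rule: int_induct[where k = 0])
  case (step1 i)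
  then show ?case using assms[of "t + i"] by (simp add: algebra_simps)
next
  case (step2 i)
  then show ?case using assms[of "t + (i - 1)"] by (simp add: algebra_simps)
qed simp

lemma periodic_int:
  assumes "\<And>t. b (t + 1 :: real) = b t"
  shows "b (t + of_int k) = b t"
proof (induction k arbitrary: t rule: int_induct[where k = 0])
  case (step1 i)
  then show ?case using assms[of "t + of_int i"] by (simp add: algebra_simps)
next
  case (step2 i)
  then show ?case using assms[of "t + of_int (i - 1)"] by (simp add: algebra_simps)
qed simp

text \<open>Injectivity on the circle fixes the degree. The increment G (t + 1) - G t is a constant
  integer d; it is not 0, so G is injective on the line and hence monotone, and the intermediate
  value theorem then excludes a degree of modulus at least 2.\<close>

lemma circle_embedding_lift_monotone:
  fixes G :: "real \<Rightarrow> real"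
  assumes cont: "continuous_on UNIV G"
    and well: "\<And>s t. s - t \<in> \<int> \<Longrightarrow> G s - G t \<in> \<int>"
    and inj: "\<And>s t. G s - G t \<in> \<int> \<Longrightarrow> s - t \<in> \<int>"
  shows "strict_mono G \<and> (\<forall>t. G (t + 1) = G t + 1) \<or>
    strict_antimono_on UNIV G \<and> (\<forall>t. G (t + 1) = G t - 1)"
proof -
  have contd: "continuous_on UNIV (\<lambda>t. G (t + 1) - G t)"
    by (intro continuous_intros continuous_on_compose2[OF cont]) auto
  obtain d :: int where "\<And>t. G (t + 1) - G t = d"
    using Ints_valued_constant[OF _ contd] well by auto
  then have d: "G (t + 1) = G t + d" for t
    by (metis add.commute diff_add_cancel)
  note dk = shift_int[of G d, OF d]
  have cont': "continuous_on S G" for S using cont continuous_on_subset by blast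
  have ivt: "y \<in> G ` {a..b}" if "u \<in> {a..b}" "v \<in> {a..b}" "G u \<le> y" "y \<le> G v" for u a b v y
  proof -
    have "connected (G ` {a..b})" by (intro connected_continuous_image cont') simp
    then show ?thesis using that unfolding connected_iff_interval by blast
  qed
  \<comment> \<open>If G 0 = G 1, a value strictly between G 0 and G (1/2) is taken in both halves
    of [0, 1], at two points whose distance is strictly between 0 and 1.\<close>
  have d0: "d \<noteq> 0"
  proof
    assume "d = 0"
    then have 1: "G 1 = G 0" using d[of 0] by simp
    define y where "y = (G 0 + G (1/2)) / 2"
    have nI: "(1/2::real) \<notin> \<int>" by (simp add: fraction_not_in_Ints)
    have ne: "G (1/2) \<noteq> G 0" using inj[of "1/2" 0] nI by auto
    have betw: "G 0 \<le> y \<and> y \<le> G (1/2) \<or> G (1/2) \<le> y \<and> y \<le> G 0"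
      unfolding y_def by (cases "G 0 \<le> G (1/2)") simp_all
    have "y \<in> G ` {0..1/2}" using betw ivt[of 0 0 "1/2" "1/2" y] ivt[of "1/2" 0 "1/2" 0 y] by auto
    then obtain t1 where t1: "0 \<le> t1" "t1 \<le> 1/2" "G t1 = y" by auto
    have "y \<in> G ` {1/2..1}" using betw 1 ivt[of 1 "1/2" 1 "1/2" y] ivt[of "1/2" "1/2" 1 1 y] by auto
    then obtain t2 where t2: "1/2 \<le> t2" "t2 \<le> 1" "G t2 = y" by auto
    have "y \<noteq> G 0" "y \<noteq> G (1/2)" using ne by (auto simp: y_def)
    then have "t1 \<noteq> 0" "t1 \<noteq> 1/2" "t2 \<noteq> 1/2" "t2 \<noteq> 1" using t1(3) t2(3) 1 by metis+
    then have "0 < t2 - t1" "t2 - t1 < 1" using t1 t2 by auto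
    moreover have "t2 - t1 \<in> \<int>" using inj t1 t2 by simp
    ultimately show False by (auto elim!: Ints_cases)
  qed
  have "inj G"
  proof (rule injI)
    fix a b assume ab: "G a = G b"
    then have "a - b \<in> \<int>" using inj by simp
    then obtain m :: int where m: "a = b + m" by (metis Ints_cases add.commute diff_add_cancel)
    then show "a = b" using dk[of b m] ab d0 by simp
  qed
  then have "strict_mono_on UNIV G \<or> strict_antimono_on UNIV G"
    using injective_eq_monotone_map[of UNIV G] cont by simp
  \<comment> \<open>For d \<ge> 2 the value G 0 + 1 would be taken strictly inside [0, 1], at a
    point incongruent to 0.\<close>
  moreover have "d = 1" if "strict_mono_on UNIV G"
  proof (rule ccontr)
    assume "d \<noteq> 1"
    have "G 0 < G 1" using that by (simp add: monotone_on_def)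
    then have "d \<ge> 2" using d[of 0] \<open>d \<noteq> 1\<close> by auto
    then have y: "G 0 \<le> G 0 + 1" "G 0 + 1 \<le> G 1" using d[of 0] by auto
    then have "G 0 + 1 \<in> G ` {0..1}" using ivt[of 0 0 1 1 "G 0 + 1"] by simp
    then obtain t where t: "0 \<le> t" "t \<le> 1" "G t = G 0 + 1" by auto
    then have "t - 0 \<in> \<int>" using inj[of t 0] by simp
    moreover have "t \<noteq> 0" "t \<noteq> 1" using t d[of 0] \<open>d \<ge> 2\<close> by auto
    ultimately show False using t by (auto elim!: Ints_cases)
  qed
  moreover have "d = -1" if "strict_antimono_on UNIV G"
  proof (rule ccontr)
    assume "d \<noteq> -1"
    have "G 1 < G 0" using that by (simp add: monotone_on_def)
    then have "d \<le> -2" using d[of 0] \<open>d \<noteq> -1\<close> by auto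
    then have y: "G 1 \<le> G 0 - 1" "G 0 - 1 \<le> G 0" using d[of 0] by auto
    then have "G 0 - 1 \<in> G ` {0..1}" using ivt[of 1 0 1 0 "G 0 - 1"] by simp
    then obtain t where t: "0 \<le> t" "t \<le> 1" "G t = G 0 - 1" by auto
    then have "t - 0 \<in> \<int>" using inj[of t 0] by simp
    moreover have "t \<noteq> 0" "t \<noteq> 1" using t d[of 0] \<open>d \<le> -2\<close> by auto
    ultimately show False using t by (auto elim!: Ints_cases)
  qed
  ultimately show ?thesis using d by fastforce
qed

text \<open>The real line is contractible, so the zero-free function
  \<open>g (cis (2 * pi * t))\<close> has a continuous logarithm. Its real part vanishes because the
  values have modulus 1; its imaginary part, counted in turns, is the lift.\<close>

lemma circle_embedding_lift_exists:
  fixes g :: "complex \<Rightarrow> complex"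
  assumes cont: "continuous_on (sphere 0 1) g" and maps: "g ` sphere 0 1 \<subseteq> sphere 0 1"
  obtains G where "continuous_on UNIV G" "\<And>t. g (cis (2 * pi * t)) = cis (2 * pi * G t)"
proof -
  have S: "cis (2 * pi * t) \<in> sphere 0 1" for t by simp
  have n: "cmod (g (cis (2 * pi * t))) = 1" for t
    using maps S[of t] by (auto simp: image_subset_iff)
  have c: "continuous_on UNIV (\<lambda>t. g (cis (2 * pi * t)))"
    by (rule continuous_on_compose2[OF cont]) (auto intro!: continuous_intros)
  have nz: "g (cis (2 * pi * t)) \<noteq> 0" for t using n[of t] by auto
  obtain L where L: "continuous_on UNIV L" "\<And>t. g (cis (2 * pi * t)) = exp (L t)"
    using continuous_logarithm_on_contractible[OF c] nz by auto
  have "g (cis (2 * pi * t)) = cis (2 * pi * (Im (L t) / (2 * pi)))" for t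
  proof -
    have "exp (Re (L t)) = 1" using n[of t] unfolding L(2) by simp
    then show ?thesis unfolding L(2) exp_eq_polar by simp
  qed
  then show ?thesis
    by (intro that[of "\<lambda>t. Im (L t) / (2 * pi)"]) (auto intro!: continuous_intros L(1))
qed

section \<open>Degree-one lifts: bounded displacement and the translation number\<close>

locale degree_one_lift =
  fixes \<gamma> :: "real \<Rightarrow> real"
  assumes cont: "continuous_on UNIV \<gamma>" and mono: "strict_mono \<gamma>"
    and add_1: "\<And>t. \<gamma> (t + 1) = \<gamma> t + 1"
begin

lemma iterate: "degree_one_lift (\<gamma> ^^ n)"
proof (induction n)
  case 0
  show ?case by unfold_locales (auto simp: strict_mono_def)
next
  case (Suc n)
  interpret it: degree_one_lift "\<gamma> ^^ n" by (rule Suc)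
  show ?case
  proof
    show "continuous_on UNIV (\<gamma> ^^ Suc n)"
      by (auto simp: comp_def intro!: continuous_on_compose2[OF cont] it.cont)
    show "strict_mono (\<gamma> ^^ Suc n)"
      using mono it.mono by (simp add: strict_mono_def)
    show "(\<gamma> ^^ Suc n) (t + 1) = (\<gamma> ^^ Suc n) t + 1" for t
      by (simp add: add_1 it.add_1)
  qed
qed

lemma add_int: "\<gamma> (t + of_int k) = \<gamma> t + of_int k"
  using shift_int[of \<gamma> 1 t k] add_1 by simp

lemma iterate_add_int: "(\<gamma> ^^ n) (t + of_int k) = (\<gamma> ^^ n) t + of_int k"
  by (rule degree_one_lift.add_int[OF iterate])

text \<open>The displacement has period 1, and for t in [0, 1) both t and \<gamma> t - \<gamma> 0
  lie in [0, 1].\<close>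

lemma displacement: "\<bar>\<gamma> t - t - \<gamma> 0\<bar> \<le> 1"
proof -
  have "\<gamma> t = \<gamma> (frac t) + \<lfloor>t\<rfloor>" using add_int[of "frac t" "\<lfloor>t\<rfloor>"] by (simp add: frac_def)
  then have "\<gamma> t - t = \<gamma> (frac t) - frac t" by (simp add: frac_def)
  moreover have "0 \<le> frac t" "frac t < 1" by (auto simp: frac_lt_1)
  moreover from this have "\<gamma> 0 \<le> \<gamma> (frac t)" "\<gamma> (frac t) \<le> \<gamma> 0 + 1"
    using strict_mono_less_eq[OF mono] add_1[of 0] by (metis add_0 less_eq_real_def)+
  ultimately show ?thesis by linarith
qed

lemma iterate_displacement: "\<bar>(\<gamma> ^^ n) t - t - (\<gamma> ^^ n) 0\<bar> \<le> 1"
  by (rule degree_one_lift.displacement[OF iterate])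

text \<open>Each application of \<open>\<gamma> ^^ n\<close> adds \<open>(\<gamma> ^^ n) 0\<close>
  up to an error of 1. This quasi-additivity is what makes the averages converge.\<close>

lemma iterate_mult: "\<bar>(\<gamma> ^^ (m * n)) 0 - m * (\<gamma> ^^ n) 0\<bar> \<le> m"
proof (induction m)
  case (Suc m)
  have "(\<gamma> ^^ (Suc m * n)) 0 = (\<gamma> ^^ n) ((\<gamma> ^^ (m * n)) 0)" by (simp add: funpow_add)
  then show ?case using iterate_displacement[of n "(\<gamma> ^^ (m * n)) 0"] Suc
    by (simp add: algebra_simps abs_le_iff)
qed simp

definition translation_number :: real where
  "translation_number = lim (\<lambda>n. (\<gamma> ^^ n) 0 / real n)"

lemma tendsto_translation_number: "(\<lambda>n. (\<gamma> ^^ n) 0 / real n) \<longlonglongrightarrow> translation_number"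
proof -
  \<comment> \<open>The averages for m and for n are both compared with the average for m *
    n.\<close>
  have *: "\<bar>(\<gamma> ^^ (m * n)) 0 / (m * n) - (\<gamma> ^^ n) 0 / n\<bar> \<le> 1 / n" if "m > 0" "n > 0" for m n :: nat
  proof -
    have "(\<gamma> ^^ (m * n)) 0 / (m * n) - (\<gamma> ^^ n) 0 / n = ((\<gamma> ^^ (m * n)) 0 - m * (\<gamma> ^^ n) 0) / (m * n)"
      using that by (simp add: field_simps)
    then have "\<bar>(\<gamma> ^^ (m * n)) 0 / (m * n) - (\<gamma> ^^ n) 0 / n\<bar> = \<bar>(\<gamma> ^^ (m * n)) 0 - m * (\<gamma> ^^ n) 0\<bar> / (m * n)"
      by simp
    also have "\<dots> \<le> m / (m * n)" by (intro divide_right_mono iterate_mult) simp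
    finally show ?thesis using that by simp
  qed
  have d: "\<bar>(\<gamma> ^^ m) 0 / m - (\<gamma> ^^ n) 0 / n\<bar> \<le> 1 / n + 1 / m" if "m > 0" "n > 0" for m n :: nat
    using *[of m n] *[of n m] that by (simp add: mult.commute)
  have "Cauchy (\<lambda>n. (\<gamma> ^^ n) 0 / real n)"
  proof (rule metric_CauchyI)
    fix e :: real assume "0 < e"
    then obtain M :: nat where M: "M > 0" "inverse (real M) < e / 2"
      using reals_Archimedean[of "e / 2"] by (metis half_gt_zero zero_less_Suc)
    have "dist ((\<gamma> ^^ m) 0 / m) ((\<gamma> ^^ n) 0 / n) < e" if "m \<ge> M" "n \<ge> M" for m n
    proof -
      have "1 / real n \<le> inverse (real M)" "1 / real m \<le> inverse (real M)"
        using that M by (auto simp: field_simps)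
      then show ?thesis using d[of m n] that M by (simp add: dist_real_def)
    qed
    then show "\<exists>M. \<forall>m\<ge>M. \<forall>n\<ge>M. dist ((\<gamma> ^^ m) 0 / m) ((\<gamma> ^^ n) 0 / n) < e" by blast
  qed
  then show ?thesis
    unfolding translation_number_def by (simp add: Cauchy_convergent convergent_LIMSEQ_iff[symmetric])
qed

text \<open>The bound on the displacement is uniform in the starting point, which may therefore vary
  with n. An orientation reversing \<open>G\<close> leads to such moving starting points.\<close>

lemma tendsto_displacement: "(\<lambda>n. ((\<gamma> ^^ n) (u n) - u n) / real n) \<longlonglongrightarrow> translation_number"
proof -
  have "(\<lambda>n. ((\<gamma> ^^ n) (u n) - u n - (\<gamma> ^^ n) 0) / real n) \<longlonglongrightarrow> 0"
  proof (rule Lim_null_comparison)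
    show "\<forall>\<^sub>F n in sequentially. norm (((\<gamma> ^^ n) (u n) - u n - (\<gamma> ^^ n) 0) / real n) \<le> 1 / real n"
      using iterate_displacement by (auto intro!: divide_right_mono always_eventually)
  qed (rule lim_1_over_n)
  from tendsto_add[OF this tendsto_translation_number] show ?thesis
    by (simp add: add_divide_distrib[symmetric])
qed

lemma tendsto_orbit: "(\<lambda>n. (\<gamma> ^^ n) t / real n) \<longlonglongrightarrow> translation_number"
proof -
  have "(\<lambda>n. t / real n) \<longlonglongrightarrow> 0"
    by (rule lim_const_over_n)
  from tendsto_add[OF tendsto_displacement[of "\<lambda>_. t"] this] show ?thesis
    by (simp add: add_divide_distrib[symmetric])
qed

lemma surj: "surj \<gamma>"
proof -
  have "y \<in> range \<gamma>" for y
  proof -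
    have c: "connected (range \<gamma>)" by (intro connected_continuous_image cont) simp
    have [simp]: "\<gamma> (of_int k) = \<gamma> 0 + of_int k" for k using add_int[of 0 k] by simp
    then have "\<gamma> (of_int \<lfloor>y - \<gamma> 0\<rfloor>) \<le> y" "y \<le> \<gamma> (of_int \<lceil>y - \<gamma> 0\<rceil>)"
      by (simp_all, linarith+)
    then show ?thesis using c unfolding connected_iff_interval by blast
  qed
  then show ?thesis by auto
qed

lemma bij: "bij \<gamma>"
  using surj strict_mono_imp_inj_on[OF mono] by (simp add: bij_def)

lemma inv_lift: "degree_one_lift (inv \<gamma>)"
proof -
  have r: "\<gamma> (inv \<gamma> t) = t" for t using surj by (rule surj_f_inv_f)
  have lt: "inv \<gamma> s < inv \<gamma> t \<longleftrightarrow> s < t" for s t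
    using strict_mono_less[OF mono, of "inv \<gamma> s" "inv \<gamma> t"] by (simp add: r)
  show ?thesis
  proof
    have "range (inv \<gamma>) = UNIV" using bij by (simp add: bij_imp_bij_inv bij_is_surj)
    then show "continuous_on UNIV (inv \<gamma>)"
      by (intro continuous_onI_mono) (auto simp: not_less[symmetric] lt)
    show "strict_mono (inv \<gamma>)" by (simp add: strict_mono_def lt)
    show "inv \<gamma> (t + 1) = inv \<gamma> t + 1" for t
      by (intro inv_f_eq) (auto simp: add_1 r strict_mono_imp_inj_on[OF mono])
  qed
qed

end

lemma degree_one_lift_plus_int:
  assumes "degree_one_lift \<gamma>"
  shows "degree_one_lift (\<lambda>t. \<gamma> t + of_int k)"
    and "degree_one_lift.translation_number (\<lambda>t. \<gamma> t + of_int k)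
      = degree_one_lift.translation_number \<gamma> + of_int k"
proof -
  interpret degree_one_lift \<gamma> by fact
  show "degree_one_lift (\<lambda>t. \<gamma> t + of_int k)"
  proof
    show "strict_mono (\<lambda>t. \<gamma> t + of_int k)"
      using mono by (simp add: strict_mono_def)
  qed (auto intro!: continuous_intros cont simp: add_1)
  then interpret shifted: degree_one_lift "\<lambda>t. \<gamma> t + of_int k" .
  have "((\<lambda>t. \<gamma> t + of_int k) ^^ n) 0 = (\<gamma> ^^ n) 0 + n * of_int k" for n
  proof (induction n)
    case (Suc n)
    have "\<gamma> ((\<gamma> ^^ n) 0 + real n * of_int k) = \<gamma> ((\<gamma> ^^ n) 0) + real n * of_int k"
      using add_int[of "(\<gamma> ^^ n) 0" "int n * k"] by simp
    then show ?case using Suc by (simp add: algebra_simps)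
  qed simp
  then have eq: "\<forall>\<^sub>F n in sequentially. ((\<lambda>t. \<gamma> t + of_int k) ^^ n) 0 / real n = (\<gamma> ^^ n) 0 / real n + of_int k"
    by (intro eventually_sequentiallyI[of 1]) (simp add: add_divide_distrib)
  have "(\<lambda>n. (\<gamma> ^^ n) 0 / real n + of_int k) \<longlonglongrightarrow> translation_number + of_int k"
    by (intro tendsto_intros tendsto_translation_number)
  then have "(\<lambda>n. ((\<lambda>t. \<gamma> t + of_int k) ^^ n) 0 / real n) \<longlonglongrightarrow> translation_number + of_int k"
    using tendsto_cong[OF eq] by simp
  then show "shifted.translation_number = translation_number + of_int k"
    using LIMSEQ_unique shifted.tendsto_translation_number by blast
qed

text \<open>\<open>rotation_number\<close> uses a lift chosen by \<open>SOME\<close>. Lifts differ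
  by integers, an integer added to a lift is added to its translation number, and
  \<open>frac\<close> discards it. Since 1 is not fixed, \<gamma> 0 is not an integer, and
  subtracting its floor normalizes the lift.\<close>

lemma
  assumes homeo: "orientation_preserving_homeo \<alpha>" and fix1: "\<alpha> 1 \<noteq> 1"
  shows normalized_lift: "is_lift \<alpha> (normalized_lift \<alpha>)"
      "0 < normalized_lift \<alpha> 0" "normalized_lift \<alpha> 0 < 1"
    and degree_one_normalized_lift: "degree_one_lift (normalized_lift \<alpha>)"
    and rotation_number_eq: "rotation_number \<alpha> =
      frac (degree_one_lift.translation_number (normalized_lift \<alpha>))"
proof -
  obtain \<alpha>' \<gamma> where h: "homeomorphism (sphere 0 1) (sphere 0 1) \<alpha> \<alpha>'" "is_lift \<alpha> \<gamma>" "strict_mono \<gamma>"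
    using homeo by (auto simp: orientation_preserving_homeo_def)
  have c: "continuous_on UNIV \<gamma>" and e: "\<alpha> (cis (2 * pi * t)) = cis (2 * pi * \<gamma> t)" for t
    using h(2) by (auto simp: is_lift_def)
  have "\<gamma> s - \<gamma> t \<in> \<int> \<longleftrightarrow> s - t \<in> \<int>" for s t
  proof -
    have "\<gamma> s - \<gamma> t \<in> \<int> \<longleftrightarrow> \<alpha> (cis (2 * pi * s)) = \<alpha> (cis (2 * pi * t))"
      by (simp add: e cis_2pi_eq_iff)
    also have "\<dots> \<longleftrightarrow> cis (2 * pi * s) = cis (2 * pi * t)"
      using h(1) by (intro inj_on_eq_iff[of _ "sphere 0 1"]) (auto simp: homeomorphism_def intro: inj_on_inverseI)
    finally show ?thesis by (simp add: cis_2pi_eq_iff)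
  qed
  then have "strict_mono \<gamma> \<and> (\<forall>t. \<gamma> (t + 1) = \<gamma> t + 1) \<or>
    strict_antimono_on UNIV \<gamma> \<and> (\<forall>t. \<gamma> (t + 1) = \<gamma> t - 1)"
    by (intro circle_embedding_lift_monotone c) auto
  moreover have "\<not> strict_antimono_on UNIV \<gamma>"
  proof
    assume "strict_antimono_on UNIV \<gamma>"
    then have "\<gamma> 1 < \<gamma> 0" by (simp add: monotone_on_def)
    then show False using strict_mono_less[OF h(3), of 0 1] by simp
  qed
  ultimately interpret g0: degree_one_lift \<gamma>
    using c by unfold_locales auto
  define \<delta> where "\<delta> = (\<lambda>t. \<gamma> t + of_int (- \<lfloor>\<gamma> 0\<rfloor>))"
  have lift: "is_lift \<alpha> (\<lambda>t. \<gamma> t + of_int k)" for k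
    unfolding is_lift_def
    by (intro conjI allI continuous_intros c) (simp add: e cis_2pi_eq_iff)
  have n0: "\<gamma> 0 \<notin> \<int>"
  proof
    assume "\<gamma> 0 \<in> \<int>"
    then show False using fix1 e[of 0] by simp
  qed
  have \<delta>: "is_lift \<alpha> \<delta>" "0 < \<delta> 0" "\<delta> 0 < 1"
    using lift[of "- \<lfloor>\<gamma> 0\<rfloor>"] n0 frac_gt_0_iff[of "\<gamma> 0"] frac_lt_1[of "\<gamma> 0"]
    unfolding \<delta>_def frac_def by auto
  have "normalized_lift \<alpha> = \<delta>"
    unfolding normalized_lift_def
  proof (rule the_equality)
    fix \<eta> assume \<eta>: "is_lift \<alpha> \<eta> \<and> 0 < \<eta> 0 \<and> \<eta> 0 < 1"
    then obtain k :: int where k: "\<And>t. \<eta> t = \<delta> t + k"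
      using lifts_differ_by_int[OF \<delta>(1), of \<eta>] by blast
    then have "k = 0" using k[of 0] \<eta> \<delta> by auto
    then show "\<eta> = \<delta>" using k by auto
  qed (use \<delta> in auto)
  then show "is_lift \<alpha> (normalized_lift \<alpha>)" "0 < normalized_lift \<alpha> 0" "normalized_lift \<alpha> 0 < 1"
    and d: "degree_one_lift (normalized_lift \<alpha>)"
    using \<delta> degree_one_lift_plus_int(1)[OF g0.degree_one_lift_axioms, of "- \<lfloor>\<gamma> 0\<rfloor>"]
    by (auto simp: \<delta>_def)
  interpret degree_one_lift "normalized_lift \<alpha>" by (rule d)
  define \<eta> where "\<eta> = (SOME \<gamma>. is_lift \<alpha> \<gamma>)"
  have "is_lift \<alpha> \<eta>" unfolding \<eta>_def using h(2) by (rule someI[of "is_lift \<alpha>"])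
  then obtain k :: int where k: "\<And>t. \<eta> t = normalized_lift \<alpha> t + k"
    using lifts_differ_by_int[OF \<open>is_lift \<alpha> (normalized_lift \<alpha>)\<close>, of \<eta>] by blast
  then have \<eta>: "\<eta> = (\<lambda>t. normalized_lift \<alpha> t + of_int k)" by auto
  have "rotation_number \<alpha> = frac (degree_one_lift.translation_number \<eta>)"
    unfolding rotation_number_def Let_def \<eta>_def[symmetric]
    unfolding \<eta> degree_one_lift.translation_number_def[OF degree_one_lift_plus_int(1)[OF d]] ..
  then show "rotation_number \<alpha> = frac translation_number"
    unfolding \<eta> degree_one_lift_plus_int(2)[OF d] by (simp add: frac_def)
qed

section \<open>The maximal ideal space\<close>

text \<open>If u \<le> 1/2 is the distance of a - b to the nearest integer, the chord has length 2
  sin (pi u), and sine is increasing up to pi / 2.\<close>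

lemma near_int_of_cis_close:
  assumes e: "0 < e" "e \<le> 1/2" and "cmod (cis (2 * pi * a) - cis (2 * pi * b)) < 2 * sin (pi * e)"
  shows "\<bar>a - b - round (a - b)\<bar> < e"
proof (rule ccontr)
  define u where "u = \<bar>a - b - round (a - b)\<bar>"
  assume "\<not> ?thesis"
  then have u: "e \<le> u" "u \<le> 1/2"
    using of_int_round_abs_le[of "a - b"] by (auto simp: u_def abs_minus_commute)
  have "sin (pi * e) \<le> sin (pi * u)"
  proof (rule sin_monotone_2pi_le)
    show "- (pi / 2) \<le> pi * e" using e mult_nonneg_nonneg[of pi e] pi_ge_zero by linarith
    show "pi * e \<le> pi * u" using u by simp
    show "pi * u \<le> pi / 2" using mult_left_mono[OF u(2), of pi] by simp
  qed
  also have "sin (pi * u) \<le> \<bar>sin (pi * (a - b - round (a - b)))\<bar>"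
  proof (cases "0 \<le> a - b - round (a - b)")
    case False
    then have "pi * u = - (pi * (a - b - round (a - b)))" by (simp add: u_def algebra_simps)
    then show ?thesis by (metis abs_ge_minus_self sin_minus)
  qed (simp add: u_def)
  finally have "2 * sin (pi * e) \<le> cmod (cis (2 * pi * (a - b - round (a - b))) - 1)"
    unfolding norm_cis_2pi_minus_one by simp
  also have "cis (2 * pi * (a - b - round (a - b))) = cis (2 * pi * (a - b))"
    unfolding cis_2pi_eq_iff by simp
  also have "cmod (cis (2 * pi * (a - b)) - 1) = cmod (cis (2 * pi * b) * (cis (2 * pi * (a - b)) - 1))"
    by (simp add: norm_mult)
  also have "cis (2 * pi * b) * (cis (2 * pi * (a - b)) - 1) = cis (2 * pi * a) - cis (2 * pi * b)"
    by (simp add: right_diff_distrib cis_mult)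
  finally show False using assms(3) by simp
qed

text \<open>To leave the e-neighbourhood of its first nearest integer, D would have to take a value
  at distance exactly e from it. As e < 1/2, that integer is still the nearest one there, against
  \<open>near\<close>. This yields one integer for both ends of an arc.\<close>

lemma interval_close_to_int:
  fixes D :: "real \<Rightarrow> real"
  assumes "connected S" "continuous_on S D" "0 < e" "e < 1/2"
    and near: "\<And>t. t \<in> S \<Longrightarrow> \<bar>D t - round (D t)\<bar> < e"
  shows "\<exists>k::int. \<forall>t\<in>S. \<bar>D t - k\<bar> < e"
proof (cases "S = {}")
  case False
  then obtain s where s: "s \<in> S" by blast
  define f where "f t = \<bar>D t - round (D s)\<bar>" for t
  have "connected (f ` S)"
    unfolding f_def by (intro connected_continuous_image continuous_intros assms)
  have "f t < e" if "t \<in> S" for t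
  proof (rule ccontr)
    assume "\<not> f t < e"
    then have "f s \<in> f ` S" "f t \<in> f ` S" "f s \<le> e" "e \<le> f t"
      using that s near[OF s] by (auto simp: f_def)
    then have "e \<in> f ` S"
      using \<open>connected (f ` S)\<close> unfolding connected_iff_interval by blast
    then obtain r where r: "r \<in> S" "\<bar>D r - round (D s)\<bar> = e" by (auto simp: f_def)
    have "round (D r) = round (D s)" using near[OF r(1)] r(2) assms(3,4) by linarith
    then show False using near[OF r(1)] r(2) by simp
  qed
  then show ?thesis by (intro exI[of _ "round (D s)"]) (auto simp: f_def)
qed auto

text \<open>The level \<open>N\<close> of the maximal ideal space sits at height \<open>1 / (N + 1)\<close>, the level \<open>\<infinity>\<close> at height \<open>0\<close>.\<close>

definition arc_level :: "(nat \<Rightarrow> real) \<Rightarrow> nat \<Rightarrow> (real \<times> complex) set" where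
  "arc_level x N = (\<lambda>t. (1 / real (Suc N), cis (2 * pi * t))) ` {x N..x (Suc N)}"

definition arc_space :: "(nat \<Rightarrow> real) \<Rightarrow> (real \<times> complex) set" where
  "arc_space x = {0} \<times> sphere 0 1 \<union> (\<Union>N. arc_level x N)"

lemma arc_level_subset: "arc_level x N \<subseteq> arc_space x"
  by (auto simp: arc_space_def)

lemma arc_level_eq: "arc_level x N = {p \<in> arc_space x. fst p = 1 / real (Suc N)}"
  by (auto simp: arc_space_def arc_level_def divide_simps)

lemma limit_level_eq: "{0} \<times> sphere 0 1 = {p \<in> arc_space x. fst p = 0}"
  by (auto simp: arc_space_def arc_level_def)

lemma connected_arc_level: "connected (arc_level x N)"
  unfolding arc_level_def by (intro connected_continuous_image continuous_intros) simp

lemma connected_limit_level: "connected ({0::real} \<times> sphere (0::complex) 1)"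
  by (intro connected_Times connected_sphere) auto

lemma connected_level:
  assumes "p \<in> arc_space x"
  shows "connected {q \<in> arc_space x. fst q = fst p}"
proof -
  consider "fst p = 0" | N where "fst p = 1 / real (Suc N)"
    using assms by (auto simp: arc_space_def arc_level_def)
  then show ?thesis
  proof cases
    case 1
    then show ?thesis using connected_limit_level unfolding limit_level_eq[of x] by simp
  next
    case (2 N)
    then show ?thesis using connected_arc_level[of x N] unfolding arc_level_eq by simp
  qed
qed

lemma heights_arc_space: "fst ` arc_space x \<subseteq> insert 0 (range (\<lambda>N. 1 / real (Suc N)))"
  by (auto simp: arc_space_def arc_level_def)

text \<open>A connected set of reals with two elements is uncountable, but only countably many
  heights occur.\<close>

lemma connected_height_constant:
  assumes "connected C" "C \<subseteq> arc_space x" "p \<in> C" "q \<in> C"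
  shows "fst p = fst q"
proof (rule ccontr)
  assume "fst p \<noteq> fst q"
  moreover have "connected (fst ` C)" by (intro connected_continuous_image assms continuous_intros)
  ultimately have "uncountable (fst ` C)" using connected_uncountable assms(3,4) by (metis imageI)
  moreover have "countable (fst ` C)"
    by (rule countable_subset[of _ "insert 0 (range (\<lambda>N. 1 / real (Suc N)))"])
      (use heights_arc_space assms(2) in blast, simp)
  ultimately show False by blast
qed

text \<open>The bound is the gap between 1 / (N + 1) and the next lower height 1 / (N + 2); the gap
  to the next higher one is larger.\<close>

lemma height_isolated:
  assumes "r \<in> insert 0 (range (\<lambda>N. 1 / real (Suc N)))"
    and "\<bar>r - 1 / real (Suc N)\<bar> < 1 / (real (Suc N) * real (Suc (Suc N)))"
  shows "r = 1 / real (Suc N)"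
proof -
  have eq: "1 / (real (Suc N) * real (Suc (Suc N))) = 1 / real (Suc N) - 1 / real (Suc (Suc N))"
    by (simp add: field_simps)
  consider "r = 0" | M where "r = 1 / real (Suc M)" using assms(1) by auto
  then show ?thesis
  proof cases
    case 1
    then show ?thesis using assms(2) unfolding eq by simp
  next
    case (2 M)
    consider "M = N" | "M > N" | "M < N" by linarith
    then show ?thesis
    proof cases
      case 1
      then show ?thesis using 2 by simp
    next
      case g: 2
      then have "1 / real (Suc M) \<le> 1 / real (Suc (Suc N))" by (simp add: field_simps)
      then show ?thesis using assms(2) 2 unfolding eq by linarith
    next
      case l: 3
      then have "1 / real N \<le> 1 / real (Suc M)" by (simp add: field_simps)
      moreover have "1 / (real (Suc N) * real (Suc (Suc N))) \<le> 1 / real N - 1 / real (Suc N)"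
      proof -
        have "1 / real N - 1 / real (Suc N) = 1 / (real N * real (Suc N))"
          using l by (simp add: field_simps)
        moreover have "real N * real (Suc N) \<le> real (Suc N) * real (Suc (Suc N))"
          by (intro mult_mono) auto
        ultimately show ?thesis using l by (simp add: frac_le)
      qed
      ultimately show ?thesis using assms(2) 2 by linarith
    qed
  qed
qed

lemma tendsto_heights: "(\<lambda>N. 1 / real (Suc N)) \<longlonglongrightarrow> 0"
  using LIMSEQ_Suc[OF lim_1_over_n] .

text \<open>The space arises from the compact product of all heights with the circle by removing
  open sets: around each height 1 / (N + 1), a neighbourhood \<open>B N\<close> free of other
  heights times the complement of the arc.\<close>

lemma compact_arc_space: "compact (arc_space x)"
proof -
  let ?Z = "insert 0 (range (\<lambda>N. 1 / real (Suc N)))"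
  define A where "A N = (\<lambda>t. cis (2 * pi * t)) ` {x N..x (Suc N)}" for N
  define B where "B N = ball (1 / real (Suc N)) (1 / (real (Suc N) * real (Suc (Suc N))))" for N
  have cA: "closed (A N)" for N
    unfolding A_def by (intro compact_imp_closed compact_continuous_image continuous_intros) auto
  have iso: "r = 1 / real (Suc N)" if "r \<in> ?Z" "r \<in> B N" for r N
    using height_isolated[OF that(1), of N] that(2) by (simp add: B_def dist_real_def abs_minus_commute)
  have self: "1 / real (Suc N) \<in> B N" for N by (simp add: B_def)
  have lev: "arc_level x N = {1 / real (Suc N)} \<times> A N" for N by (auto simp: arc_level_def A_def)
  have "arc_space x = ?Z \<times> sphere 0 1 - (\<Union>N. B N \<times> - A N)"
  proof (intro equalityI subsetI)
    fix p assume p: "p \<in> arc_space x"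
    have pZ: "fst p \<in> ?Z" using heights_arc_space p by blast
    have "snd p \<in> sphere 0 1" using p by (auto simp: arc_space_def arc_level_def)
    moreover have False if "fst p \<in> B N" "snd p \<notin> A N" for N
    proof -
      have "p \<in> arc_level x N" using iso[OF pZ that(1)] p by (simp add: arc_level_eq)
      then show False using that(2) by (auto simp: lev)
    qed
    ultimately show "p \<in> ?Z \<times> sphere 0 1 - (\<Union>N. B N \<times> - A N)"
      using pZ by (cases p) auto
  next
    fix p assume p: "p \<in> ?Z \<times> sphere 0 1 - (\<Union>N. B N \<times> - A N)"
    then consider "fst p = 0" | N where "fst p = 1 / real (Suc N)" by auto
    then show "p \<in> arc_space x"
    proof cases
      case 1
      then show ?thesis using p by (cases p) (auto simp: arc_space_def)
    next
      case (2 N)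
      then have "p \<in> arc_level x N" using p self[of N] unfolding lev by (cases p) auto
      then show ?thesis using arc_level_subset by blast
    qed
  qed
  moreover have "compact (?Z \<times> sphere (0::complex) 1)"
    by (intro compact_Times compact_sequence_with_limit tendsto_heights compact_sphere)
  moreover have "open (\<Union>N. B N \<times> - A N)"
    by (intro open_UN ballI open_Times) (auto simp: B_def cA open_Compl)
  ultimately show ?thesis by (simp add: compact_diff)
qed

section \<open>Homeomorphisms between spectra\<close>

lemma homeomorphism_height_cong:
  assumes h: "homeomorphism (arc_space x) (arc_space y) h h'"
    and "p \<in> arc_space x" "q \<in> arc_space x" "fst p = fst q"
  shows "fst (h p) = fst (h q)"
proof -
  let ?C = "{r \<in> arc_space x. fst r = fst p}"
  have "connected (h ` ?C)"
    using h by (intro connected_continuous_image connected_level assms)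
      (auto simp: homeomorphism_def elim!: continuous_on_subset)
  moreover have "h ` ?C \<subseteq> arc_space y" using h by (auto simp: homeomorphism_def)
  ultimately show ?thesis by (rule connected_height_constant) (use assms in auto)
qed

text \<open>The limit level is the only level that is not open.\<close>

lemma homeomorphism_limit_level:
  assumes h: "homeomorphism (arc_space x) (arc_space y) h h'" and x: "\<And>N. x N \<le> x (Suc N)"
    and p: "p \<in> arc_space x" "fst p = 0"
  shows "fst (h p) = 0"
proof (rule ccontr)
  have ch: "continuous_on (arc_space x) h" and hy: "h q \<in> arc_space y" if "q \<in> arc_space x" for q
    using h that by (auto simp: homeomorphism_def)
  note h_sym = homeomorphism_symD[OF h]
  assume ne: "fst (h p) \<noteq> 0"
  obtain n where n: "fst (h p) = 1 / real (Suc n)"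
    using hy[OF p(1)] ne by (auto simp: arc_space_def arc_level_def)
  \<comment> \<open>One point on each arc. A subsequence converges to a point of the limit level,
    whose image is assumed to lie at the height of arc \<open>n\<close>. That height is isolated, so
    the images of two points of different levels lie on arc \<open>n\<close>, and \<open>h'\<close>
    would take them back to a common level.\<close>
  define k where "k N = (1 / real (Suc N), cis (2 * pi * x N))" for N
  have "k N \<in> arc_level x N" for N using x[of N] by (auto simp: k_def arc_level_def)
  then have k: "k N \<in> arc_space x" for N using arc_level_subset by blast
  obtain l r where l: "l \<in> arc_space x" "strict_mono r" "(k \<circ> r) \<longlonglongrightarrow> l"
    using compact_arc_space[of x] k unfolding compact_eq_seq_compact_metric seq_compact_def by metis
  have "(\<lambda>N. fst (k (r N))) \<longlonglongrightarrow> fst l" using tendsto_fst[OF l(3)] by (simp add: comp_def)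
  moreover have "(\<lambda>N. fst (k (r N))) \<longlonglongrightarrow> 0"
    using LIMSEQ_subseq_LIMSEQ[OF tendsto_heights l(2)] by (simp add: k_def comp_def)
  ultimately have "fst l = 0" using LIMSEQ_unique by blast
  then have hl: "fst (h l) = 1 / real (Suc n)"
    using homeomorphism_height_cong[OF h l(1) p(1)] p(2) n by simp
  have "(\<lambda>N. h ((k \<circ> r) N)) \<longlonglongrightarrow> h l"
    by (rule continuous_on_tendsto_compose[OF ch[OF p(1)] l(3,1)]) (simp add: k)
  then have "(\<lambda>N. fst (h (k (r N)))) \<longlonglongrightarrow> 1 / real (Suc n)"
    unfolding hl[symmetric] by (intro tendsto_fst) (simp add: comp_def)
  then have "\<forall>\<^sub>F N in sequentially. dist (fst (h (k (r N)))) (1 / real (Suc n))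
      < 1 / (real (Suc n) * real (Suc (Suc n)))"
    by (rule tendstoD) simp
  then obtain N0 where N0: "\<And>N. N \<ge> N0 \<Longrightarrow> \<bar>fst (h (k (r N))) - 1 / real (Suc n)\<bar>
      < 1 / (real (Suc n) * real (Suc (Suc n)))"
    unfolding eventually_sequentially dist_real_def by blast
  have "fst (h (k (r N))) = 1 / real (Suc n)" if "N \<ge> N0" for N
    by (rule height_isolated[OF _ N0[OF that]]) (use heights_arc_space hy[OF k] in blast)
  then have "fst (h (k (r N0))) = fst (h (k (r (Suc N0))))" by simp
  then have "fst (h' (h (k (r N0)))) = fst (h' (h (k (r (Suc N0)))))"
    by (intro homeomorphism_height_cong[OF h_sym] hy k)
  then have "r N0 = r (Suc N0)"
    using homeomorphism_apply1[OF h] k by (simp add: k_def)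
  then show False using l(2) by (metis n_not_Suc_n strict_mono_eq)
qed

text \<open>Both \<open>h\<close> and \<open>h'\<close> take levels into levels, and neither moves a
  point onto or off the limit level. No relation between \<open>M\<close> and \<open>N\<close> is
  available.\<close>

lemma homeomorphism_arc_level:
  assumes h: "homeomorphism (arc_space x) (arc_space y) h h'"
    and x: "\<And>N. x N \<le> x (Suc N)" and y: "\<And>N. y N \<le> y (Suc N)"
  obtains M where "h ` arc_level x N = arc_level y M"
proof -
  note h_sym = homeomorphism_symD[OF h]
  have hy: "h q \<in> arc_space y" "h' (h q) = q" if "q \<in> arc_space x" for q
    using h that by (auto simp: homeomorphism_def)
  have hx: "h' q \<in> arc_space x" "h (h' q) = q" if "q \<in> arc_space y" for q
    using h that by (auto simp: homeomorphism_def)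
  define p where "p = (1 / real (Suc N), cis (2 * pi * x N))"
  have "p \<in> arc_level x N" using x[of N] by (auto simp: p_def arc_level_def)
  then have p: "p \<in> arc_space x" "fst p = 1 / real (Suc N)"
    using arc_level_subset by (auto simp: p_def)
  have "fst (h p) \<noteq> 0"
    using homeomorphism_limit_level[OF h_sym y, of "h p"] hy[OF p(1)] p(2) by auto
  then obtain M where M: "fst (h p) = 1 / real (Suc M)"
    using hy(1)[OF p(1)] by (auto simp: arc_space_def arc_level_def)
  have "h ` arc_level x N = arc_level y M"
  proof (intro equalityI subsetI)
    fix q assume "q \<in> h ` arc_level x N"
    then obtain q' where "q' \<in> arc_space x" "fst q' = fst p" "q = h q'"
      by (auto simp: arc_level_eq p(2))
    then show "q \<in> arc_level y M"
      using homeomorphism_height_cong[OF h _ p(1)] hy M by (auto simp: arc_level_eq)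
  next
    fix q assume q: "q \<in> arc_level y M"
    then have q': "q \<in> arc_space y" "fst q = fst (h p)" by (auto simp: arc_level_eq M)
    then have "fst (h' q) = fst p"
      using homeomorphism_height_cong[OF h_sym, of q "h p"] hy[OF p(1)] by simp
    then have "h' q \<in> arc_level x N" using hx q' p(2) by (simp add: arc_level_eq)
    then show "q \<in> h ` arc_level x N" using hx(2)[OF q'(1)] by (metis imageI)
  qed
  then show ?thesis by (rule that)
qed

text \<open>A continuous injection of an interval is monotone. The two alternatives are the two
  orientations; which one occurs may differ from arc to arc.\<close>

lemma interval_bijection_endpoints:
  fixes H :: "real \<Rightarrow> real"
  assumes "a \<le> b" "continuous_on {a..b} H" "inj_on H {a..b}" "H ` {a..b} = {c..d}"
  shows "H a = c \<and> H b = d \<or> H a = d \<and> H b = c"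
proof -
  have ab: "a \<in> {a..b}" "b \<in> {a..b}" using assms(1) by auto
  have "c \<le> H a" "H a \<le> d" "c \<le> d" using ab assms(4) by (metis atLeastAtMost_iff imageI order_trans)+
  then have "c \<in> H ` {a..b}" "d \<in> H ` {a..b}" using assms(4) by auto
  then obtain u v where uv: "u \<in> {a..b}" "v \<in> {a..b}" "H u = c" "H v = d" by auto
  have r: "c \<le> H a" "H a \<le> d" "c \<le> H b" "H b \<le> d" using ab assms(4) by auto
  have "is_interval {a..b}" by simp
  then consider "strict_mono_on {a..b} H" | "strict_antimono_on {a..b} H"
    using injective_eq_monotone_map assms(2,3) by blast
  then show ?thesis
  proof cases
    case 1
    then have "H a \<le> H u" "H v \<le> H b"
      using uv ab by (auto simp: strict_mono_on_leD)
    then show ?thesis using r uv by auto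
  next
    case 2
    then have "H u \<le> H a" if "u \<in> {a..b}" for u
      using that ab by (cases "u = a") (auto simp: monotone_on_def less_imp_le)
    moreover have "H b \<le> H v" if "v \<in> {a..b}" for v
      using 2 that ab by (cases "v = b") (auto simp: monotone_on_def less_imp_le)
    ultimately show ?thesis using r uv by force
  qed
qed

text \<open>An arc shorter than a full turn is an embedded interval. This allows \<open>h\<close> on
  an arc to be written as a map between real intervals.\<close>

lemma homeomorphism_arc_param:
  assumes "x (Suc N) < x N + 1"
  obtains q where "homeomorphism {x N..x (Suc N)} (arc_level x N)
    (\<lambda>t. (1 / real (Suc N), cis (2 * pi * t))) q"
proof -
  have "inj_on (\<lambda>t. (1 / real (Suc N), cis (2 * pi * t))) {x N..x (Suc N)}"
  proof (rule inj_onI)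
    fix s t assume st: "s \<in> {x N..x (Suc N)}" "t \<in> {x N..x (Suc N)}"
      "(1 / real (Suc N), cis (2 * pi * s)) = (1 / real (Suc N), cis (2 * pi * t))"
    then have "s - t \<in> \<int>" by (simp add: cis_2pi_eq_iff)
    moreover have "\<bar>s - t\<bar> < 1" using st assms by auto
    ultimately show "s = t" using Ints_nonzero_abs_ge1[of "s - t"] by fastforce
  qed
  moreover have "continuous_on {x N..x (Suc N)} (\<lambda>t. (1 / real (Suc N), cis (2 * pi * t)))"
    by (intro continuous_intros)
  ultimately show ?thesis
    using homeomorphism_compact[of "{x N..x (Suc N)}"] that unfolding arc_level_def by blast
qed

text \<open>Points of arc \<open>N\<close> lie 1 / (N + 1) above the limit circle, so uniform
  continuity makes \<open>h\<close> on that arc close to its limit map. Closeness on the circle is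
  closeness modulo integers, and connectedness of the arc supplies one integer k for both ends. The
  two alternatives record the orientation of \<open>h\<close> on the arc.\<close>

lemma homeomorphism_arc_space_lift:
  assumes h: "homeomorphism (arc_space x) (arc_space y) h h'"
    and x: "\<And>N. x N \<le> x (Suc N)" "\<And>N. x (Suc N) < x N + 1"
    and y: "\<And>N. y N \<le> y (Suc N)" "\<And>N. y (Suc N) < y N + 1"
  shows "\<exists>G :: real \<Rightarrow> real. continuous_on UNIV G \<and>
    (strict_mono G \<and> (\<forall>t. G (t + 1) = G t + 1) \<or>
      strict_antimono_on UNIV G \<and> (\<forall>t. G (t + 1) = G t - 1)) \<and>
    (\<forall>e>0. \<forall>\<^sub>F N in sequentially. \<exists>M. \<exists>k::int.
      \<bar>y M - G (x N) - k\<bar> < e \<and> \<bar>y (Suc M) - G (x (Suc N)) - k\<bar> < e \<or>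
      \<bar>y (Suc M) - G (x N) - k\<bar> < e \<and> \<bar>y M - G (x (Suc N)) - k\<bar> < e)"
proof -
  have ch: "continuous_on (arc_space x) h" and hy: "\<And>q. q \<in> arc_space x \<Longrightarrow> h q \<in> arc_space y"
    using h by (auto simp: homeomorphism_def)
  have lim: "(0, z) \<in> arc_space x \<longleftrightarrow> cmod z = 1" for x z
    by (auto simp: arc_space_def arc_level_def)
  define g where "g z = snd (h (0, z))" for z
  have h0: "h (0, z) = (0, g z)" if "z \<in> sphere 0 1" for z
    using homeomorphism_limit_level[OF h x(1), of "(0, z)"] that by (simp add: lim g_def prod_eq_iff)
  have "continuous_on (sphere 0 1) g"
    unfolding g_def by (intro continuous_intros continuous_on_compose2[OF ch]) (auto simp: lim)
  moreover have "g ` sphere 0 1 \<subseteq> sphere 0 1"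
  proof safe
    fix z :: complex assume z: "z \<in> sphere 0 1"
    then have "(0, g z) \<in> arc_space y" using hy[of "(0, z)"] h0[OF z] lim by auto
    then show "g z \<in> sphere 0 1" by (simp add: lim)
  qed
  ultimately obtain G where G: "continuous_on UNIV G" "\<And>t. g (cis (2 * pi * t)) = cis (2 * pi * G t)"
    using circle_embedding_lift_exists by metis
  have inj_g: "inj_on g (sphere 0 1)"
  proof (rule inj_onI)
    fix z w :: complex assume zw: "z \<in> sphere 0 1" "w \<in> sphere 0 1" "g z = g w"
    then have "h (0, z) = h (0, w)" by (simp add: h0)
    then have "h' (h (0, z)) = h' (h (0, w))" by simp
    then show "z = w" using zw by (simp add: homeomorphism_apply1[OF h] lim)
  qed
  have Gint: "G s - G t \<in> \<int> \<longleftrightarrow> s - t \<in> \<int>" for s t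
  proof -
    have "G s - G t \<in> \<int> \<longleftrightarrow> g (cis (2 * pi * s)) = g (cis (2 * pi * t))"
      by (simp add: G cis_2pi_eq_iff)
    also have "\<dots> \<longleftrightarrow> cis (2 * pi * s) = cis (2 * pi * t)"
      by (intro inj_on_eq_iff[OF inj_g]) auto
    finally show ?thesis by (simp add: cis_2pi_eq_iff)
  qed
  have approx: "\<forall>\<^sub>F N in sequentially. \<exists>M. \<exists>k::int.
      \<bar>y M - G (x N) - k\<bar> < e \<and> \<bar>y (Suc M) - G (x (Suc N)) - k\<bar> < e \<or>
      \<bar>y (Suc M) - G (x N) - k\<bar> < e \<and> \<bar>y M - G (x (Suc N)) - k\<bar> < e" if "0 < e" for e :: real
  proof -
    \<comment> \<open>The nearest integer can be followed along the arc only for errors below 1/2;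
      hence the cap 1/3.\<close>
    define e' where "e' = min e (1/3)"
    have e': "0 < e'" "e' \<le> e" "e' < 1/2" using that by (auto simp: e'_def)
    \<comment> \<open>The length of the chord that spans an angle of e' turns.\<close>
    define \<eta> where "\<eta> = 2 * sin (pi * e')"
    have "0 < pi * e'" "pi * e' < pi" using e' by auto
    then have "0 < \<eta>" unfolding \<eta>_def using sin_gt_zero by simp
    have "uniformly_continuous_on (arc_space x) h"
      by (rule compact_uniformly_continuous[OF ch compact_arc_space])
    then obtain d where d: "0 < d"
      "\<And>p q. p \<in> arc_space x \<Longrightarrow> q \<in> arc_space x \<Longrightarrow> dist p q < d \<Longrightarrow> dist (h p) (h q) < \<eta>"
      using \<open>0 < \<eta>\<close> unfolding uniformly_continuous_on_def by (metis dist_commute)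
    have "\<forall>\<^sub>F N in sequentially. 1 / real (Suc N) < d"
      using order_tendstoD(2)[OF tendsto_heights d(1)] .
    then show ?thesis
    proof eventually_elim
      case (elim N)
      let ?I = "{x N..x (Suc N)}"
      let ?q = "\<lambda>t. (1 / real (Suc N), cis (2 * pi * t))"
      obtain M where M: "h ` arc_level x N = arc_level y M"
        using homeomorphism_arc_level[OF h x(1) y(1)] by blast
      obtain r where r: "homeomorphism ?I (arc_level x N) ?q r"
        using homeomorphism_arc_param[of x N, OF x(2)] by blast
      let ?q' = "\<lambda>t. (1 / real (Suc M), cis (2 * pi * t))"
      obtain r' where r': "homeomorphism {y M..y (Suc M)} (arc_level y M) ?q' r'"
        using homeomorphism_arc_param[of y M, OF y(2)] by blast
      have hN: "homeomorphism (arc_level x N) (arc_level y M) h h'"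
        by (rule homeomorphism_of_subsets[OF h arc_level_subset arc_level_subset M])
      \<comment> \<open>The map \<open>h\<close> in the real coordinates of the arcs
        \<open>N\<close> and \<open>M\<close>.\<close>
      define H where "H = r' \<circ> (h \<circ> ?q)"
      obtain H' where H: "homeomorphism ?I {y M..y (Suc M)} H H'"
        unfolding H_def
        using homeomorphism_compose[OF homeomorphism_compose[OF r hN] homeomorphism_symD[OF r']] by blast
      have contH: "continuous_on ?I H" using H by (simp add: homeomorphism_def)
      have qx: "?q t \<in> arc_space x" "?q t \<in> arc_level x N" if "t \<in> ?I" for t
        using that arc_level_subset[of x N] by (auto simp: arc_level_def)
      have qH: "?q' (H t) = h (?q t)" if "t \<in> ?I" for t
      proof -
        have "h (?q t) \<in> arc_level y M" using M qx(2)[OF that] by blast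
        then show ?thesis using homeomorphism_apply2[OF r'] by (simp add: H_def)
      qed
      have "\<bar>H t - G t - round (H t - G t)\<bar> < e'" if "t \<in> ?I" for t
      proof (rule near_int_of_cis_close)
        \<comment> \<open>Comparison with the point directly below on the limit circle, where
          \<open>h\<close> is given by \<open>G\<close>.\<close>
        have "dist (?q t) (0, cis (2 * pi * t)) = 1 / real (Suc N)"
          by (simp add: dist_Pair_Pair)
        then have "dist (h (?q t)) (h (0, cis (2 * pi * t))) < \<eta>"
          using elim qx[OF that] by (intro d) (auto simp: lim)
        moreover have "h (0, cis (2 * pi * t)) = (0, cis (2 * pi * G t))" by (simp add: h0 G)
        ultimately have "dist (?q' (H t)) (0, cis (2 * pi * G t)) < \<eta>" unfolding qH[OF that] by metis
        then have "dist (snd (?q' (H t))) (snd (0::real, cis (2 * pi * G t))) < \<eta>"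
          by (rule le_less_trans[OF dist_snd_le])
        then show "cmod (cis (2 * pi * H t) - cis (2 * pi * G t)) < 2 * sin (pi * e')"
          by (simp add: dist_norm \<eta>_def)
      qed (use e' in auto)
      note near = this
      have contD: "continuous_on ?I (\<lambda>t. H t - G t)"
        by (intro continuous_intros contH continuous_on_subset[OF G(1)]) auto
      obtain k :: int where k: "\<And>t. t \<in> ?I \<Longrightarrow> \<bar>H t - G t - k\<bar> < e'"
        using interval_close_to_int[OF connected_Icc contD e'(1,3) near] by blast
      have "H (x N) = y M \<and> H (x (Suc N)) = y (Suc M) \<or> H (x N) = y (Suc M) \<and> H (x (Suc N)) = y M"
      proof (rule interval_bijection_endpoints[OF x(1) contH _ homeomorphism_image1[OF H]])
        show "inj_on H ?I" using homeomorphism_apply1[OF H] by (rule inj_on_inverseI)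
      qed
      moreover have "\<bar>H (x N) - G (x N) - k\<bar> < e" "\<bar>H (x (Suc N)) - G (x (Suc N)) - k\<bar> < e"
        using k[of "x N"] k[of "x (Suc N)"] x(1)[of N] e'(2) by auto
      ultimately show ?case by (intro exI[of _ M] exI[of _ k]) auto
    qed
  qed
  show ?thesis
    by (intro exI[of _ G] conjI allI impI G(1) approx circle_embedding_lift_monotone) (use Gint in auto)
qed

section \<open>Comparison of translation numbers\<close>


context degree_one_lift
begin

lemma modulus_of_continuity:
  assumes "0 < e"
  shows "\<exists>d>0. \<forall>u v. dist v u < d \<longrightarrow> dist (\<gamma> v) (\<gamma> u) < e"
proof -
  \<comment> \<open>An integer shift brings u into [0, 1); the margin of 1 on either side then
    contains every v at distance less than 1.\<close>
  have "uniformly_continuous_on {-1..2} \<gamma>"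
    by (intro compact_uniformly_continuous continuous_on_subset[OF cont]) auto
  then obtain d where d: "0 < d"
    "\<And>u v. u \<in> {-1..2} \<Longrightarrow> v \<in> {-1..2} \<Longrightarrow> dist v u < d \<Longrightarrow> dist (\<gamma> v) (\<gamma> u) < e"
    using assms unfolding uniformly_continuous_on_def by metis
  have "dist (\<gamma> v) (\<gamma> u) < e" if "dist v u < min d 1" for u v
  proof -
    define k where "k = - \<lfloor>u\<rfloor>"
    have "u + of_int k \<in> {-1..2}" "v + of_int k \<in> {-1..2}"
      using that unfolding k_def dist_real_def atLeastAtMost_iff by linarith+
    then have "dist (\<gamma> (v + of_int k)) (\<gamma> (u + of_int k)) < e"
      by (rule d(2)) (use that in \<open>simp add: dist_real_def\<close>)
    then show ?thesis by (simp add: add_int dist_real_def)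
  qed
  then show ?thesis
    using d(1) by (intro exI[of _ "min d 1"]) auto
qed

text \<open>The limit point is taken modulo 1, where the orbit stays in a compact set. For fixed j,
  the values of F at the j-th images of the approximating points are again terms of the given null
  sequence, so the vanishing passes to the whole forward orbit of z.\<close>

lemma periodic_vanishing_on_orbit:
  fixes F :: "real \<Rightarrow> real"
  assumes F: "continuous_on UNIV F" "\<And>t. F (t + 1) = F t"
    and lim: "(\<lambda>N. F ((\<gamma> ^^ N) 0)) \<longlonglongrightarrow> 0"
  obtains z where "\<And>j. F ((\<gamma> ^^ j) z) = 0"
proof -
  note Fint = periodic_int[of F, OF F(2)]
  define u where "u N = frac ((\<gamma> ^^ N) 0)" for N
  have "u N \<in> {0..1}" for N by (simp add: u_def less_imp_le[OF frac_lt_1])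
  then obtain z r where r: "strict_mono r" "(u \<circ> r) \<longlonglongrightarrow> z"
    using compact_Icc[of 0 "1::real"] unfolding compact_eq_seq_compact_metric seq_compact_def by metis
  have "F ((\<gamma> ^^ j) z) = 0" for j
  proof -
    interpret it: degree_one_lift "\<gamma> ^^ j" by (rule iterate)
    have "continuous_on UNIV (\<lambda>t. F ((\<gamma> ^^ j) t))"
      by (rule continuous_on_compose2[OF F(1) it.cont]) simp
    then have "(\<lambda>N. F ((\<gamma> ^^ j) ((u \<circ> r) N))) \<longlonglongrightarrow> F ((\<gamma> ^^ j) z)"
      using r(2) by (rule continuous_on_tendsto_compose) auto
    moreover have "F ((\<gamma> ^^ j) ((u \<circ> r) N)) = F ((\<gamma> ^^ (r N + j)) 0)" for N
    proof -
      have "F ((\<gamma> ^^ j) (u M)) = F ((\<gamma> ^^ (M + j)) 0)" for M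
      proof -
        have "u M = (\<gamma> ^^ M) 0 + of_int (- \<lfloor>(\<gamma> ^^ M) 0\<rfloor>)" by (simp add: u_def frac_def)
        then have "F ((\<gamma> ^^ j) (u M)) = F ((\<gamma> ^^ j) ((\<gamma> ^^ M) 0))"
          by (simp only: iterate_add_int Fint)
        then show ?thesis by (simp add: add.commute[of M] funpow_add)
      qed
      then show ?thesis by simp
    qed
    moreover have "(\<lambda>N. F ((\<gamma> ^^ (r N + j)) 0)) \<longlonglongrightarrow> 0"
      using LIMSEQ_subseq_LIMSEQ[OF LIMSEQ_ignore_initial_segment[OF lim, of j] r(1)]
      by (simp add: comp_def)
    ultimately show ?thesis using LIMSEQ_unique by simp
  qed
  then show ?thesis by (rule that)
qed

lemma tendsto_bounded_displacement: "(\<lambda>n. (\<gamma> (u n) - u n) / real n) \<longlonglongrightarrow> 0"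
proof (rule Lim_null_comparison)
  have "\<bar>\<gamma> (u n) - u n\<bar> \<le> \<bar>\<gamma> 0\<bar> + 1" for n using displacement[of "u n"] by linarith
  then show "\<forall>\<^sub>F n in sequentially. norm ((\<gamma> (u n) - u n) / real n) \<le> (\<bar>\<gamma> 0\<bar> + 1) / real n"
    by (auto intro!: divide_right_mono always_eventually)
qed (rule lim_const_over_n)

text \<open>The iterate preserves the order in 0 < \<gamma> 0 < 1. Hence no arc is a single point
  and none is a full turn.\<close>

lemma orbit_of_0_increasing:
  assumes "0 < \<gamma> 0" "\<gamma> 0 < 1"
  shows "(\<gamma> ^^ N) 0 < (\<gamma> ^^ Suc N) 0" "(\<gamma> ^^ Suc N) 0 < (\<gamma> ^^ N) 0 + 1"
proof -
  interpret it: degree_one_lift "\<gamma> ^^ N" by (rule iterate)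
  have "(\<gamma> ^^ Suc N) 0 = (\<gamma> ^^ N) (\<gamma> 0)" by (simp add: funpow_swap1)
  moreover have "(\<gamma> ^^ N) 1 = (\<gamma> ^^ N) 0 + 1" using it.add_1[of 0] by simp
  ultimately show "(\<gamma> ^^ N) 0 < (\<gamma> ^^ Suc N) 0" "(\<gamma> ^^ Suc N) 0 < (\<gamma> ^^ N) 0 + 1"
    using strict_mono_less[OF it.mono, of 0 "\<gamma> 0"] strict_mono_less[OF it.mono, of "\<gamma> 0" 1] assms
    by simp_all
qed

end

text \<open>The homeomorphism of the limit circles conjugates the two circle maps, or one with the inverse
  of the other, but only along the limit set of the orbit of \<open>1\<close>.\<close>

theorem translation_number_eq_of_homeomorphism:
  assumes "degree_one_lift \<gamma>" "degree_one_lift \<delta>"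
    and \<gamma>0: "0 < \<gamma> 0" "\<gamma> 0 < 1" and \<delta>0: "0 < \<delta> 0" "\<delta> 0 < 1"
    and h: "homeomorphism (arc_space (\<lambda>N. (\<gamma> ^^ N) 0)) (arc_space (\<lambda>N. (\<delta> ^^ N) 0)) h h'"
  shows "degree_one_lift.translation_number \<gamma> = degree_one_lift.translation_number \<delta>"
proof -
  interpret c: degree_one_lift \<gamma> by fact
  interpret d: degree_one_lift \<delta> by fact
  define x where "x N = (\<gamma> ^^ N) 0" for N
  define y where "y N = (\<delta> ^^ N) 0" for N
  have x: "x N < x (Suc N)" "x (Suc N) < x N + 1" "x (Suc N) = \<gamma> (x N)" for N
    using c.orbit_of_0_increasing[OF \<gamma>0] by (simp_all add: x_def)
  have y: "y N < y (Suc N)" "y (Suc N) < y N + 1" "y (Suc N) = \<delta> (y N)" for N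
    using d.orbit_of_0_increasing[OF \<delta>0] by (simp_all add: y_def)
  have h1: "homeomorphism (arc_space x) (arc_space y) h h'"
    using h unfolding x_def[abs_def] y_def[abs_def] .
  obtain G :: "real \<Rightarrow> real" where G: "continuous_on UNIV G"
    and deg: "strict_mono G \<and> (\<forall>t. G (t + 1) = G t + 1) \<or>
      strict_antimono_on UNIV G \<and> (\<forall>t. G (t + 1) = G t - 1)"
    and approx: "\<forall>e>0. \<forall>\<^sub>F N in sequentially. \<exists>M. \<exists>k::int.
      \<bar>y M - G (x N) - k\<bar> < e \<and> \<bar>y (Suc M) - G (x (Suc N)) - k\<bar> < e \<or>
      \<bar>y (Suc M) - G (x N) - k\<bar> < e \<and> \<bar>y M - G (x (Suc N)) - k\<bar> < e"
    using homeomorphism_arc_space_lift[OF h1 less_imp_le[OF x(1)] x(2) less_imp_le[OF y(1)] y(2)]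
    by (elim exE conjE)
  \<comment> \<open>Applied with s one of the points \<open>y M\<close>: the shift k is the same for
    s and \<delta> s, and \<delta> commutes with it, so it cancels.\<close>
  have close: "\<bar>\<delta> u - v\<bar> < e" if "\<bar>s - u - k\<bar> < \<eta>" "\<bar>\<delta> s - v - k\<bar> < \<eta>" "\<eta> \<le> e / 2"
    "\<And>a b. dist b a < \<eta> \<Longrightarrow> dist (\<delta> b) (\<delta> a) < e / 2" for s u v e \<eta> :: real and k :: int
  proof -
    have "dist (\<delta> (u + k)) (\<delta> s) < e / 2" using that(1) by (intro that(4)) (simp add: dist_real_def)
    then show ?thesis using that(2,3) unfolding dist_real_def d.add_int by linarith
  qed
  have modulus: "\<exists>\<eta>>0. \<eta> \<le> e / 2 \<and> (\<forall>a b. dist b a < \<eta> \<longrightarrow> dist (\<delta> b) (\<delta> a) < e / 2)"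
    if e: "0 < e" for e :: real
  proof -
    obtain \<eta> where "0 < \<eta>" "\<And>a b. dist b a < \<eta> \<Longrightarrow> dist (\<delta> b) (\<delta> a) < e / 2"
      using d.modulus_of_continuity[OF half_gt_zero[OF e]] by blast
    then show ?thesis using e by (intro exI[of _ "min \<eta> (e / 2)"]) auto
  qed
  have over: "(\<lambda>n. a / real n) \<longlonglongrightarrow> 0" for a :: real by (rule lim_const_over_n)
  from deg show ?thesis
  proof
    assume deg: "strict_mono G \<and> (\<forall>t. G (t + 1) = G t + 1)"
    then interpret G: degree_one_lift G using G by unfold_locales auto
    have "(\<lambda>N. \<delta> (G (x N)) - G (\<gamma> (x N))) \<longlonglongrightarrow> 0"
    proof (rule tendstoI)
      fix e :: real assume "0 < e"
      then obtain \<eta> where \<eta>: "0 < \<eta>" "\<eta> \<le> e / 2" "\<And>a b. dist b a < \<eta> \<Longrightarrow> dist (\<delta> b) (\<delta> a) < e / 2"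
        using modulus by blast
      have "0 < \<eta> / 3" using \<eta> by simp
      from approx[rule_format, OF this]
      show "\<forall>\<^sub>F N in sequentially. dist (\<delta> (G (x N)) - G (\<gamma> (x N))) 0 < e"
      proof eventually_elim
        case (elim N)
        then obtain M and k :: int where *:
          "\<bar>y M - G (x N) - k\<bar> < \<eta> / 3 \<and> \<bar>y (Suc M) - G (x (Suc N)) - k\<bar> < \<eta> / 3 \<or>
           \<bar>y (Suc M) - G (x N) - k\<bar> < \<eta> / 3 \<and> \<bar>y M - G (x (Suc N)) - k\<bar> < \<eta> / 3" by blast
        \<comment> \<open>In the alternative of the wrong orientation, the opposite orders of the
          two pairs squeeze all four numbers (modulo the shift k) into an interval shorter than
          \<eta>, so the estimate for the right pairing holds as well.\<close>
        have "G (x N) < G (x (Suc N))" using G.mono x(1) by (simp add: strict_mono_less)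
        then have "\<bar>y M - G (x N) - k\<bar> < \<eta>" "\<bar>y (Suc M) - G (x (Suc N)) - k\<bar> < \<eta>"
          using * y(1)[of M] by linarith+
        then show ?case using close[OF _ _ \<eta>(2,3)] by (simp add: x y dist_real_def)
      qed
    qed
    then have "(\<lambda>N. \<delta> (G ((\<gamma> ^^ N) 0)) - G (\<gamma> ((\<gamma> ^^ N) 0))) \<longlonglongrightarrow> 0" by (simp add: x_def)
    moreover have "continuous_on UNIV (\<lambda>t. \<delta> (G t) - G (\<gamma> t))"
      by (intro continuous_intros continuous_on_compose2[OF d.cont G]
          continuous_on_compose2[OF G c.cont]) auto
    ultimately obtain z where z: "\<And>j. \<delta> (G ((\<gamma> ^^ j) z)) - G (\<gamma> ((\<gamma> ^^ j) z)) = 0"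
      using c.periodic_vanishing_on_orbit[of "\<lambda>t. \<delta> (G t) - G (\<gamma> t)"]
      by (auto simp: G.add_1 d.add_1 c.add_1)
    have conj: "(\<delta> ^^ j) (G z) = G ((\<gamma> ^^ j) z)" for j
      by (induction j) (use z in auto)
    \<comment> \<open>G t - t is bounded, so the \<delta>-orbit of G z has the same mean drift as
      the \<gamma>-orbit of z.\<close>
    have "(\<lambda>j. (\<gamma> ^^ j) z / real j + (G ((\<gamma> ^^ j) z) - (\<gamma> ^^ j) z) / real j)
        \<longlonglongrightarrow> c.translation_number + 0"
      by (intro tendsto_add c.tendsto_orbit G.tendsto_bounded_displacement)
    then have "(\<lambda>j. (\<delta> ^^ j) (G z) / real j) \<longlonglongrightarrow> c.translation_number"
      by (simp add: conj add_divide_distrib[symmetric])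
    then show ?thesis using d.tendsto_orbit LIMSEQ_unique by blast
  next
    assume deg: "strict_antimono_on UNIV G \<and> (\<forall>t. G (t + 1) = G t - 1)"
    then have anti: "G b < G a" if "a < b" for a b using that by (simp add: monotone_on_def)
    interpret G: degree_one_lift "\<lambda>t. - G t"
      using deg anti by unfold_locales (auto intro!: continuous_intros G strict_monoI)
    have "(\<lambda>N. \<delta> (G (\<gamma> (x N))) - G (x N)) \<longlonglongrightarrow> 0"
    proof (rule tendstoI)
      fix e :: real assume "0 < e"
      then obtain \<eta> where \<eta>: "0 < \<eta>" "\<eta> \<le> e / 2" "\<And>a b. dist b a < \<eta> \<Longrightarrow> dist (\<delta> b) (\<delta> a) < e / 2"
        using modulus by blast
      have "0 < \<eta> / 3" using \<eta> by simp
      from approx[rule_format, OF this]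
      show "\<forall>\<^sub>F N in sequentially. dist (\<delta> (G (\<gamma> (x N))) - G (x N)) 0 < e"
      proof eventually_elim
        case (elim N)
        then obtain M and k :: int where *:
          "\<bar>y M - G (x N) - k\<bar> < \<eta> / 3 \<and> \<bar>y (Suc M) - G (x (Suc N)) - k\<bar> < \<eta> / 3 \<or>
           \<bar>y (Suc M) - G (x N) - k\<bar> < \<eta> / 3 \<and> \<bar>y M - G (x (Suc N)) - k\<bar> < \<eta> / 3" by blast
        have "G (x (Suc N)) < G (x N)" using anti x(1) by simp
        then have "\<bar>y (Suc M) - G (x N) - k\<bar> < \<eta>" "\<bar>y M - G (x (Suc N)) - k\<bar> < \<eta>"
          using * y(1)[of M] by linarith+
        then show ?case using close[OF _ _ \<eta>(2,3)] by (simp add: x y dist_real_def)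
      qed
    qed
    then have "(\<lambda>N. \<delta> (G (\<gamma> ((\<gamma> ^^ N) 0))) - G ((\<gamma> ^^ N) 0)) \<longlonglongrightarrow> 0" by (simp add: x_def)
    moreover have "continuous_on UNIV (\<lambda>t. \<delta> (G (\<gamma> t)) - G t)"
      by (intro continuous_intros G continuous_on_compose2[OF d.cont]
          continuous_on_compose2[OF G c.cont]) auto
    moreover have "\<delta> (G (\<gamma> (t + 1))) - G (t + 1) = \<delta> (G (\<gamma> t)) - G t" for t
      using deg d.add_int[of "G (\<gamma> t)" "-1"] by (simp add: c.add_1)
    ultimately obtain z where z: "\<And>j. \<delta> (G (\<gamma> ((\<gamma> ^^ j) z))) - G ((\<gamma> ^^ j) z) = 0"
      using c.periodic_vanishing_on_orbit[of "\<lambda>t. \<delta> (G (\<gamma> t)) - G t"] by auto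
    have conj: "(\<delta> ^^ j) (G ((\<gamma> ^^ j) z)) = G z" for j
    proof (induction j)
      case (Suc j)
      then show ?case using z[of j] by (simp add: funpow_swap1)
    qed simp
    \<comment> \<open>Here j steps of \<delta> lead from the moving point G (\<gamma>^j z) to the
      fixed point G z. Since - G t - t is bounded, this displacement is \<gamma>^j z up to a bounded
      error, with a positive sign.\<close>
    have "(\<lambda>j. G z / real j + ((\<gamma> ^^ j) z / real j + (- G ((\<gamma> ^^ j) z) - (\<gamma> ^^ j) z) / real j))
        \<longlonglongrightarrow> 0 + (c.translation_number + 0)"
      by (intro tendsto_add c.tendsto_orbit G.tendsto_bounded_displacement over)
    then have "(\<lambda>j. ((\<delta> ^^ j) (G ((\<gamma> ^^ j) z)) - G ((\<gamma> ^^ j) z)) / real j) \<longlonglongrightarrow> c.translation_number"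
      by (simp add: conj add_divide_distrib[symmetric] diff_divide_distrib[symmetric])
    then show ?thesis
      using d.tendsto_displacement[of "\<lambda>j. G ((\<gamma> ^^ j) z)"] LIMSEQ_unique by blast
  qed
qed

section \<open>Isomorphic function algebras have homeomorphic spectra\<close>

lemma continuous_on_cnj_comp: "continuous_on S f \<Longrightarrow> continuous_on S (\<lambda>x. cnj (f x))"
  by (intro continuous_intros)

text \<open>A character outside the point evaluations would vanish on a finite sum of squares
  \<open>\<bar>\<phi>\<bar>\<^sup>2\<close> without zeros, that is, on a unit.\<close>

lemma character_is_evaluation:
  fixes K :: "'a::metric_space set" and \<xi> :: "('a \<Rightarrow> complex) \<Rightarrow> complex"
  assumes K: "compact K"
    and cong: "\<And>f g. continuous_on K f \<Longrightarrow> continuous_on K g \<Longrightarrow> (\<And>k. k \<in> K \<Longrightarrow> f k = g k) \<Longrightarrow> \<xi> f = \<xi> g"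
    and add: "\<And>f g. continuous_on K f \<Longrightarrow> continuous_on K g \<Longrightarrow> \<xi> (\<lambda>k. f k + g k) = \<xi> f + \<xi> g"
    and mult: "\<And>f g. continuous_on K f \<Longrightarrow> continuous_on K g \<Longrightarrow> \<xi> (\<lambda>k. f k * g k) = \<xi> f * \<xi> g"
    and const: "\<And>c. \<xi> (\<lambda>_. c) = c"
  obtains k where "k \<in> K" "\<And>f. continuous_on K f \<Longrightarrow> \<xi> f = f k"
proof (rule ccontr)
  assume contra: "\<not> thesis"
  note evaluation = that
  have "\<exists>f. continuous_on K f \<and> \<xi> f = 0 \<and> f k \<noteq> 0" if k: "k \<in> K" for k
  proof -
    obtain f where f: "continuous_on K f" "\<xi> f \<noteq> f k" using contra evaluation[OF k] by blast
    \<comment> \<open>Subtracting the constant \<xi> f puts f into the kernel of \<xi> and leaves it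
      nonzero at k.\<close>
    have "\<xi> (\<lambda>k. f k + - \<xi> f) = \<xi> f + \<xi> (\<lambda>_. - \<xi> f)" by (rule add) (auto intro: f)
    then show ?thesis using f
      by (intro exI[of _ "\<lambda>k. f k + - \<xi> f"]) (auto simp: const intro!: continuous_intros)
  qed
  then obtain F where F: "\<And>k. k \<in> K \<Longrightarrow> continuous_on K (F k)" "\<And>k. k \<in> K \<Longrightarrow> \<xi> (F k) = 0"
      "\<And>k. k \<in> K \<Longrightarrow> F k k \<noteq> 0"
    by metis
  have "\<exists>U. open U \<and> {k' \<in> K. F k k' \<noteq> 0} = U \<inter> K" if "k \<in> K" for k
    using continuous_on_open_invariant[of K "F k"] F(1)[OF that]
    by (auto dest!: spec[of _ "- {0}"] simp: Int_def vimage_def conj_commute)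
  then obtain U where U: "\<And>k. k \<in> K \<Longrightarrow> open (U k)" "\<And>k. k \<in> K \<Longrightarrow> {k' \<in> K. F k k' \<noteq> 0} = U k \<inter> K"
    by metis
  have "K \<subseteq> (\<Union>k\<in>K. U k)" using F(3) U(2) by blast
  then obtain C where C: "C \<subseteq> K" "finite C" "K \<subseteq> (\<Union>k\<in>C. U k)"
    using compactE_image[OF K, of K U] U(1) by metis
  define S where "S A k = (\<Sum>c\<in>A. F c k * cnj (F c k))" for A k
  have S: "continuous_on K (S A) \<and> \<xi> (S A) = 0" if "finite A" "A \<subseteq> K" for A
    using that
  proof (induction A rule: finite_induct)
    case empty
    then show ?case using const[of 0] by (simp add: S_def[abs_def])
  next
    case (insert c A)
    have c: "continuous_on K (F c)" "\<xi> (F c) = 0" using F insert.prems by auto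
    have "S (insert c A) = (\<lambda>k. F c k * cnj (F c k) + S A k)"
      using insert.hyps by (auto simp: S_def)
    moreover have "\<xi> (\<lambda>k. F c k * cnj (F c k) + S A k) = \<xi> (\<lambda>k. F c k * cnj (F c k)) + \<xi> (S A)"
      using insert c by (intro add continuous_intros) auto
    \<comment> \<open>The factor \<open>F c\<close> is in the kernel, whatever \<xi> does to its
      conjugate.\<close>
    moreover have "\<xi> (\<lambda>k. F c k * cnj (F c k)) = 0"
      using mult[OF c(1) continuous_on_cnj_comp[OF c(1)]] c(2) by simp
    ultimately show ?case using insert c by (auto intro!: continuous_intros)
  qed
  have S_nz: "S C k \<noteq> 0" if k: "k \<in> K" for k
  proof -
    obtain c where c: "c \<in> C" "k \<in> U c" using C k by blast
    then have "F c k \<noteq> 0" using U(2)[of c] C(1) k by blast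
    have "S C k = of_real (\<Sum>c\<in>C. (cmod (F c k))\<^sup>2)"
      by (simp add: S_def complex_norm_square del: of_real_power)
    moreover have "0 < (\<Sum>c\<in>C. (cmod (F c k))\<^sup>2)"
      using C(2) c(1) \<open>F c k \<noteq> 0\<close> by (intro sum_pos2) auto
    ultimately show ?thesis by (metis less_irrefl of_real_eq_0_iff)
  qed
  have contS: "continuous_on K (S C)" and "\<xi> (S C) = 0" using S[OF C(2,1)] by auto
  have contI: "continuous_on K (\<lambda>k. inverse (S C k))"
    using contS S_nz by (intro continuous_intros) auto
  have "1 = \<xi> (\<lambda>_. 1)" by (simp add: const)
  also have "\<dots> = \<xi> (\<lambda>k. S C k * inverse (S C k))"
    by (rule cong) (use contS contI S_nz in \<open>auto intro!: continuous_intros\<close>)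
  also have "\<dots> = 0" using mult[OF contS contI] \<open>\<xi> (S C) = 0\<close> by simp
  finally show False by simp
qed

text \<open>For each l the map f |-> T f l is a character, hence evaluation at some
  \<open>h l\<close>. T acts on total functions of which only the values on K and L count; the
  equivalence in \<open>inj\<close> therefore contains both well-definedness and injectivity on
  K.\<close>

theorem function_algebra_isomorphism_homeomorphism:
  fixes K :: "'a::metric_space set" and L :: "'b::metric_space set"
    and T :: "('a \<Rightarrow> complex) \<Rightarrow> 'b \<Rightarrow> complex"
  assumes K: "compact K" and L: "compact L"
    and cont: "\<And>f. continuous_on K f \<Longrightarrow> continuous_on L (T f)"
    and inj: "\<And>f g. continuous_on K f \<Longrightarrow> continuous_on K g \<Longrightarrow>
      (\<forall>l\<in>L. T f l = T g l) \<longleftrightarrow> (\<forall>k\<in>K. f k = g k)"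
    and surj: "\<And>g. continuous_on L g \<Longrightarrow> \<exists>f. continuous_on K f \<and> (\<forall>l\<in>L. T f l = g l)"
    and add: "\<And>f g l. continuous_on K f \<Longrightarrow> continuous_on K g \<Longrightarrow> l \<in> L \<Longrightarrow>
      T (\<lambda>k. f k + g k) l = T f l + T g l"
    and mult: "\<And>f g l. continuous_on K f \<Longrightarrow> continuous_on K g \<Longrightarrow> l \<in> L \<Longrightarrow>
      T (\<lambda>k. f k * g k) l = T f l * T g l"
    and const: "\<And>c l. l \<in> L \<Longrightarrow> T (\<lambda>_. c) l = c"
  shows "L homeomorphic K"
proof -
  have "\<exists>k\<in>K. \<forall>f. continuous_on K f \<longrightarrow> T f l = f k" if "l \<in> L" for l
  proof -
    have c: "\<And>f g. continuous_on K f \<Longrightarrow> continuous_on K g \<Longrightarrow> (\<And>k. k \<in> K \<Longrightarrow> f k = g k) \<Longrightarrow> T f l = T g l"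
      using inj that by blast
    show ?thesis
      using character_is_evaluation[OF K, of "\<lambda>f. T f l", OF c add[OF _ _ that] mult[OF _ _ that] const[OF that]]
      by blast
  qed
  then obtain h where h: "\<And>l. l \<in> L \<Longrightarrow> h l \<in> K"
      "\<And>l f. l \<in> L \<Longrightarrow> continuous_on K f \<Longrightarrow> T f l = f (h l)"
    by metis
  have conth: "continuous_on L h"
    unfolding continuous_on_iff
  proof (intro ballI allI impI)
    fix l and e :: real assume l: "l \<in> L" and e: "0 < e"
    \<comment> \<open>The distance to \<open>h l\<close> tests continuity: T f measures how far h
      moves from \<open>h l\<close>.\<close>
    define f where "f k = complex_of_real (dist k (h l))" for k
    have f: "continuous_on K f" unfolding f_def by (intro continuous_intros)
    obtain d where d: "0 < d" "\<And>l'. l' \<in> L \<Longrightarrow> dist l' l < d \<Longrightarrow> dist (T f l') (T f l) < e"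
      using cont[OF f] l e unfolding continuous_on_iff by metis
    have "dist (h l') (h l) < e" if "l' \<in> L" "dist l' l < d" for l'
      using d(2)[OF that] h(2)[OF that(1) f] h(2)[OF l f] by (simp add: f_def)
    then show "\<exists>d>0. \<forall>l'\<in>L. dist l' l < d \<longrightarrow> dist (h l') (h l) < e" using d(1) by blast
  qed
  have injh: "inj_on h L"
  proof (rule inj_onI)
    fix l m assume lm: "l \<in> L" "m \<in> L" "h l = h m"
    have "continuous_on L (\<lambda>l'. complex_of_real (dist l' m))" by (intro continuous_intros)
    then obtain f where f: "continuous_on K f" "\<And>l'. l' \<in> L \<Longrightarrow> T f l' = complex_of_real (dist l' m)"
      using surj by meson
    have "T f l = T f m" using h(2) f(1) lm by simp
    then show "l = m" using f(2) lm by simp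
  qed
  have "K \<subseteq> h ` L"
  proof
    fix k assume k: "k \<in> K"
    show "k \<in> h ` L"
    proof (cases "L = {}")
      case True
      then show ?thesis using inj[of "\<lambda>_. 0" "\<lambda>_. 1"] k by auto
    next
      case False
      \<comment> \<open>The distance to the image of h is sent to 0 by T, so it vanishes on K; the
        image is closed.\<close>
      have f: "continuous_on K (\<lambda>k. complex_of_real (infdist k (h ` L)))" by (intro continuous_intros)
      have "\<forall>l\<in>L. T (\<lambda>k. complex_of_real (infdist k (h ` L))) l = T (\<lambda>_. 0) l"
        using h f by (auto simp: const infdist_zero)
      then have "infdist k (h ` L) = 0" using inj[OF f, of "\<lambda>_. 0"] k by auto
      moreover have "closed (h ` L)" by (intro compact_imp_closed compact_continuous_image conth L)
      ultimately show ?thesis using in_closed_iff_infdist_zero[of "h ` L" k] False by simp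
    qed
  qed
  then have "h ` L = K" using h(1) by blast
  then show ?thesis
    using homeomorphism_compact[OF L conth _ injh] unfolding homeomorphic_def by blast
qed

section \<open>Multiplication operators\<close>

text \<open>Precisely the condition under which \<open>L2_times\<close> does not take its dummy
  value.\<close>

definition bounded_borel :: "(real \<Rightarrow> complex) \<Rightarrow> bool" where
  "bounded_borel g \<longleftrightarrow> g \<in> borel_measurable borel \<and> bounded (range g)"

lemma bounded_borelI:
  assumes "g \<in> borel_measurable borel" "\<And>t. cmod (g t) \<le> C"
  shows "bounded_borel g"
  using assms by (auto simp: bounded_borel_def bounded_iff)

lemma bounded_borel_measurable: "bounded_borel g \<Longrightarrow> g \<in> borel_measurable borel"
  by (simp add: bounded_borel_def)

lemma bounded_borel_bound:
  assumes "bounded_borel g"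
  shows "\<exists>C\<ge>0. \<forall>t. cmod (g t) \<le> C"
proof -
  obtain C where C: "\<forall>t. cmod (g t) \<le> C" using assms by (auto simp: bounded_borel_def bounded_iff)
  then have "0 \<le> C" using norm_ge_zero order_trans by blast
  with C show ?thesis by blast
qed

lemma bounded_borel_const [simp, intro]: "bounded_borel (\<lambda>_. c)"
  by (rule bounded_borelI) auto

lemma bounded_borel_add [intro]:
  assumes "bounded_borel f" "bounded_borel g"
  shows "bounded_borel (\<lambda>t. f t + g t)"
proof -
  obtain C where C: "0 \<le> C" "\<forall>t. cmod (f t) \<le> C" using bounded_borel_bound[OF assms(1)] by blast
  obtain D where D: "0 \<le> D" "\<forall>t. cmod (g t) \<le> D" using bounded_borel_bound[OF assms(2)] by blast
  show ?thesis
  proof (rule bounded_borelI)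
    show "cmod (f t + g t) \<le> C + D" for t
      using norm_triangle_ineq[of "f t" "g t"] C(2) D(2) by (smt (verit, best))
  qed (use assms[THEN bounded_borel_measurable] in simp)
qed

lemma bounded_borel_mult [intro]:
  assumes "bounded_borel f" "bounded_borel g"
  shows "bounded_borel (\<lambda>t. f t * g t)"
proof -
  obtain C where C: "0 \<le> C" "\<forall>t. cmod (f t) \<le> C" using bounded_borel_bound[OF assms(1)] by blast
  obtain D where D: "0 \<le> D" "\<forall>t. cmod (g t) \<le> D" using bounded_borel_bound[OF assms(2)] by blast
  show ?thesis
  proof (rule bounded_borelI)
    show "cmod (f t * g t) \<le> C * D" for t
      unfolding norm_mult using C D by (intro mult_mono norm_ge_zero) auto
  qed (use assms[THEN bounded_borel_measurable] in simp)
qed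

lemma bounded_borel_cnj [intro]:
  assumes "bounded_borel f"
  shows "bounded_borel (\<lambda>t. cnj (f t))"
proof -
  obtain C where C: "0 \<le> C" "\<forall>t. cmod (f t) \<le> C" using bounded_borel_bound[OF assms] by blast
  show ?thesis
  proof (rule bounded_borelI)
    show "(\<lambda>t. cnj (f t)) \<in> borel_measurable borel"
      using bounded_borel_measurable[OF assms] by (rule borel_measurable_continuous_on[rotated]) (intro continuous_intros)
    show "cmod (cnj (f t)) \<le> C" for t using C(2) by simp
  qed
qed

lemma bounded_borel_diff [intro]:
  assumes "bounded_borel f" "bounded_borel g"
  shows "bounded_borel (\<lambda>t. f t - g t)"
  using bounded_borel_add[OF assms(1) bounded_borel_mult[OF bounded_borel_const[of "-1"] assms(2)]] by simp

lemma bounded_borel_comp: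
  assumes "bounded_borel f" "continuous_on UNIV \<gamma>"
  shows "bounded_borel (\<lambda>t. f (\<gamma> t))"
proof -
  obtain C where C: "0 \<le> C" "\<forall>t. cmod (f t) \<le> C" using bounded_borel_bound[OF assms(1)] by blast
  show ?thesis
  proof (rule bounded_borelI)
    show "(\<lambda>t. f (\<gamma> t)) \<in> borel_measurable borel"
      by (rule measurable_compose[OF borel_measurable_continuous_onI[OF assms(2)]
            bounded_borel_measurable[OF assms(1)]])
  qed (use C in blast)
qed

lemma bounded_borel_restrict:
  assumes "bounded_borel f"
  shows "bounded_borel (\<lambda>t. if a \<le> t then f t else 0)"
proof -
  obtain C where C: "0 \<le> C" "\<forall>t. cmod (f t) \<le> C" using bounded_borel_bound[OF assms] by blast
  show ?thesis
    by (rule bounded_borelI[of _ C]) (use C bounded_borel_measurable[OF assms] in auto)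
qed

lemma bounded_borel_periodic:
  assumes "continuous_on UNIV b" "\<And>t. b (t + 1) = b t"
  shows "bounded_borel b"
proof -
  have "bounded (b ` {0..1})"
    by (intro compact_imp_bounded compact_continuous_image continuous_on_subset[OF assms(1)]) auto
  then obtain C where C: "\<forall>t\<in>{0..1}. cmod (b t) \<le> C" by (auto simp: bounded_iff)
  note per = periodic_int[of b, OF assms(2)]
  have "b t = b (frac t)" for t using per[of "frac t" "\<lfloor>t\<rfloor>"] by (simp add: frac_def)
  then have "cmod (b t) \<le> C" for t
    using C[rule_format, of "frac t"] by (simp add: less_imp_le[OF frac_lt_1])
  then show ?thesis
    by (intro bounded_borelI borel_measurable_continuous_onI assms) auto
qed

lemma sq_int_mult_bounded: "bounded_borel g \<Longrightarrow> sq_int f \<Longrightarrow> sq_int (\<lambda>t. g t * f t)"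
  by (auto simp: bounded_borel_def intro: sq_int_mult)

lemma mult_op_apply: "bounded_borel g \<Longrightarrow> sq_int f \<Longrightarrow> mult_op g (to_L2 f) = to_L2 (\<lambda>t. g t * f t)"
  by (auto simp: bounded_borel_def intro: mult_op_to_L2)

lemma blinfun_eq_on_to_L2I:
  fixes S T :: "L2 \<Rightarrow>\<^sub>L L2"
  assumes "\<And>f. sq_int f \<Longrightarrow> S (to_L2 f) = T (to_L2 f)"
  shows "S = T"
proof (rule blinfun_eqI)
  fix F
  obtain f where "sq_int f" "F = to_L2 f" by (rule L2_obtain)
  then show "S F = T F" using assms by simp
qed

lemma to_L2_add: "sq_int f \<Longrightarrow> sq_int g \<Longrightarrow> to_L2 f + to_L2 g = to_L2 (\<lambda>t. f t + g t)"
  by transfer (simp add: l2_eq_def sq_int_add)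

lemma mult_op_add:
  assumes "bounded_borel f" "bounded_borel g"
  shows "mult_op f + mult_op g = mult_op (\<lambda>t. f t + g t)"
  by (rule blinfun_eq_on_to_L2I)
    (simp add: assms bounded_borel_add mult_op_apply sq_int_mult_bounded to_L2_add plus_blinfun.rep_eq distrib_right)

lemma mult_op_compose:
  assumes "bounded_borel f" "bounded_borel g"
  shows "mult_op f o\<^sub>L mult_op g = mult_op (\<lambda>t. f t * g t)"
  by (rule blinfun_eq_on_to_L2I)
    (simp add: assms bounded_borel_mult mult_op_apply sq_int_mult_bounded mult.assoc)

lemma mult_op_zero: "mult_op (\<lambda>_. 0) = 0"
proof (rule blinfun_eq_on_to_L2I)
  fix f :: "real \<Rightarrow> complex" assume "sq_int f"
  have "to_L2 (\<lambda>_. 0) = 0" by transfer (simp add: l2_eq_def sq_int_zero)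
  then show "mult_op (\<lambda>_. 0) (to_L2 f) = blinfun_apply 0 (to_L2 f)"
    using \<open>sq_int f\<close> by (simp add: mult_op_apply)
qed

lemma mult_op_diff:
  assumes "bounded_borel f" "bounded_borel g"
  shows "mult_op f - mult_op g = mult_op (\<lambda>t. f t - g t)"
proof -
  have "mult_op (\<lambda>t. f t - g t) + mult_op g = mult_op f"
    using assms by (simp add: mult_op_add bounded_borel_diff)
  then show ?thesis by (metis add_diff_cancel_right')
qed

lemma adj_mult_op:
  assumes "bounded_borel f"
  shows "adj (mult_op f) = mult_op (\<lambda>t. cnj (f t))"
proof (rule adj_eqI)
  fix F G
  obtain u where u: "sq_int u" "F = to_L2 u" by (rule L2_obtain)
  obtain v where v: "sq_int v" "G = to_L2 v" by (rule L2_obtain)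
  show "cinner (mult_op f F) G = cinner F (mult_op (\<lambda>t. cnj (f t)) G)"
    using u v assms
    by (simp add: mult_op_apply bounded_borel_cnj cinner_to_L2 sq_int_mult_bounded mult.assoc mult.left_commute)
qed

lemma clinear_mult_op:
  assumes "bounded_borel f"
  shows "clinear_op (mult_op f)"
proof -
  have "mult_op f o\<^sub>L scalar_op c = scalar_op c o\<^sub>L mult_op f" for c
    using assms by (simp add: mult_op_compose mult.commute)
  then show ?thesis unfolding clinear_op_def by (metis blinfun_apply_blinfun_compose)
qed

lemma norm_to_L2:
  assumes "sq_int f"
  shows "(norm (to_L2 f))\<^sup>2 = (LINT t|lborel. (cmod (f t))\<^sup>2)"
proof -
  have "(LINT t|lborel. f t * cnj (f t)) = of_real (LINT t|lborel. (cmod (f t))\<^sup>2)"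
    unfolding integral_complex_of_real[symmetric] by (simp add: complex_norm_square del: of_real_power)
  then show ?thesis using assms by (simp add: power2_norm_eq_inner inner_L2_def cinner_to_L2)
qed

lemma norm_mult_op_le:
  assumes "bounded_borel g" "\<And>t. cmod (g t) \<le> C"
  shows "norm (mult_op g) \<le> C"
proof (rule norm_blinfun_bound)
  show "0 \<le> C" using norm_ge_zero assms(2) by (rule order_trans)
  fix F
  show "norm (mult_op g F) \<le> C * norm F"
  proof (rule power2_le_imp_le)
    show "(norm (mult_op g F))\<^sup>2 \<le> (C * norm F)\<^sup>2"
      using cinner_L2_times_le[of g C F] assms
      by (simp add: power2_norm_eq_inner inner_L2_def power_mult_distrib bounded_borel_def mult_op.rep_eq)
  qed (simp add: \<open>0 \<le> C\<close>)
qed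

text \<open>Tested on the indicator function of the interval. A bound on an interval replaces the
  essential supremum, since the symbols met later are continuous from the right on the half
  line.\<close>

lemma norm_mult_op_ge:
  assumes g: "bounded_borel g" and ab: "a < b" and c: "0 \<le> c" "\<And>t. a < t \<Longrightarrow> t < b \<Longrightarrow> c \<le> cmod (g t)"
  shows "c \<le> norm (mult_op g)"
proof -
  define f :: "real \<Rightarrow> complex" where "f = indicator {a<..<b}"
  have f2: "(cmod (f t))\<^sup>2 = indicator {a<..<b} t" for t by (simp add: f_def indicator_def)
  have f: "sq_int f" unfolding sq_int_def f2
    using ab by (simp add: f_def integrable_indicator_iff)
  have gf: "sq_int (\<lambda>t. g t * f t)" by (rule sq_int_mult_bounded[OF g f])
  have nf: "(norm (to_L2 f))\<^sup>2 = b - a" unfolding norm_to_L2[OF f] f2 using ab by simp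
  have "(LINT t|lborel. c\<^sup>2 * (cmod (f t))\<^sup>2) \<le> (LINT t|lborel. (cmod (g t * f t))\<^sup>2)"
  proof (rule integral_mono)
    show "c\<^sup>2 * (cmod (f t))\<^sup>2 \<le> (cmod (g t * f t))\<^sup>2" for t
      using c power_mono[of c "cmod (g t)" 2] by (auto simp: f_def indicator_def norm_mult)
  qed (use f gf in \<open>auto simp: sq_int_def\<close>)
  then have "c\<^sup>2 * (norm (to_L2 f))\<^sup>2 \<le> (norm (mult_op g (to_L2 f)))\<^sup>2"
    using f gf g by (simp add: mult_op_apply norm_to_L2)
  also have "\<dots> \<le> (norm (mult_op g) * norm (to_L2 f))\<^sup>2"
    by (intro power_mono norm_blinfun) simp
  finally have "c\<^sup>2 \<le> (norm (mult_op g))\<^sup>2"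
    using ab by (simp add: power_mult_distrib nf)
  then show ?thesis by (rule power2_le_imp_le) simp
qed

section \<open>Compression of the weighted composition operator\<close>

abbreviation half_line_indicator :: "real \<Rightarrow> complex" where
  "half_line_indicator \<equiv> indicator {0..}"

lemma bounded_borel_half_line: "bounded_borel half_line_indicator"
  by (rule bounded_borelI[of _ 1]) (auto simp: indicator_def)

lemma projH_mult_op_projH:
  assumes "bounded_borel f"
  shows "projH o\<^sub>L mult_op f o\<^sub>L projH = mult_op (\<lambda>t. if 0 \<le> t then f t else 0)"
proof -
  have "half_line_indicator t * f t * half_line_indicator t = (if 0 \<le> t then f t else 0)" for t
    by (simp add: indicator_def)
  then show ?thesis
    unfolding projH_eq_mult_op
    by (simp add: mult_op_compose bounded_borel_mult bounded_borel_half_line assms)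
qed

lemma projH_idem: "projH o\<^sub>L projH = projH"
proof -
  have "(\<lambda>t. half_line_indicator t * half_line_indicator t) = half_line_indicator"
    by (auto simp: indicator_def)
  then show ?thesis unfolding projH_eq_mult_op by (simp only: mult_op_compose bounded_borel_half_line)
qed

lemma cinner_projH: "cinner (projH F) G = cinner F (projH G)"
proof -
  obtain u where u: "sq_int u" "F = to_L2 u" by (rule L2_obtain)
  obtain v where v: "sq_int v" "G = to_L2 v" by (rule L2_obtain)
  have cnj_ind: "cnj (half_line_indicator t) = half_line_indicator t" for t by (simp add: indicator_def)
  show ?thesis
    using u v unfolding projH_eq_mult_op
    by (simp add: mult_op_apply bounded_borel_half_line cinner_to_L2 sq_int_mult_bounded
        mult.assoc mult.left_commute cnj_ind)
qed

text \<open>The inverse of a unitary operator is linear and isometric, and it satisfies the adjoint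
  relation. This is the witness from which the adjoint of the compression is computed by
  \<open>adj_eqI\<close>.\<close>

lemma unitary_op_inverse:
  assumes "unitary_op W"
  obtains V :: "L2 \<Rightarrow>\<^sub>L L2" where "V o\<^sub>L W = id_blinfun" "\<And>F G. cinner (W F) G = cinner F (V G)"
proof -
  have c: "cinner (W F) (W G) = cinner F G" for F G using assms by (simp add: unitary_op_def)
  have surj: "surj (blinfun_apply W)" using assms by (simp add: unitary_op_def)
  have norm: "norm (W F) = norm F" for F by (simp add: norm_eq_sqrt_inner inner_L2_def c)
  have inj: "inj (blinfun_apply W)"
  proof (rule injI)
    fix F G assume "W F = W G"
    then have "norm (F - G) = 0" using norm[of "F - G"] by (simp add: blinfun.diff_right)
    then show "F = G" by simp
  qed
  define v where "v = inv (blinfun_apply W)"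
  have Wv: "W (v F) = F" and vW: "v (W F) = F" for F
    using surj inj by (simp_all add: v_def surj_f_inv_f)
  have "bounded_linear v"
  proof (rule bounded_linear_intro[where K = 1])
    show "v (F + G) = v F + v G" for F G
      using vW[of "v F + v G"] by (simp add: blinfun.add_right Wv)
    show "v (r *\<^sub>R F) = r *\<^sub>R v F" for r F
      using vW[of "r *\<^sub>R v F"] by (simp add: blinfun.scaleR_right Wv)
    show "norm (v F) \<le> norm F * 1" for F using norm[of "v F"] by (simp add: Wv)
  qed
  then have app: "blinfun_apply (Blinfun v) = v" by (rule bounded_linear_Blinfun_apply)
  show ?thesis
  proof (rule that[of "Blinfun v"])
    show "Blinfun v o\<^sub>L W = id_blinfun" by (rule blinfun_eqI) (simp add: app vW)
    show "cinner (W F) G = cinner F (Blinfun v G)" for F G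
      using c[of F "v G"] by (simp add: app Wv)
  qed
qed

text \<open>The weight commutes with multiplication; only the substitution acts on b.\<close>

lemma induces_intertwine:
  assumes W: "induces \<gamma> W" and \<gamma>: "continuous_on UNIV \<gamma>" and b: "bounded_borel b"
  shows "W o\<^sub>L mult_op b = mult_op (\<lambda>t. b (\<gamma> t)) o\<^sub>L W"
proof (rule blinfun_eq_on_to_L2I)
  fix f assume f: "sq_int f"
  have "weighted_comp \<gamma> (\<lambda>t. b t * f t) = (\<lambda>t. b (\<gamma> t) * weighted_comp \<gamma> f t)"
    by (auto simp: weighted_comp_def)
  then show "(W o\<^sub>L mult_op b) (to_L2 f) = (mult_op (\<lambda>t. b (\<gamma> t)) o\<^sub>L W) (to_L2 f)"
    using W f b bounded_borel_comp[OF b \<gamma>]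
    by (simp add: induces_def mult_op_apply sq_int_mult_bounded)
qed

lemma blinfun_compose_assoc: "(R o\<^sub>L S) o\<^sub>L T = R o\<^sub>L (S o\<^sub>L T)"
  by (rule blinfun_eqI) simp

text \<open>\<open>op_power\<close> adds factors on the left. The innermost conjugation needs the
  new factor of the power of U on the right; \<open>projH\<close>, as the zeroth power, is a unit
  for T.\<close>

lemma op_power_Suc_right:
  assumes "projH o\<^sub>L T = T" "T o\<^sub>L projH = T"
  shows "op_power T (Suc n) = op_power T n o\<^sub>L T"
proof (induction n)
  case (Suc n)
  then show ?case by (metis blinfun_compose_assoc op_power.simps(2))
qed (simp add: assms)

text \<open>One conjugation restricts the multiplier to the half line and then composes it with the
  inverse of \<gamma>, which moves the cut from 0 to \<gamma> 0. Iteration moves it along the orbit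
  of 0.\<close>

lemma compression_of_mult_op:
  assumes lift: "degree_one_lift \<gamma>" and W: "induces \<gamma> W" "unitary_op W"
    and a: "bounded_borel a" and \<gamma>0: "0 < \<gamma> 0"
  shows "op_power (adj (projH o\<^sub>L W o\<^sub>L projH)) n o\<^sub>L (projH o\<^sub>L mult_op a o\<^sub>L projH)
      o\<^sub>L op_power (projH o\<^sub>L W o\<^sub>L projH) n =
    mult_op (\<lambda>t. if (\<gamma> ^^ n) 0 \<le> t then a ((inv \<gamma> ^^ n) t) else 0)"
proof -
  interpret degree_one_lift \<gamma> by (rule lift)
  interpret i: degree_one_lift "inv \<gamma>" by (rule inv_lift)
  obtain V where V: "V o\<^sub>L W = id_blinfun" "\<And>F G. cinner (W F) G = cinner F (V G)"
    using unitary_op_inverse[OF W(2)] by blast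
  define U where "U = projH o\<^sub>L W o\<^sub>L projH"
  define U' where "U' = projH o\<^sub>L V o\<^sub>L projH"
  have "adj U = U'" by (rule adj_eqI) (simp add: U_def U'_def cinner_projH V)
  have sides: "projH o\<^sub>L U = U" "U o\<^sub>L projH = U" "projH o\<^sub>L U' = U'" "U' o\<^sub>L projH = U'"
    unfolding U_def U'_def by (metis blinfun_compose_assoc projH_idem)+
  have inv1: "inv \<gamma> (\<gamma> t) = t" "\<gamma> (inv \<gamma> t) = t" for t
    using bij by (simp_all add: bij_is_inj bij_is_surj surj_f_inv_f)
  have ge: "s \<le> inv \<gamma> t \<longleftrightarrow> \<gamma> s \<le> t" for s t
    using strict_mono_less_eq[OF mono, of s "inv \<gamma> t"] by (simp add: inv1)
  have conj: "U' o\<^sub>L mult_op c o\<^sub>L U = mult_op (\<lambda>t. if 0 \<le> t \<and> \<gamma> 0 \<le> t then c (inv \<gamma> t) else 0)"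
    if c: "bounded_borel c" for c
  proof -
    define d where "d = (\<lambda>t. if 0 \<le> t then c t else 0)"
    have d: "bounded_borel d" unfolding d_def by (rule bounded_borel_restrict[OF c])
    have d': "bounded_borel (\<lambda>t. d (inv \<gamma> t))" by (rule bounded_borel_comp[OF d i.cont])
    have "U' o\<^sub>L mult_op c o\<^sub>L U = projH o\<^sub>L (V o\<^sub>L ((projH o\<^sub>L mult_op c o\<^sub>L projH) o\<^sub>L W)) o\<^sub>L projH"
      unfolding U_def U'_def by (simp add: blinfun_compose_assoc)
    also have "projH o\<^sub>L mult_op c o\<^sub>L projH = mult_op d"
      unfolding d_def by (rule projH_mult_op_projH[OF c])
    \<comment> \<open>The intertwining relation for d composed with the inverse of \<gamma>, read
      from right to left.\<close>
    also have "mult_op d o\<^sub>L W = W o\<^sub>L mult_op (\<lambda>t. d (inv \<gamma> t))"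
      using induces_intertwine[OF W(1) cont d'] by (simp add: inv1)
    also have "V o\<^sub>L (W o\<^sub>L mult_op (\<lambda>t. d (inv \<gamma> t))) = mult_op (\<lambda>t. d (inv \<gamma> t))"
      by (rule blinfun_eqI) (metis V(1) blinfun_apply_blinfun_compose blinfun_apply_id_blinfun id_apply)
    also have "projH o\<^sub>L mult_op (\<lambda>t. d (inv \<gamma> t)) o\<^sub>L projH =
        mult_op (\<lambda>t. if 0 \<le> t then d (inv \<gamma> t) else 0)"
      by (rule projH_mult_op_projH[OF d'])
    also have "(\<lambda>t. if 0 \<le> t then d (inv \<gamma> t) else 0) = (\<lambda>t. if 0 \<le> t \<and> \<gamma> 0 \<le> t then c (inv \<gamma> t) else 0)"
      by (auto simp: d_def ge)
    finally show ?thesis .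
  qed
  \<comment> \<open>Makes the cut at 0 that every conjugation introduces invisible behind the cut at
    the orbit point.\<close>
  have nonneg: "0 \<le> (\<gamma> ^^ n) 0" for n
  proof (induction n)
    case (Suc n)
    then show ?case using \<gamma>0 strict_mono_less_eq[OF mono, of 0 "(\<gamma> ^^ n) 0"] by simp
  qed simp
  have "op_power U' n o\<^sub>L (projH o\<^sub>L mult_op a o\<^sub>L projH) o\<^sub>L op_power U n =
    mult_op (\<lambda>t. if (\<gamma> ^^ n) 0 \<le> t then a ((inv \<gamma> ^^ n) t) else 0)"
  proof (induction n)
    case 0
    have "projH o\<^sub>L (projH o\<^sub>L mult_op a o\<^sub>L projH) o\<^sub>L projH = projH o\<^sub>L mult_op a o\<^sub>L projH"
      by (metis blinfun_compose_assoc projH_idem)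
    then show ?case by (simp add: projH_mult_op_projH[OF a] cong: if_cong)
  next
    case (Suc n)
    let ?c = "\<lambda>t. if (\<gamma> ^^ n) 0 \<le> t then a ((inv \<gamma> ^^ n) t) else 0"
    interpret it: degree_one_lift "inv \<gamma> ^^ n" by (rule i.iterate)
    have c: "bounded_borel ?c"
      by (rule bounded_borel_restrict[OF bounded_borel_comp[OF a it.cont]])
    have "op_power U' (Suc n) o\<^sub>L (projH o\<^sub>L mult_op a o\<^sub>L projH) o\<^sub>L op_power U (Suc n) =
        U' o\<^sub>L (op_power U' n o\<^sub>L (projH o\<^sub>L mult_op a o\<^sub>L projH) o\<^sub>L op_power U n) o\<^sub>L U"
      unfolding op_power_Suc_right[OF sides(1,2)] by (simp add: blinfun_compose_assoc)
    also have "\<dots> = U' o\<^sub>L mult_op ?c o\<^sub>L U" unfolding Suc ..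
    also have "\<dots> = mult_op (\<lambda>t. if 0 \<le> t \<and> \<gamma> 0 \<le> t then ?c (inv \<gamma> t) else 0)"
      by (rule conj[OF c])
    also have "(\<lambda>t. if 0 \<le> t \<and> \<gamma> 0 \<le> t then ?c (inv \<gamma> t) else 0) =
        (\<lambda>t. if (\<gamma> ^^ Suc n) 0 \<le> t then a ((inv \<gamma> ^^ Suc n) t) else 0)"
    proof
      fix t
      have "\<gamma> 0 \<le> (\<gamma> ^^ Suc n) 0" using strict_mono_less_eq[OF mono] nonneg[of n] by simp
      then show "(if 0 \<le> t \<and> \<gamma> 0 \<le> t then ?c (inv \<gamma> t) else 0) =
          (if (\<gamma> ^^ Suc n) 0 \<le> t then a ((inv \<gamma> ^^ Suc n) t) else 0)"
        using \<gamma>0 by (auto simp: ge funpow_swap1)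
    qed
    finally show ?case .
  qed
  then show ?thesis unfolding \<open>adj U = U'\<close>[symmetric] U_def .
qed

section \<open>The algebra as a function algebra\<close>

text \<open>The circle is a quotient of [0, 1]: the preimage of a closed set under B is the image of
  a compact subset of [0, 1].\<close>

lemma periodic_descends_to_circle:
  fixes b :: "real \<Rightarrow> complex"
  assumes cont: "continuous_on UNIV b" and per: "\<And>t. b (t + 1) = b t"
  shows "\<exists>B. continuous_on (sphere 0 1) B \<and> (\<forall>t. B (cis (2 * pi * t)) = b t)"
proof -
  note per' = periodic_int[of b, OF per]
  define B where "B z = b (SOME t. z = cis (2 * pi * t))" for z
  have B: "B (cis (2 * pi * t)) = b t" for t
  proof -
    have "cis (2 * pi * t) = cis (2 * pi * (SOME s. cis (2 * pi * t) = cis (2 * pi * s)))"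
      by (rule someI) simp
    then have "t - (SOME s. cis (2 * pi * t) = cis (2 * pi * s)) \<in> \<int>" by (simp only: cis_2pi_eq_iff)
    then obtain k :: int where "t - (SOME s. cis (2 * pi * t) = cis (2 * pi * s)) = k"
      by (auto elim: Ints_cases)
    then have "t = (SOME s. cis (2 * pi * t) = cis (2 * pi * s)) + k" by simp
    then show ?thesis unfolding B_def using per' by metis
  qed
  have "continuous_on (sphere 0 1) B"
    unfolding continuous_on_closed_vimage[OF closed_sphere]
  proof (intro allI impI)
    fix C :: "complex set" assume "closed C"
    have "closed ({0..1} \<inter> b -` C)"
      by (intro continuous_closed_preimage continuous_on_subset[OF cont] \<open>closed C\<close>) auto
    then have "compact ({0..1} \<inter> b -` C)"
      using compact_Int_closed[of "{0..1}" "{0..1} \<inter> b -` C"] by (simp add: Int_absorb1)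
    moreover have "B -` C \<inter> sphere 0 1 = (\<lambda>t. cis (2 * pi * t)) ` ({0..1} \<inter> b -` C)"
    proof (intro equalityI subsetI)
      fix z assume z: "z \<in> B -` C \<inter> sphere 0 1"
      then obtain t where "t \<in> {0..<1}" "z = cis (2 * pi * t)" using unit_circle_cis_2pi by blast
      then show "z \<in> (\<lambda>t. cis (2 * pi * t)) ` ({0..1} \<inter> b -` C)" using z by (auto simp: B)
    qed (auto simp: B)
    ultimately show "closed (B -` C \<inter> sphere 0 1)"
      by (simp add: compact_imp_closed compact_continuous_image continuous_intros)
  qed
  then show ?thesis using B by blast
qed

text \<open>\<open>level_height x t\<close> is \<open>1 / (N + 1)\<close> on \<open>[x N, x (N + 1))\<close> and \<open>0\<close> beyond all \<open>x N\<close>.\<close>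

definition level_height :: "(nat \<Rightarrow> real) \<Rightarrow> real \<Rightarrow> real" where
  "level_height x t = (if \<exists>N. t < x N then 1 / real (LEAST N. t < x N) else 0)"

definition spectrum_point :: "(nat \<Rightarrow> real) \<Rightarrow> real \<Rightarrow> real \<times> complex" where
  "spectrum_point x t = (level_height x t, cis (2 * pi * t))"

text \<open>The value 0 on the negative half line matches the extension by zero of operators on the
  half line.\<close>

definition fun_symbol :: "(nat \<Rightarrow> real) \<Rightarrow> (real \<times> complex \<Rightarrow> complex) \<Rightarrow> real \<Rightarrow> complex" where
  "fun_symbol x \<phi> t = (if 0 \<le> t then \<phi> (spectrum_point x t) else 0)"

definition fun_op :: "(nat \<Rightarrow> real) \<Rightarrow> (real \<times> complex \<Rightarrow> complex) \<Rightarrow> L2 \<Rightarrow>\<^sub>L L2" where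
  "fun_op x \<phi> = mult_op (fun_symbol x \<phi>)"

definition fun_algebra :: "(nat \<Rightarrow> real) \<Rightarrow> (L2 \<Rightarrow>\<^sub>L L2) set" where
  "fun_algebra x = fun_op x ` {\<phi>. continuous_on (arc_space x) \<phi>}"

text \<open>The generators of the algebra: a periodic a, conjugated n times, gives b equal to a
  composed with the inverse of \<gamma>^n.\<close>

definition tail_op :: "(nat \<Rightarrow> real) \<Rightarrow> nat \<Rightarrow> (real \<Rightarrow> complex) \<Rightarrow> L2 \<Rightarrow>\<^sub>L L2" where
  "tail_op x n b = mult_op (\<lambda>t. if x n \<le> t then b t else 0)"

section \<open>Functions on the spectrum as multiplication operators\<close>

locale breakpoints =
  fixes x :: "nat \<Rightarrow> real"
  assumes x0: "x 0 = 0" and x_less: "\<And>N. x N < x (Suc N)"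
begin

lemma x_mono: "M \<le> N \<Longrightarrow> x M \<le> x N"
  by (rule lift_Suc_mono_le[of x, OF less_imp_le[OF x_less]])

lemma x_nonneg: "0 \<le> x N"
  using x_mono[of 0 N] x0 by simp

lemma level_height_arc:
  assumes "x N \<le> t" "t < x (Suc N)"
  shows "level_height x t = 1 / real (Suc N)"
proof -
  have "(LEAST M. t < x M) = Suc N"
  proof (rule Least_equality)
    fix M assume "t < x M"
    then have "\<not> M \<le> N" using x_mono[of M N] assms by auto
    then show "Suc N \<le> M" by simp
  qed (rule assms)
  then show ?thesis using assms unfolding level_height_def by auto
qed

lemma level_height_beyond: "(\<And>N. x N \<le> t) \<Longrightarrow> level_height x t = 0"
  unfolding level_height_def by (simp add: not_less[symmetric])

lemma level_cases:
  assumes "0 \<le> t"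
  obtains (arc) N where "x N \<le> t" "t < x (Suc N)" | (beyond) "\<And>N. x N \<le> t"
proof (cases "\<exists>N. t < x N")
  case True
  define M where "M = (LEAST N. t < x N)"
  have M: "t < x M" unfolding M_def using True by (rule LeastI_ex)
  then have "M \<noteq> 0" using assms x0 by (metis not_less)
  then obtain N where N: "M = Suc N" by (cases M) auto
  then have "\<not> t < x N" unfolding M_def using not_less_Least by (metis lessI)
  then show ?thesis using M N by (intro arc[of N]) auto
next
  case False
  then show ?thesis by (intro beyond) (simp add: not_less)
qed

lemma spectrum_point_in:
  assumes "0 \<le> t"
  shows "spectrum_point x t \<in> arc_space x"
  using assms
proof (cases t rule: level_cases)
  case (arc N)
  then have "spectrum_point x t \<in> arc_level x N"
    by (auto simp: spectrum_point_def arc_level_def level_height_arc[OF arc])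
  then show ?thesis using arc_level_subset by blast
next
  case beyond
  then show ?thesis by (auto simp: spectrum_point_def arc_space_def level_height_beyond)
qed

lemma level_height_le:
  assumes "0 \<le> t" "x N \<le> t"
  shows "level_height x t \<le> 1 / real (Suc N)"
  using assms(1)
proof (cases t rule: level_cases)
  case (arc M)
  have "N \<le> M"
  proof (rule ccontr)
    assume "\<not> N \<le> M"
    then have "x (Suc M) \<le> x N" by (intro x_mono) simp
    then show False using arc assms(2) by simp
  qed
  then show ?thesis unfolding level_height_arc[OF arc] by (simp add: field_simps)
qed (simp add: level_height_beyond)

lemma level_height_ge:
  assumes "0 \<le> t" "t < x (Suc N)"
  shows "1 / real (Suc N) \<le> level_height x t"
  using assms(1)
proof (cases t rule: level_cases)
  case (arc M)
  have "M \<le> N"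
  proof (rule ccontr)
    assume "\<not> M \<le> N"
    then have "x (Suc N) \<le> x M" by (intro x_mono) simp
    then show False using arc assms by simp
  qed
  then show ?thesis unfolding level_height_arc[OF arc] by (simp add: field_simps)
next
  case beyond
  then show ?thesis using assms(2) by (meson not_less)
qed

lemma level_height_nonneg: "0 \<le> level_height x t"
  by (simp add: level_height_def)

text \<open>A function on the spectrum alone has no values at the points needed below: measurability
  of symbols and the freezing of heights both call for a function on the whole plane
  product.\<close>

lemma continuous_extension:
  assumes "continuous_on (arc_space x) (\<phi> :: real \<times> complex \<Rightarrow> complex)"
  obtains \<Psi> where "continuous_on UNIV \<Psi>" "\<And>k. k \<in> arc_space x \<Longrightarrow> \<Psi> k = \<phi> k"
proof -
  have "closedin (top_of_set UNIV) (arc_space x)"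
    using compact_imp_closed[OF compact_arc_space] by simp
  then show ?thesis using Tietze_unbounded[OF assms] that by blast
qed

lemma measurable_spectrum_point: "spectrum_point x \<in> borel_measurable borel"
proof -
  have "level_height x \<in> borel_measurable borel"
    unfolding level_height_def by measurable
  moreover have "(\<lambda>t. cis (2 * pi * t)) \<in> borel_measurable borel"
    by (intro borel_measurable_continuous_onI continuous_intros)
  ultimately show ?thesis unfolding spectrum_point_def[abs_def] by (rule borel_measurable_Pair)
qed

lemma bounded_borel_fun_symbol:
  assumes "continuous_on (arc_space x) \<phi>"
  shows "bounded_borel (fun_symbol x \<phi>)"
proof -
  obtain \<Psi> where \<Psi>: "continuous_on UNIV \<Psi>" "\<And>k. k \<in> arc_space x \<Longrightarrow> \<Psi> k = \<phi> k"
    using continuous_extension[OF assms] by blast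
  have eq: "fun_symbol x \<phi> = (\<lambda>t. if 0 \<le> t then \<Psi> (spectrum_point x t) else 0)"
    by (auto simp: fun_symbol_def \<Psi>(2) spectrum_point_in)
  have "bounded (\<phi> ` arc_space x)"
    by (intro compact_imp_bounded compact_continuous_image compact_arc_space assms)
  then obtain C where C: "\<forall>k\<in>arc_space x. cmod (\<phi> k) \<le> C" by (auto simp: bounded_iff)
  have "(0, 1) \<in> arc_space x" by (simp add: arc_space_def)
  then have "0 \<le> C" using C norm_ge_zero order_trans by blast
  show ?thesis
  proof (rule bounded_borelI)
    have "(\<lambda>t. \<Psi> (spectrum_point x t)) \<in> borel_measurable borel"
      by (rule measurable_compose[OF measurable_spectrum_point borel_measurable_continuous_onI[OF \<Psi>(1)]])
    then show "fun_symbol x \<phi> \<in> borel_measurable borel" unfolding eq by measurable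
    show "cmod (fun_symbol x \<phi> t) \<le> C" for t
      using C \<open>0 \<le> C\<close> by (simp add: fun_symbol_def spectrum_point_in)
  qed
qed

text \<open>The half line covers the half-open arcs; their right ends are limits from the left. A
  point of the limit circle with parameter s is approached along s + n, whose height tends to 0
  whether or not the \<open>x N\<close> are bounded.\<close>

lemma spectrum_point_dense: "arc_space x \<subseteq> closure (spectrum_point x ` {0..})"
proof
  fix k assume "k \<in> arc_space x"
  then consider z where "k = (0, z)" "z \<in> sphere 0 1"
    | N t where "x N \<le> t" "t \<le> x (Suc N)" "k = (1 / real (Suc N), cis (2 * pi * t))"
    by (auto simp: arc_space_def arc_level_def)
  then show "k \<in> closure (spectrum_point x ` {0..})"
  proof cases
    case 1
    then obtain s where s: "0 \<le> s" "s < 1" "z = cis (2 * pi * s)"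
      using unit_circle_cis_2pi by (metis atLeastLessThan_iff)
    show ?thesis unfolding closure_approachable
    proof (intro allI impI)
      fix e :: real assume "0 < e"
      then obtain N where N: "1 / real (Suc N) < e" using nat_approx_posE by blast
      obtain n :: nat where n: "x N \<le> n" using real_arch_simple by blast
      have "level_height x (s + n) \<le> 1 / real (Suc N)" using s n by (intro level_height_le) auto
      moreover have "cis (2 * pi * (s + n)) = cis (2 * pi * s)" unfolding cis_2pi_eq_iff by simp
      ultimately have "dist (spectrum_point x (s + n)) k < e"
        using N level_height_nonneg[of "s + n"] 1 s
        by (simp add: spectrum_point_def dist_Pair_Pair dist_real_def)
      then show "\<exists>y\<in>spectrum_point x ` {0..}. dist y k < e"
        using s by (intro bexI[of _ "spectrum_point x (s + n)"]) auto
    qed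
  next
    case (2 N t)
    \<comment> \<open>Starts at \<open>x N\<close> and increases to t, staying strictly below it;
      this reaches t = \<open>x (Suc N)\<close>, whose own spectrum point is on the next
      level.\<close>
    define u where "u n = t - (t - x N) / real (Suc n)" for n
    show ?thesis
    proof (cases "t = x N")
      case True
      then have "k = spectrum_point x t"
        using 2 x_less[of N] level_height_arc[of N "x N"]
        by (simp add: spectrum_point_def)
      moreover have "0 \<le> t" using True x_nonneg by simp
      ultimately have "k \<in> spectrum_point x ` {0..}" by simp
      then show ?thesis by (rule subsetD[OF closure_subset])
    next
      case False
      then have pos: "0 < t - x N" using 2 by simp
      have u: "x N \<le> u n" "u n < x (Suc N)" for n
      proof -
        have "(t - x N) / real (Suc n) \<le> t - x N" "0 < (t - x N) / real (Suc n)"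
          using pos by (auto simp: divide_le_eq mult_le_cancel_left1)
        then show "x N \<le> u n" "u n < x (Suc N)" using 2 unfolding u_def by linarith+
      qed
      have "u \<longlonglongrightarrow> t - (t - x N) * 0"
        unfolding u_def divide_inverse using tendsto_heights
        by (intro tendsto_intros) (simp add: divide_inverse)
      then have "(\<lambda>n. (1 / real (Suc N), cis (2 * pi * u n))) \<longlonglongrightarrow> k"
        unfolding 2 by (auto intro!: tendsto_intros)
      moreover have "(1 / real (Suc N), cis (2 * pi * u n)) = spectrum_point x (u n)" for n
        by (simp add: spectrum_point_def level_height_arc[OF u])
      moreover have "0 \<le> u n" for n using u(1) x_nonneg order_trans by blast
      ultimately show ?thesis unfolding closure_sequential
        by (intro exI[of _ "\<lambda>n. spectrum_point x (u n)"]) auto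
    qed
  qed
qed

text \<open>With \<open>norm_fun_op_le\<close> this makes \<open>fun_op\<close> isometric for the
  supremum norm. The height is constant just to the right of every t \<ge> 0, so the symbol is
  nearly as large on an interval as at t; density covers the remaining points.\<close>

lemma norm_fun_op_ge:
  assumes \<phi>: "continuous_on (arc_space x) \<phi>" and k: "k \<in> arc_space x"
  shows "cmod (\<phi> k) \<le> norm (fun_op x \<phi>)"
proof -
  have half: "cmod (\<phi> (spectrum_point x t)) \<le> norm (fun_op x \<phi>)" if t: "0 \<le> t" for t
  proof (rule field_le_epsilon)
    fix e :: real assume e: "0 < e"
    obtain b where b: "t < b" "\<And>s. t \<le> s \<Longrightarrow> s < b \<Longrightarrow> level_height x s = level_height x t"
      using t
    proof (cases t rule: level_cases)
      case (arc N)
      show ?thesis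
        by (rule that[of "x (Suc N)"]) (use arc in \<open>auto simp: level_height_arc[of N]\<close>)
    next
      case beyond
      then have "level_height x s = 0" if "t \<le> s" for s using that by (intro level_height_beyond) (meson order_trans)
      then show ?thesis by (intro that[of "t + 1"]) auto
    qed
    have right_cont: "continuous_on {t..<b} (\<lambda>s. \<phi> (level_height x t, cis (2 * pi * s)))"
    proof (rule continuous_on_compose2[OF \<phi>])
      show "(\<lambda>s. (level_height x t, cis (2 * pi * s))) ` {t..<b} \<subseteq> arc_space x"
      proof
        fix p assume "p \<in> (\<lambda>s. (level_height x t, cis (2 * pi * s))) ` {t..<b}"
        then obtain s where "t \<le> s" "s < b" "p = (level_height x t, cis (2 * pi * s))" by auto
        then have "p = spectrum_point x s" using b(2)[of s] by (simp add: spectrum_point_def)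
        then show "p \<in> arc_space x" using spectrum_point_in[of s] t \<open>t \<le> s\<close> by simp
      qed
    qed (intro continuous_intros)
    have "t \<in> {t..<b}" using b(1) by simp
    from right_cont[unfolded continuous_on_iff, rule_format, OF this e]
    obtain d where d: "0 < d" "\<forall>s\<in>{t..<b}. dist s t < d \<longrightarrow>
        dist (\<phi> (level_height x t, cis (2 * pi * s))) (\<phi> (level_height x t, cis (2 * pi * t))) < e"
      by blast
    \<comment> \<open>The lower bound must be nonnegative to be squared.\<close>
    have "max 0 (cmod (\<phi> (spectrum_point x t)) - e) \<le> norm (mult_op (fun_symbol x \<phi>))"
    proof (rule norm_mult_op_ge[OF bounded_borel_fun_symbol[OF \<phi>]])
      show "t < min b (t + d)" using b(1) d(1) by simp
      fix s assume s: "t < s" "s < min b (t + d)"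
      then have "dist (\<phi> (spectrum_point x s)) (\<phi> (spectrum_point x t)) < e"
        using d(2)[rule_format, of s] b(2)[of s] by (simp add: spectrum_point_def dist_real_def)
      then have "cmod (\<phi> (spectrum_point x t)) - e \<le> cmod (\<phi> (spectrum_point x s))"
        using norm_triangle_ineq2[of "\<phi> (spectrum_point x t)" "\<phi> (spectrum_point x s)"]
        by (simp add: dist_norm norm_minus_commute)
      then show "max 0 (cmod (\<phi> (spectrum_point x t)) - e) \<le> cmod (fun_symbol x \<phi> s)"
        using s t by (simp add: fun_symbol_def)
    qed simp
    then show "cmod (\<phi> (spectrum_point x t)) \<le> norm (fun_op x \<phi>) + e"
      unfolding fun_op_def by linarith
  qed
  have "closure (spectrum_point x ` {0..}) \<subseteq> arc_space x"
    by (rule closure_minimal) (auto simp: spectrum_point_in compact_imp_closed compact_arc_space)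
  then have "continuous_on (closure (spectrum_point x ` {0..})) (\<lambda>k. cmod (\<phi> k))"
    by (intro continuous_intros continuous_on_subset[OF \<phi>])
  then show ?thesis
    by (rule continuous_le_on_closure) (use k spectrum_point_dense half in auto)
qed

lemma norm_fun_op_le:
  assumes "continuous_on (arc_space x) \<phi>" "\<And>k. k \<in> arc_space x \<Longrightarrow> cmod (\<phi> k) \<le> C" "0 \<le> C"
  shows "norm (fun_op x \<phi>) \<le> C"
  unfolding fun_op_def
  by (rule norm_mult_op_le[OF bounded_borel_fun_symbol[OF assms(1)]])
    (use assms in \<open>auto simp: fun_symbol_def spectrum_point_in\<close>)

lemma fun_op_cong: "(\<And>k. k \<in> arc_space x \<Longrightarrow> \<phi> k = \<psi> k) \<Longrightarrow> fun_op x \<phi> = fun_op x \<psi>"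
  unfolding fun_op_def by (rule arg_cong[of _ _ mult_op]) (auto simp: fun_symbol_def fun_eq_iff spectrum_point_in)

context
  fixes \<phi> \<psi> :: "real \<times> complex \<Rightarrow> complex"
  assumes \<phi>: "continuous_on (arc_space x) \<phi>" and \<psi>: "continuous_on (arc_space x) \<psi>"
begin

lemma fun_op_add: "fun_op x \<phi> + fun_op x \<psi> = fun_op x (\<lambda>k. \<phi> k + \<psi> k)"
  unfolding fun_op_def mult_op_add[OF bounded_borel_fun_symbol[OF \<phi>] bounded_borel_fun_symbol[OF \<psi>]]
  by (rule arg_cong[of _ _ mult_op]) (auto simp: fun_symbol_def fun_eq_iff)

lemma fun_op_diff: "fun_op x \<phi> - fun_op x \<psi> = fun_op x (\<lambda>k. \<phi> k - \<psi> k)"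
  unfolding fun_op_def mult_op_diff[OF bounded_borel_fun_symbol[OF \<phi>] bounded_borel_fun_symbol[OF \<psi>]]
  by (rule arg_cong[of _ _ mult_op]) (auto simp: fun_symbol_def fun_eq_iff)

lemma fun_op_mult: "fun_op x \<phi> o\<^sub>L fun_op x \<psi> = fun_op x (\<lambda>k. \<phi> k * \<psi> k)"
  unfolding fun_op_def mult_op_compose[OF bounded_borel_fun_symbol[OF \<phi>] bounded_borel_fun_symbol[OF \<psi>]]
  by (rule arg_cong[of _ _ mult_op]) (auto simp: fun_symbol_def fun_eq_iff)

lemma fun_op_scale: "scalar_op c o\<^sub>L fun_op x \<phi> = fun_op x (\<lambda>k. c * \<phi> k)"
  unfolding fun_op_def mult_op_compose[OF bounded_borel_const bounded_borel_fun_symbol[OF \<phi>]]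
  by (rule arg_cong[of _ _ mult_op]) (auto simp: fun_symbol_def fun_eq_iff)

lemma adj_fun_op: "adj (fun_op x \<phi>) = fun_op x (\<lambda>k. cnj (\<phi> k))"
  unfolding fun_op_def adj_mult_op[OF bounded_borel_fun_symbol[OF \<phi>]]
  by (rule arg_cong[of _ _ mult_op]) (auto simp: fun_symbol_def fun_eq_iff)

lemma fun_op_eq_iff: "fun_op x \<phi> = fun_op x \<psi> \<longleftrightarrow> (\<forall>k\<in>arc_space x. \<phi> k = \<psi> k)"
proof
  assume "fun_op x \<phi> = fun_op x \<psi>"
  then have "norm (fun_op x (\<lambda>k. \<phi> k - \<psi> k)) = 0" by (simp add: fun_op_diff[symmetric])
  moreover have "continuous_on (arc_space x) (\<lambda>k. \<phi> k - \<psi> k)" by (intro continuous_intros \<phi> \<psi>)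
  ultimately show "\<forall>k\<in>arc_space x. \<phi> k = \<psi> k" using norm_fun_op_ge by fastforce
qed (auto intro: fun_op_cong)

lemma fun_op_in_ops_on_H: "fun_op x \<phi> \<in> ops_on_H"
proof -
  have "projH o\<^sub>L mult_op (fun_symbol x \<phi>) o\<^sub>L projH = mult_op (fun_symbol x \<phi>)"
    unfolding projH_mult_op_projH[OF bounded_borel_fun_symbol[OF \<phi>]]
    by (rule arg_cong[of _ _ mult_op]) (auto simp: fun_symbol_def fun_eq_iff)
  then show ?thesis
    unfolding ops_on_H_def fun_op_def using clinear_mult_op[OF bounded_borel_fun_symbol[OF \<phi>]] by simp
qed

end

lemma fun_op_in: "continuous_on (arc_space x) \<phi> \<Longrightarrow> fun_op x \<phi> \<in> fun_algebra x"
  by (auto simp: fun_algebra_def)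

lemma fun_algebraE:
  assumes "T \<in> fun_algebra x"
  obtains \<phi> where "continuous_on (arc_space x) \<phi>" "T = fun_op x \<phi>"
  using assms by (auto simp: fun_algebra_def)

text \<open>By isometry, a norm convergent sequence of operators comes from a uniformly Cauchy
  sequence of functions, whose limit is continuous.\<close>

lemma closed_fun_algebra: "closed (fun_algebra x)"
  unfolding closed_sequential_limits
proof (intro allI impI, elim conjE)
  fix S T assume S: "\<forall>n. S n \<in> fun_algebra x" and lim: "S \<longlonglongrightarrow> T"
  then have "\<forall>n. \<exists>\<phi>. continuous_on (arc_space x) \<phi> \<and> S n = fun_op x \<phi>"
    by (auto simp: fun_algebra_def)
  then obtain \<phi> where \<phi>: "\<And>n. continuous_on (arc_space x) (\<phi> n)" "\<And>n. S n = fun_op x (\<phi> n)"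
    by metis
  have bound: "dist (\<phi> m k) (\<phi> n k) \<le> dist (S m) (S n)" if "k \<in> arc_space x" for m n k
    using norm_fun_op_ge[OF continuous_on_diff[OF \<phi>(1) \<phi>(1)] that]
    by (simp add: dist_norm \<phi>(2) fun_op_diff \<phi>(1))
  have "Cauchy S" using lim by (rule LIMSEQ_imp_Cauchy)
  then have "uniformly_Cauchy_on (arc_space x) \<phi>"
    unfolding uniformly_Cauchy_on_def Cauchy_def using bound by (meson le_less_trans)
  then obtain \<psi> where \<psi>: "uniform_limit (arc_space x) \<phi> \<psi> sequentially"
    using Cauchy_uniformly_convergent unfolding uniformly_convergent_on_def by blast
  have cont\<psi>: "continuous_on (arc_space x) \<psi>"
    by (rule uniform_limit_theorem[OF _ \<psi>]) (use \<phi> in auto)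
  have "S \<longlonglongrightarrow> fun_op x \<psi>"
  proof (rule tendstoI)
    fix e :: real assume e: "0 < e"
    then have "\<forall>\<^sub>F n in sequentially. \<forall>k\<in>arc_space x. dist (\<phi> n k) (\<psi> k) < e / 2"
      using \<psi> half_gt_zero[OF e] unfolding uniform_limit_iff by blast
    then show "\<forall>\<^sub>F n in sequentially. dist (S n) (fun_op x \<psi>) < e"
    proof eventually_elim
      case (elim n)
      have "norm (fun_op x (\<lambda>k. \<phi> n k - \<psi> k)) \<le> e / 2"
        by (rule norm_fun_op_le)
          (use elim e in \<open>auto simp: dist_norm less_imp_le intro!: continuous_intros \<phi> cont\<psi>\<close>)
      then show ?case using e by (simp add: dist_norm \<phi>(2) fun_op_diff[OF \<phi>(1) cont\<psi>])
    qed
  qed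
  then have "T = fun_op x \<psi>" using LIMSEQ_unique[OF lim] by blast
  then show "T \<in> fun_algebra x" using cont\<psi> by (simp add: fun_op_in)
qed

lemma cstar_subalgebra_fun_algebra: "cstar_subalgebra (fun_algebra x)"
  unfolding cstar_subalgebra_def
proof (intro conjI ballI allI closed_fun_algebra)
  show "fun_algebra x \<subseteq> ops_on_H"
    using fun_op_in_ops_on_H by (auto simp: fun_algebra_def)
  have "fun_op x (\<lambda>_. 0) = 0"
    unfolding fun_op_def fun_symbol_def[abs_def] by (simp add: mult_op_zero)
  then show "0 \<in> fun_algebra x" using fun_op_in[of "\<lambda>_. 0"] by simp
  fix S T :: "L2 \<Rightarrow>\<^sub>L L2" and c :: complex
  assume "S \<in> fun_algebra x"
  then obtain \<phi> where \<phi>: "continuous_on (arc_space x) \<phi>" "S = fun_op x \<phi>" by (rule fun_algebraE)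
  show "scalar_op c o\<^sub>L S \<in> fun_algebra x" "adj S \<in> fun_algebra x"
    unfolding \<phi> fun_op_scale[OF \<phi>(1) \<phi>(1)] adj_fun_op[OF \<phi>(1) \<phi>(1)]
    by (intro fun_op_in continuous_intros \<phi>)+
  assume "T \<in> fun_algebra x"
  then obtain \<psi> where \<psi>: "continuous_on (arc_space x) \<psi>" "T = fun_op x \<psi>" by (rule fun_algebraE)
  show "S + T \<in> fun_algebra x" "S o\<^sub>L T \<in> fun_algebra x"
    unfolding \<phi> \<psi> fun_op_add[OF \<phi>(1) \<psi>(1)] fun_op_mult[OF \<phi>(1) \<psi>(1)]
    by (intro fun_op_in continuous_intros \<phi> \<psi>)+
qed

text \<open>The cut-off \<open>max 0 (min 1 ((n + 1) (1 - n r)))\<close> of the height \<open>r\<close> is \<open>1\<close> from level \<open>n\<close> on and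
  \<open>0\<close> on the levels before.\<close>

lemma tail_op_in_fun_algebra:
  assumes b: "continuous_on UNIV b" "\<And>t. b (t + 1) = b t"
  shows "tail_op x n b \<in> fun_algebra x"
proof -
  obtain B where B: "continuous_on (sphere 0 1) B" "\<And>t. B (cis (2 * pi * t)) = b t"
    using periodic_descends_to_circle[OF b] by blast
  \<comment> \<open>Inside the clipping stands, for n > 0, the affine function that is 0 at 1 / n
    and 1 at 1 / (n + 1), the heights of the levels n - 1 and n.\<close>
  define \<theta> where "\<theta> r = max 0 (min 1 (real (Suc n) * (1 - real n * r)))" for r :: real
  define \<phi> where "\<phi> k = of_real (\<theta> (fst k)) * B (snd k)" for k
  have "continuous_on (arc_space x) (\<lambda>k. B (snd k))"
    by (rule continuous_on_compose2[OF B(1)])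
      (auto intro!: continuous_intros simp: arc_space_def arc_level_def)
  then have "continuous_on (arc_space x) \<phi>"
    unfolding \<phi>_def \<theta>_def by (intro continuous_intros)
  moreover have "(if x n \<le> t then b t else 0) = fun_symbol x \<phi> t" for t
  proof (cases "0 \<le> t")
    case True
    have "\<theta> (level_height x t) = (if x n \<le> t then 1 else 0)"
    proof (cases "x n \<le> t")
      case le: True
      have "real n * level_height x t \<le> real n * (1 / real (Suc n))"
        by (intro mult_left_mono level_height_le True le) simp
      then have "real (Suc n) * (1 - real n * (1 / real (Suc n))) \<le> real (Suc n) * (1 - real n * level_height x t)"
        by (intro mult_left_mono) auto
      moreover have "real (Suc n) * (1 - real n * (1 / real (Suc n))) = 1" by (simp add: field_simps)
      ultimately have "1 \<le> real (Suc n) * (1 - real n * level_height x t)" by (simp only:)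
      then show ?thesis using le unfolding \<theta>_def by (simp only: min_absorb1) simp
    next
      case False
      then obtain m where m: "n = Suc m" using True x0 by (cases n) auto
      have "real n * (1 / real n) \<le> real n * level_height x t"
        using False level_height_ge[OF True, of m] m by (intro mult_left_mono) auto
      then have "1 - real n * level_height x t \<le> 0" using m by simp
      then have "real (Suc n) * (1 - real n * level_height x t) \<le> 0"
        by (intro mult_nonneg_nonpos) auto
      then show ?thesis using False by (simp add: \<theta>_def)
    qed
    then show ?thesis using True by (simp add: fun_symbol_def \<phi>_def spectrum_point_def B)
  next
    case False
    then show ?thesis using x_nonneg[of n] by (simp add: fun_symbol_def)
  qed
  ultimately show ?thesis unfolding tail_op_def using fun_op_in[of \<phi>] by (simp add: fun_op_def)
qed

text \<open>Freezing the heights below \<open>1 / (K + 1)\<close> turns a function on the spectrum into a finite sum of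
  symbols of the operators \<open>tail_op x n b\<close>.\<close>

lemma fun_algebra_subset:
  assumes X: "cstar_subalgebra X"
    and tails: "\<And>n b. continuous_on UNIV b \<Longrightarrow> (\<And>t. b (t + 1) = b t) \<Longrightarrow> tail_op x n b \<in> X"
  shows "fun_algebra x \<subseteq> X"
proof
  fix T assume "T \<in> fun_algebra x"
  then obtain \<phi> where \<phi>: "continuous_on (arc_space x) \<phi>" "T = fun_op x \<phi>" by (rule fun_algebraE)
  obtain \<Psi> where \<Psi>: "continuous_on UNIV \<Psi>" "\<And>k. k \<in> arc_space x \<Longrightarrow> \<Psi> k = \<phi> k"
    using continuous_extension[OF \<phi>(1)] by blast
  define b where "b N t = \<Psi> (1 / real (Suc N), cis (2 * pi * t))" for N t
  have cis1: "cis (2 * pi * (t + 1)) = cis (2 * pi * t)" for t unfolding cis_2pi_eq_iff by simp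
  have b: "continuous_on UNIV (b N)" "b N (t + 1) = b N t" for N t
    unfolding b_def cis1 by (auto intro!: continuous_on_compose2[OF \<Psi>(1)] continuous_intros)
  define \<phi>' where "\<phi>' K k = \<Psi> (max (fst k) (1 / real (Suc K)), snd k)" for K k
  have \<phi>': "continuous_on S (\<phi>' K)" for K S
    unfolding \<phi>'_def by (intro continuous_on_compose2[OF \<Psi>(1)] continuous_intros) auto
  have in_X: "fun_op x (\<phi>' K) \<in> X" for K
  proof (induction K)
    case 0
    have "fun_symbol x (\<phi>' 0) = (\<lambda>t. if x 0 \<le> t then b 0 t else 0)"
    proof
      fix t
      have "max (level_height x t) 1 = 1" if "0 \<le> t"
        using level_height_le[OF that, of 0] that x0 by simp
      then show "fun_symbol x (\<phi>' 0) t = (if x 0 \<le> t then b 0 t else 0)"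
        by (simp add: fun_symbol_def \<phi>'_def b_def spectrum_point_def x0)
    qed
    then show ?case using tails[OF b, of 0 0] by (simp add: fun_op_def tail_op_def)
  next
    case (Suc K)
    have bd: "continuous_on UNIV (\<lambda>t. b (Suc K) t - b K t)"
      "b (Suc K) (t + 1) - b K (t + 1) = b (Suc K) t - b K t" for t
      by (auto intro!: continuous_intros b simp: b(2))
    have "(\<lambda>t. fun_symbol x (\<phi>' K) t + (if x (Suc K) \<le> t then b (Suc K) t - b K t else 0))
      = fun_symbol x (\<phi>' (Suc K))"
    proof
      fix t
      consider "t < 0" | "0 \<le> t" "t < x (Suc K)" | "0 \<le> t" "x (Suc K) \<le> t" by linarith
      then show "fun_symbol x (\<phi>' K) t + (if x (Suc K) \<le> t then b (Suc K) t - b K t else 0)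
        = fun_symbol x (\<phi>' (Suc K)) t"
      proof cases
        case 1
        then show ?thesis using x_nonneg[of "Suc K"] by (simp add: fun_symbol_def)
      next
        case 2
        have "1 / real (Suc (Suc K)) \<le> 1 / real (Suc K)" by (simp add: field_simps)
        then have "max (level_height x t) (1 / real (Suc K)) = level_height x t"
          "max (level_height x t) (1 / real (Suc (Suc K))) = level_height x t"
          using level_height_ge[OF 2] by linarith+
        then show ?thesis using 2 by (simp add: fun_symbol_def \<phi>'_def spectrum_point_def)
      next
        case 3
        have "1 / real (Suc (Suc K)) \<le> 1 / real (Suc K)" by (simp add: field_simps)
        then have "max (level_height x t) (1 / real (Suc K)) = 1 / real (Suc K)"
          "max (level_height x t) (1 / real (Suc (Suc K))) = 1 / real (Suc (Suc K))"
          using level_height_le[OF 3] by linarith+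
        then show ?thesis using 3 by (simp add: fun_symbol_def \<phi>'_def spectrum_point_def b_def)
      qed
    qed
    then have "fun_op x (\<phi>' (Suc K)) = fun_op x (\<phi>' K) + tail_op x (Suc K) (\<lambda>t. b (Suc K) t - b K t)"
      unfolding fun_op_def tail_op_def
      by (subst mult_op_add)
        (auto intro!: bounded_borel_fun_symbol \<phi>' bounded_borel_restrict bounded_borel_periodic bd)
    then show ?case using Suc tails[OF bd] X by (simp add: cstar_subalgebra_def)
  qed
  have lim: "(\<lambda>K. fun_op x (\<phi>' K)) \<longlonglongrightarrow> T"
  proof (rule tendstoI)
    fix e :: real assume e: "0 < e"
    let ?C = "{0..1::real} \<times> sphere (0::complex) 1"
    have "uniformly_continuous_on ?C \<Psi>"
      by (intro compact_uniformly_continuous continuous_on_subset[OF \<Psi>(1)] compact_Times) auto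
    then obtain d where d: "0 < d" "\<And>p q. p \<in> ?C \<Longrightarrow> q \<in> ?C \<Longrightarrow> dist p q < d \<Longrightarrow> dist (\<Psi> p) (\<Psi> q) < e / 2"
      using half_gt_zero[OF e] unfolding uniformly_continuous_on_def by (metis dist_commute)
    have sub: "arc_space x \<subseteq> ?C"
      by (auto simp: arc_space_def arc_level_def)
    have "\<forall>\<^sub>F K in sequentially. 1 / real (Suc K) < d"
      using order_tendstoD(2)[OF tendsto_heights d(1)] .
    then show "\<forall>\<^sub>F K in sequentially. dist (fun_op x (\<phi>' K)) T < e"
    proof eventually_elim
      case (elim K)
      have "norm (fun_op x (\<lambda>k. \<phi>' K k - \<phi> k)) \<le> e / 2"
      proof (rule norm_fun_op_le)
        fix k assume k: "k \<in> arc_space x"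
        then have kC: "k \<in> ?C" using sub by blast
        let ?k = "(max (fst k) (1 / real (Suc K)), snd k)"
        have "?k \<in> ?C" using kC by (auto simp: max_def)
        moreover have "dist ?k k < d"
          using kC elim d(1) by (cases k) (auto simp: dist_Pair_Pair dist_real_def max_def)
        ultimately have "dist (\<Psi> ?k) (\<Psi> k) < e / 2" using kC d(2) by blast
        then show "cmod (\<phi>' K k - \<phi> k) \<le> e / 2" using k by (simp add: \<phi>'_def \<Psi>(2) dist_norm)
      qed (use e in \<open>auto intro!: continuous_intros \<phi>' \<phi>\<close>)
      then show ?case using e by (simp add: dist_norm \<phi>(2) fun_op_diff[OF \<phi>' \<phi>(1)])
    qed
  qed
  have "closed X" using X by (simp add: cstar_subalgebra_def)
  then show "T \<in> X" by (rule closed_sequentially) (rule in_X, rule lim)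
qed

end

section \<open>From isomorphic algebras to equal rotation numbers\<close>

lemma fun_algebra_isomorphic_imp_homeomorphic:
  assumes "breakpoints x" "breakpoints y" and iso: "cstar_isomorphic (fun_algebra x) (fun_algebra y)"
  shows "arc_space y homeomorphic arc_space x"
proof -
  interpret x: breakpoints x by fact
  interpret y: breakpoints y by fact
  let ?C = "\<lambda>x \<phi>. continuous_on (arc_space x) (\<phi> :: real \<times> complex \<Rightarrow> complex)"
  obtain \<Phi> where bij: "bij_betw \<Phi> (fun_algebra x) (fun_algebra y)"
    and hom: "\<And>S T. S \<in> fun_algebra x \<Longrightarrow> T \<in> fun_algebra x \<Longrightarrow> \<Phi> (S + T) = \<Phi> S + \<Phi> T"
      "\<And>S T. S \<in> fun_algebra x \<Longrightarrow> T \<in> fun_algebra x \<Longrightarrow> \<Phi> (S o\<^sub>L T) = \<Phi> S o\<^sub>L \<Phi> T"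
      "\<And>c T. T \<in> fun_algebra x \<Longrightarrow> \<Phi> (scalar_op c o\<^sub>L T) = scalar_op c o\<^sub>L \<Phi> T"
    using iso unfolding cstar_isomorphic_def by blast
  \<comment> \<open>A representative is chosen because \<open>fun_op y\<close> determines a function
    only on \<open>arc_space y\<close>.\<close>
  define T where "T \<phi> = (SOME \<psi>. ?C y \<psi> \<and> \<Phi> (fun_op x \<phi>) = fun_op y \<psi>)" for \<phi>
  have T: "?C y (T \<phi>)" "\<Phi> (fun_op x \<phi>) = fun_op y (T \<phi>)" if "?C x \<phi>" for \<phi>
  proof -
    have "\<Phi> (fun_op x \<phi>) \<in> fun_algebra y"
      using bij x.fun_op_in[OF that] by (auto simp: bij_betw_def)
    then have "\<exists>\<psi>. ?C y \<psi> \<and> \<Phi> (fun_op x \<phi>) = fun_op y \<psi>" by (auto simp: fun_algebra_def)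
    then have "?C y (T \<phi>) \<and> \<Phi> (fun_op x \<phi>) = fun_op y (T \<phi>)" unfolding T_def by (rule someI_ex)
    then show "?C y (T \<phi>)" "\<Phi> (fun_op x \<phi>) = fun_op y (T \<phi>)" by auto
  qed
  have T_eq: "T \<phi> l = \<psi> l" if "?C x \<phi>" "?C y \<psi>" "\<Phi> (fun_op x \<phi>) = fun_op y \<psi>" "l \<in> arc_space y" for \<phi> \<psi> l
    using y.fun_op_eq_iff[OF T(1)[OF that(1)] that(2)] T(2)[OF that(1)] that by simp
  have surj: "\<exists>\<phi>. ?C x \<phi> \<and> \<Phi> (fun_op x \<phi>) = fun_op y \<psi>" if "?C y \<psi>" for \<psi>
  proof -
    have "fun_op y \<psi> \<in> \<Phi> ` fun_algebra x"
      using bij y.fun_op_in[OF that] by (simp add: bij_betw_def)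
    then show ?thesis by (auto simp: fun_algebra_def)
  qed
  \<comment> \<open>Preservation of the unit is not part of \<open>cstar_isomorphic\<close>. It
    follows from surjectivity: \<Phi> 1 times the unit, written as the image of some \<phi>, is the
    image of \<phi> again.\<close>
  have one: "\<Phi> (fun_op x (\<lambda>_. 1)) = fun_op y (\<lambda>_. 1)"
  proof -
    have c1: "?C x (\<lambda>_. 1)" "?C y (\<lambda>_. 1)" by (intro continuous_intros)+
    obtain \<phi> where \<phi>: "?C x \<phi>" "\<Phi> (fun_op x \<phi>) = fun_op y (\<lambda>_. 1)" using surj[OF c1(2)] by blast
    have "fun_op y (\<lambda>_. 1) = \<Phi> (fun_op x (\<lambda>_. 1) o\<^sub>L fun_op x \<phi>)"
      by (simp add: x.fun_op_mult[OF c1(1) \<phi>(1)] \<phi>(2))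
    also have "\<dots> = \<Phi> (fun_op x (\<lambda>_. 1)) o\<^sub>L \<Phi> (fun_op x \<phi>)"
      by (intro hom x.fun_op_in c1 \<phi>)
    also have "\<dots> = fun_op y (T (\<lambda>_. 1))"
      using y.fun_op_mult[OF T(1)[OF c1(1)] c1(2)] by (simp add: T(2)[OF c1(1)] \<phi>(2))
    finally show ?thesis by (simp add: T(2)[OF c1(1)])
  qed
  show ?thesis
  proof (rule function_algebra_isomorphism_homeomorphism[of "arc_space x" "arc_space y" T])
    show "compact (arc_space x)" "compact (arc_space y)" by (rule compact_arc_space)+
    show "?C y (T f)" if "?C x f" for f by (rule T(1)[OF that])
    show "(\<forall>l\<in>arc_space y. T f l = T g l) \<longleftrightarrow> (\<forall>k\<in>arc_space x. f k = g k)"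
      if fg: "?C x f" "?C x g" for f g
    proof -
      have "(\<forall>l\<in>arc_space y. T f l = T g l) \<longleftrightarrow> \<Phi> (fun_op x f) = \<Phi> (fun_op x g)"
        by (simp add: T fg y.fun_op_eq_iff)
      also have "\<dots> \<longleftrightarrow> fun_op x f = fun_op x g"
        using bij by (intro inj_on_eq_iff[of \<Phi> "fun_algebra x"]) (auto simp: bij_betw_def x.fun_op_in fg)
      finally show ?thesis by (simp add: fg x.fun_op_eq_iff)
    qed
    show "\<exists>f. ?C x f \<and> (\<forall>l\<in>arc_space y. T f l = g l)" if g: "?C y g" for g
      using surj[OF g] T_eq[OF _ g] by blast
    show "T (\<lambda>k. f k + g k) l = T f l + T g l" if fg: "?C x f" "?C x g" and l: "l \<in> arc_space y" for f g l
    proof (rule T_eq[OF _ _ _ l])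
      show "\<Phi> (fun_op x (\<lambda>k. f k + g k)) = fun_op y (\<lambda>l. T f l + T g l)"
        by (simp add: x.fun_op_add[symmetric] y.fun_op_add[symmetric] fg hom x.fun_op_in T)
    qed (intro continuous_intros fg T)+
    show "T (\<lambda>k. f k * g k) l = T f l * T g l" if fg: "?C x f" "?C x g" and l: "l \<in> arc_space y" for f g l
    proof (rule T_eq[OF _ _ _ l])
      show "\<Phi> (fun_op x (\<lambda>k. f k * g k)) = fun_op y (\<lambda>l. T f l * T g l)"
        by (simp add: x.fun_op_mult[symmetric] y.fun_op_mult[symmetric] fg hom x.fun_op_in T)
    qed (intro continuous_intros fg T)+
    show "T (\<lambda>_. c) l = c" if l: "l \<in> arc_space y" for c l
    proof (rule T_eq[OF _ _ _ l])
      \<comment> \<open>The unit \<open>fun_op x (\<lambda>_. 1)\<close> is \<open>projH\<close> and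
        not the identity, so constants are scalar multiples of it.\<close>
      have "fun_op x (\<lambda>_. c) = scalar_op c o\<^sub>L fun_op x (\<lambda>_. 1)"
        by (simp add: x.fun_op_scale[of "\<lambda>_. 1" "\<lambda>_. 1"])
      then show "\<Phi> (fun_op x (\<lambda>_. c)) = fun_op y (\<lambda>_. c)"
        by (simp add: hom x.fun_op_in one y.fun_op_scale[of "\<lambda>_. 1" "\<lambda>_. 1"])
    qed (intro continuous_intros)+
  qed
qed

text \<open>Every power of \<gamma> commutes with the translation by 1, so composing with it
  permutes the continuous periodic functions. The generators are therefore all the operators
  \<open>tail_op x n b\<close>; they lie in the closed algebra \<open>fun_algebra x\<close> and
  generate it.\<close>

lemma
  assumes homeo: "orientation_preserving_homeo \<alpha>" "\<alpha> 1 \<noteq> 1"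
    and W: "induces (normalized_lift \<alpha>) (bbU \<alpha>)" "unitary_op (bbU \<alpha>)"
  defines "x \<equiv> \<lambda>n. (normalized_lift \<alpha> ^^ n) 0"
  shows breakpoints_orbit: "breakpoints x"
    and circle_algebra_eq: "circle_algebra \<alpha> = fun_algebra x"
proof -
  define \<gamma> where "\<gamma> = normalized_lift \<alpha>"
  note \<gamma>0 = normalized_lift(2,3)[OF homeo, folded \<gamma>_def]
  interpret degree_one_lift \<gamma> using degree_one_normalized_lift[OF homeo] by (simp add: \<gamma>_def)
  interpret i: degree_one_lift "inv \<gamma>" by (rule inv_lift)
  have x_eq: "x n = (\<gamma> ^^ n) 0" for n by (simp add: x_def \<gamma>_def)
  show "breakpoints x"
    by unfold_locales (use orbit_of_0_increasing[OF \<gamma>0] in \<open>simp_all add: x_eq\<close>)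
  then interpret breakpoints x .
  define G where "G = (\<Union>n. (\<lambda>A. op_power (adj (compr_U \<alpha>)) n o\<^sub>L A o\<^sub>L op_power (compr_U \<alpha>) n)
            ` periodic_mult_algebra)"
  have gen: "op_power (adj (compr_U \<alpha>)) n o\<^sub>L (projH o\<^sub>L mult_op a o\<^sub>L projH) o\<^sub>L op_power (compr_U \<alpha>) n
      = tail_op x n (\<lambda>t. a ((inv \<gamma> ^^ n) t))"
    if "continuous_on UNIV a" "\<And>t. a (t + 1) = a t" for a n
    using compression_of_mult_op[OF degree_one_lift_axioms W[folded \<gamma>_def]
        bounded_borel_periodic[OF that] \<gamma>0(1), of n]
    by (simp add: compr_U_def tail_op_def x_eq)
  have "G \<subseteq> fun_algebra x"
  proof
    fix S assume "S \<in> G"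
    then obtain n a where a: "continuous_on UNIV a" "\<And>t. a (t + 1) = a t"
      and S: "S = op_power (adj (compr_U \<alpha>)) n o\<^sub>L (projH o\<^sub>L mult_op a o\<^sub>L projH) o\<^sub>L op_power (compr_U \<alpha>) n"
      unfolding G_def periodic_mult_algebra_def by blast
    interpret it: degree_one_lift "inv \<gamma> ^^ n" by (rule i.iterate)
    show "S \<in> fun_algebra x"
      unfolding S gen[OF a]
      by (rule tail_op_in_fun_algebra) (auto intro: continuous_on_compose2[OF a(1) it.cont] simp: it.add_1 a(2))
  qed
  moreover have "fun_algebra x \<subseteq> X" if X: "cstar_subalgebra X" "G \<subseteq> X" for X
  proof (rule fun_algebra_subset[OF X(1)])
    fix n and b :: "real \<Rightarrow> complex" assume b: "continuous_on UNIV b" "\<And>t. b (t + 1) = b t"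
    interpret it: degree_one_lift "\<gamma> ^^ n" by (rule iterate)
    \<comment> \<open>Chosen to undo the inverse iterate that the compression introduces.\<close>
    define a where "a t = b ((\<gamma> ^^ n) t)" for t
    have a: "continuous_on UNIV a" "\<And>t. a (t + 1) = a t"
      unfolding a_def by (auto intro: continuous_on_compose2[OF b(1) it.cont] simp: it.add_1 b(2))
    have "op_power (adj (compr_U \<alpha>)) n o\<^sub>L (projH o\<^sub>L mult_op a o\<^sub>L projH) o\<^sub>L op_power (compr_U \<alpha>) n \<in> G"
      unfolding G_def periodic_mult_algebra_def using a by blast
    moreover have "(\<gamma> ^^ n) ((inv \<gamma> ^^ n) t) = t" for t
      using fun_cong[OF fn_o_inv_fn_is_id[OF bij, of n], of t] by simp
    ultimately show "tail_op x n b \<in> X" using X(2) unfolding gen[OF a] by (auto simp: a_def)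
  qed
  ultimately show "circle_algebra \<alpha> = fun_algebra x"
    unfolding circle_algebra_def cstar_generated_def G_def[symmetric]
    using cstar_subalgebra_fun_algebra by blast
qed

text \<open>The equality is found for the real translation numbers of the normalized lifts;
  \<open>frac\<close> is applied only at the end. The homeomorphism of spectra runs opposite to the
  isomorphism of algebras, from \<beta> to \<alpha>.\<close>

theorem theorem4p7:
  fixes \<alpha> \<beta> :: "complex \<Rightarrow> complex"
  assumes "orientation_preserving_homeo \<alpha>" and "orientation_preserving_homeo \<beta>"
    and "\<alpha> 1 \<noteq> 1" and "\<beta> 1 \<noteq> 1"
    and "induces (normalized_lift \<alpha>) (bbU \<alpha>)" and "unitary_op (bbU \<alpha>)"
    and "induces (normalized_lift \<beta>) (bbU \<beta>)" and "unitary_op (bbU \<beta>)"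
    and "cstar_isomorphic (circle_algebra \<alpha>) (circle_algebra \<beta>)"
  shows "rotation_number \<alpha> = rotation_number \<beta>"
proof -
  note \<alpha> = assms(1,3) and \<beta> = assms(2,4)
  have "arc_space (\<lambda>n. (normalized_lift \<beta> ^^ n) 0) homeomorphic arc_space (\<lambda>n. (normalized_lift \<alpha> ^^ n) 0)"
    using assms(9) fun_algebra_isomorphic_imp_homeomorphic
      [OF breakpoints_orbit[OF \<alpha> assms(5,6)] breakpoints_orbit[OF \<beta> assms(7,8)]]
    by (simp add: circle_algebra_eq[OF \<alpha> assms(5,6)] circle_algebra_eq[OF \<beta> assms(7,8)])
  then obtain h h' where "homeomorphism (arc_space (\<lambda>n. (normalized_lift \<beta> ^^ n) 0))
      (arc_space (\<lambda>n. (normalized_lift \<alpha> ^^ n) 0)) h h'"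
    unfolding homeomorphic_def by blast
  then have "degree_one_lift.translation_number (normalized_lift \<beta>) =
      degree_one_lift.translation_number (normalized_lift \<alpha>)"
    by (intro translation_number_eq_of_homeomorphism degree_one_normalized_lift
        normalized_lift(2,3)[OF \<alpha>] normalized_lift(2,3)[OF \<beta>] \<alpha> \<beta>)
  then show ?thesis
    by (simp add: rotation_number_eq[OF \<alpha>] rotation_number_eq[OF \<beta>])
qed

end
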